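(* Let $f:\mathbb R^n\to\mathbb R$ be convex with locally Lipschitz continuous gradient, $g:\mathbb R^n\to\mathbb R\cup\{\infty\}$ and $h:\mathbb R^m\to\mathbb R\cup\{\infty\}$ be proper, convex and lsc, and $A:\mathbb R^n\to\mathbb R^m$ be linear. Suppose that $\varphi(x):=f(x)+g(x)+h(Ax)$ has a minimizer, and that there exists $x\in\operatorname{relint}\operatorname{dom}g$ with $Ax\in\operatorname{relint}\operatorname{dom}h$. Let $t>0$, $\epsilon\ge0$ and $\nu>1+\epsilon$ be fixed. Consider a sequence $(x^k,y^k)_{k\ge1}$ generated by $$\begin{aligned}y^{k+1}&=\operatorname{prox}_{\sigma_{k+1}h^*}\Bigl(y^k+\sigma_{k+1}\bigl((1+\tfrac{\gamma_{k+1}}{\gamma_k})Ax^k-\tfrac{\gamma_{k+1}}{\gamma_k}Ax^{k-1}\bigr)\Bigr),\\ x^{k+1}&=\operatorname{prox}_{\gamma_{k+1}g}\bigl(x^k-\gamma_{k+1}\nabla f(x^k)-\gamma_{k+1}A^\top y^{k+1}\bigr),\end{aligned}$$ starting from a triplet $(x^{-1},x^0,y^0)\in\mathbb R^n\times\mathbb R^n\times\mathbb R^m$ and with initial primal stepsizes $\gamma_0\ge\gamma_{-1}>0$. Denote $\xi_k:=t^2\eta_k^2\gamma_k^2$ and $\delta_k:=\gamma_k\ell_k(\gamma_kc_k-1)$, with $\ell_k,c_k$ as in the context, where $\eta_0\le\frac1{2\nu t\gamma_0}$ and, for $k\in\mathbb N$, $\eta_{k+1}$ is any number such that $\frac{\|A^\top(y^k-y^{k+1})\|}{\|y^k-y^{k+1}\|}\le\eta_{k+1}\le\eta_{\max}$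 for some $\eta_{\max}<\infty$. Suppose that for all $k\in\mathbb N$ the stepsizes satisfy $\sigma_k=t^2\gamma_k$ and $$\gamma_{k+1}=\min\left\{\gamma_k\sqrt{1+\tfrac{\gamma_k}{\gamma_{k-1}}},\ \frac1{2\nu t\eta_{k+1}},\ \gamma_k\sqrt{\frac{1-4\xi_k(1+\epsilon)^2}{2(1+\epsilon)\Bigl(\sqrt{\delta_k^2+(t\eta_{k+1}\gamma_k)^2(1-4\xi_k(1+\epsilon)^2)}+\delta_k\Bigr)}}\right\}.$$ Let $\rho_k:=\gamma_k/\gamma_{k-1}$. Then, for any primal-dual solution $(x^\star,y^\star)$, with $P_k,Q_k$ as in the context and $$\mathcal U_k:=\tfrac12\|x^k-x^\star\|^2+\tfrac{1-4\xi_k(1+\epsilon)}4\|x^k-x^{k-1}\|^2+\tfrac1{2t^2}\|y^k-y^\star\|^2+\gamma_k(1+\rho_k)P_{k-1},$$ the following hold. (i) For all $k\ge1$, $$\mathcal U_{k+1}\le\mathcal U_k-\tfrac{\epsilon}{2t^2(1+\epsilon)}\|y^k-y^{k-1}\|^2-\tfrac{1-4\xi_k-4\rho_{k+1}^2(\delta_k+\xi_{k+1})}4\|x^k-x^{k+1}\|^2-\gamma_k(1+\rho_k-\rho_{k+1}^2)P_{k-1}-\gamma_{k+1}Q_{k+1},$$ where $\tfrac{1-4\xi_k-4\rho_{k+1}^2(\delta_k+\xi_{k+1})}4\ge\tfrac{\epsilon}{4(1+\epsilon)}$ and $1+\rho_k-\rho_{k+1}^2\ge0$. (ii) The sequence $(x^k,y^k)$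 is bounded, and $\gamma_k\ge\hat\gamma>0$ for all $k\ge1$, where, with $\bar\nu:=\frac{\nu^2-(1+\epsilon)^2}{\nu^2}$, $\mathcal V$ a compact convex set containing the sequence $(x^k)$, $\overline{\mathcal V}:=\mathcal V+\{x:\|x\|\le\operatorname{diam}\mathcal V\}$ and $L_{f,\overline{\mathcal V}}>0$ a Lipschitz modulus of $\nabla f$ on $\overline{\mathcal V}$, $$\hat\gamma:=\min\left\{\gamma_0,\ \tfrac{\bar\nu^{1/4}}{\sqrt{2(1+\epsilon)t\eta_{\max}L_{f,\overline{\mathcal V}}}},\ \tfrac{\sqrt{\bar\nu}}{2\sqrt{1+\epsilon}\,L_{f,\overline{\mathcal V}}},\ \tfrac1{2\nu t\eta_{\max}},\ \tfrac{\sqrt{\bar\nu}}{2(1+\epsilon)t\eta_{\max}}\right\}.$$ (iii) $\liminf_{k\to\infty}P_k=\lim_{k\to\infty}Q_k=0$. (iv) If $\epsilon>0$, the sequence $(x^k,y^k)$ converges to a primal-dual solution.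
   Context: Norms and inner products are Euclidean, $h^*$ is the convex conjugate of $h$, and $\operatorname{prox}_{\tau g}(x):=\operatorname{argmin}_{w}\{g(w)+\frac1{2\tau}\|w-x\|^2\}$ for $\tau>0$. A differentiable $f$ has locally Lipschitz continuous gradient if for every convex compact $\mathcal V\subset\mathbb R^n$ there is $L_{f,\mathcal V}>0$ (a Lipschitz modulus) with $\|\nabla f(x)-\nabla f(x')\|\le L_{f,\mathcal V}\|x-x'\|$ on $\mathcal V$. $\operatorname{diam}\mathcal V:=\sup_{x,y\in\mathcal V}\|x-y\|$. A pair $(x^\star,y^\star)$ is a primal-dual solution if $0\in-Ax^\star+\partial h^*(y^\star)$ and $0\in A^\top y^\star+\nabla f(x^\star)+\partial g(x^\star)$. Given such a pair, $$P_k:=(f+g)(x^k)-(f+g)(x^\star)+\langle x^k-x^\star,A^\top y^\star\rangle,\qquad Q_k:=h^*(y^k)-h^*(y^\star)+\langle Ax^\star,y^\star-y^k\rangle.$$ The local estimates are $$\ell_k:=\frac{\langle\nabla f(x^{k-1})-\nabla f(x^k),x^{k-1}-x^k\rangle}{\|x^{k-1}-x^k\|^2},\qquad c_k:=\frac{\|\nabla f(x^{k-1})-\nabla f(x^k)\|^2}{\langle\nabla f(x^{k-1})-\nabla f(x^k),x^{k-1}-x^k\rangle}.$$ Throughout, the conventions $\frac00=0$ and $\frac10=\infty$ are used.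
   Formalization: (i) is false as printed; proved with y^{k+1}-y^k, x^k-x^{k-1} and coefficient (1-4ξ_k(1+ε)-4ρ_{k+1}²(δ_k+ξ_{k+1}(1+ε)))/4, still ≥ ε/(4(1+ε)). Also η_0≥0 is assumed, and V contains x^{-1}, x^0 too. *)

theory Defs
  imports "HOL-Analysis.Analysis"
begin

unbundle lipschitz_syntax

text \<open>Functions into \<open>\<real> \<union> {\<infinity>}\<close> are functions into \<^typ>\<open>ereal\<close> that never take the value
  \<open>-\<infinity>\<close>; this is part of \<open>proper_fun\<close>.\<close>

definition proper_fun :: "('a \<Rightarrow> ereal) \<Rightarrow> bool" where
  "proper_fun h \<longleftrightarrow> (\<forall>x. h x \<noteq> -\<infinity>) \<and> (\<exists>x. h x \<noteq> \<infinity>)"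

definition eff_dom :: "('a \<Rightarrow> ereal) \<Rightarrow> 'a set" where
  "eff_dom h = {x. h x < \<infinity>}"

text \<open>Since \<open>0 * \<infinity> = 0\<close> in \<^typ>\<open>ereal\<close>, the endpoints \<open>u = 0\<close> and \<open>u = 1\<close> are harmless.\<close>

definition convex_fun :: "('a::real_vector \<Rightarrow> ereal) \<Rightarrow> bool" where
  "convex_fun h \<longleftrightarrow> (\<forall>x y. \<forall>u\<in>{0..1}.
     h ((1 - u) *\<^sub>R x + u *\<^sub>R y) \<le> ereal (1 - u) * h x + ereal u * h y)"

definition lsc_fun :: "('a::topological_space \<Rightarrow> ereal) \<Rightarrow> bool" where
  "lsc_fun h \<longleftrightarrow> (\<forall>x. h x \<le> Liminf (at x) h)"

definition conjugate :: "('a::real_inner \<Rightarrow> ereal) \<Rightarrow> 'a \<Rightarrow> ereal" where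
  "conjugate h y = (SUP x. ereal (y \<bullet> x) - h x)"

definition subdifferential :: "('a::real_inner \<Rightarrow> ereal) \<Rightarrow> 'a \<Rightarrow> 'a set" where
  "subdifferential h x =
     {v. x \<in> eff_dom h \<and> (\<forall>z. h x + ereal (v \<bullet> (z - x)) \<le> h z)}"

definition prox :: "real \<Rightarrow> ('a::real_inner \<Rightarrow> ereal) \<Rightarrow> 'a \<Rightarrow> 'a" where
  "prox \<tau> h x = arg_min (\<lambda>w. h w + ereal (1 / (2 * \<tau>) * (norm (w - x))\<^sup>2)) (\<lambda>_. True)"

definition locally_lipschitz :: "('a::real_normed_vector \<Rightarrow> 'a) \<Rightarrow> bool" where
  "locally_lipschitz F \<longleftrightarrow>
     (\<forall>V. convex V \<and> compact V \<longrightarrow> (\<exists>L>0. L-lipschitz_on V F))"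

text \<open>The first argument \<open>F\<close> is the gradient of \<open>f\<close>.\<close>

definition primal_dual_solution ::
  "('a::euclidean_space \<Rightarrow> 'a) \<Rightarrow> ('a \<Rightarrow> ereal) \<Rightarrow> ('b::euclidean_space \<Rightarrow> ereal) \<Rightarrow> ('a \<Rightarrow> 'b)
    \<Rightarrow> 'a \<Rightarrow> 'b \<Rightarrow> bool" where
  "primal_dual_solution F g h A xs ys \<longleftrightarrow>
     0 \<in> (\<lambda>v. - A xs + v) ` subdifferential (conjugate h) ys \<and>
     0 \<in> (\<lambda>v. adjoint A ys + F xs + v) ` subdifferential g xs"

text \<open>The values of \<open>\<ell>\<^sub>k\<close> and \<open>c\<^sub>k\<close> are obtained at \<open>u = x\<^sup>k\<^sup>-\<^sup>1\<close>, \<open>v = x\<^sup>k\<close>, with \<open>F\<close> the gradient.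
  Real division has \<open>0 / 0 = 0\<close> as required; a nonzero numerator never meets a zero
  denominator here, because for the gradient \<open>F\<close> of a convex function
  \<open>(F u - F v) \<bullet> (u - v) = 0\<close> forces \<open>F u = F v\<close>.\<close>

definition lip_est :: "('a::real_inner \<Rightarrow> 'a) \<Rightarrow> 'a \<Rightarrow> 'a \<Rightarrow> real" where
  "lip_est F u v = (F u - F v) \<bullet> (u - v) / (norm (u - v))\<^sup>2"

definition cocoercivity_est :: "('a::real_inner \<Rightarrow> 'a) \<Rightarrow> 'a \<Rightarrow> 'a \<Rightarrow> real" where
  "cocoercivity_est F u v = (norm (F u - F v))\<^sup>2 / ((F u - F v) \<bullet> (u - v))"

text \<open>Square root with \<open>\<surd>\<infinity> = \<infinity>\<close>; it is only applied to nonnegative arguments. The stepsize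
  formulas divide in \<^typ>\<open>ereal\<close>, where \<open>0 / 0 = 0\<close> and \<open>1 / 0 = \<infinity>\<close>.\<close>

definition esqrt :: "ereal \<Rightarrow> ereal" where
  "esqrt r = (if r = \<infinity> then \<infinity> else ereal (sqrt (real_of_ereal r)))"

text \<open>On the descent inequality for the Lyapunov function \<open>U\<close>. Two conventions matter.

  The starting point \<open>x\<^sup>0\<close> need not lie in the domain of \<open>g\<close>. In that case the term \<open>P\<^sub>0\<close> and
  with it \<open>U\<^sub>1\<close> are \<open>\<infinity>\<close>, and the inequality for \<open>k = 1\<close> holds vacuously, because
  \<open>\<infinity> - \<infinity> = \<infinity>\<close> in \<^typ>\<open>ereal\<close>. All other \<open>P\<^sub>k\<close> and \<open>Q\<^sub>k\<close> that occur are finite.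

  The residuals are \<open>y\<^sup>k\<^sup>+\<^sup>1 - y\<^sup>k\<close> and \<open>x\<^sup>k - x\<^sup>k\<^sup>-\<^sup>1\<close>, the latter with the coefficient
  \<open>(1 - 4 \<xi>\<^sub>k (1+\<epsilon>) - 4 \<rho>\<^sub>k\<^sub>+\<^sub>1\<^sup>2 (\<delta>\<^sub>k + \<xi>\<^sub>k\<^sub>+\<^sub>1 (1+\<epsilon>))) / 4\<close>. With \<open>y\<^sup>k - y\<^sup>k\<^sup>-\<^sup>1\<close>,
  with \<open>x\<^sup>k - x\<^sup>k\<^sup>+\<^sup>1\<close>, or without the factors \<open>1+\<epsilon>\<close>, as the inequality also appears in print, it
  is false. For the first of these take \<open>A = 0\<close>, \<open>f = g = h = 0\<close>, \<open>\<epsilon> > 0\<close>, a constant sequence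
  \<open>x\<close>, and \<open>y\<^sup>0 \<noteq> 0\<close>, so that \<open>y\<^sup>k = 0\<close> for \<open>k \<ge> 1\<close>: then \<open>U\<^sub>1 = U\<^sub>2 = Q\<^sub>2 = P\<^sub>0 = 0\<close> for the
  solution \<open>(x\<^sup>0, 0)\<close>.\<close>

end

theory Submission
  imports Defs
begin

text \<open>Every primal-dual solution yields a Lyapunov function \<open>U\<^sub>k\<close>: combining the subgradient
  inequalities of the two proximal steps at \<open>k\<close> and \<open>k + 1\<close> leaves the cross term
  \<open>\<gamma>\<^sub>k\<^sub>+\<^sub>1 \<langle>A\<^sup>T(y\<^sup>k - y\<^sup>k\<^sup>+\<^sup>1), \<rho>\<^sub>k\<^sub>+\<^sub>1(x\<^sup>k\<^sup>-\<^sup>1 - x\<^sup>k) - (x\<^sup>k - x\<^sup>k\<^sup>+\<^sup>1)\<rangle>\<close>, which Young's inequality absorbs, and the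
  third term of the stepsize rule is the positive root of the quadratic inequality in
  \<open>\<rho>\<^sub>k\<^sub>+\<^sub>1\<^sup>2\<close> that keeps the remaining coefficient at least \<open>\<epsilon> / (4 (1 + \<epsilon>))\<close>. A solution exists by
  Fenchel duality, whence boundedness, and on bounded sets cocoercivity of the gradient bounds the
  stepsizes below. If \<open>P\<^sub>k\<close> stayed away from \<open>0\<close>, then \<open>1 + \<rho>\<^sub>k - \<rho>\<^sub>k\<^sub>+\<^sub>1\<^sup>2\<close> would tend to \<open>0\<close> and
  \<open>\<gamma>\<^sub>k\<close> would grow geometrically, contradicting boundedness of \<open>\<gamma>\<^sub>k P\<^sub>k\<^sub>-\<^sub>1\<close>. For \<open>\<epsilon> > 0\<close> the
  residuals vanish, so limit points are solutions, and the Lyapunov function of a suitable limit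
  point tends to \<open>0\<close> along a subsequence, hence altogether.\<close>

section \<open>Convex analysis\<close>

text \<open>The stepsizes are bounded below but may grow without bound, and this shapes the
  convergence proof: even where the primal gap tends to 0, nothing forces its weighted form
  \<open>\<gamma> k * (1 + \<rho> k) * primal_gap (k - 1)\<close> in the Lyapunov function to do so.
  The choice of a suitable limit point concerns exactly this term. The Lyapunov function depends on
  the solution, while stepsizes and iterates do not, so the solution has a locale of its own: it is
  interpreted at an arbitrary solution to get boundedness and vanishing residuals, and again at a
  limit point once that is known to be a solution. A solution also supplies subgradients of g and of
  the conjugate of h, hence affine minorants, and these make both proximal points exist. Since x^0
  may lie outside the domain of g, the descent is summed from k = 2 on, in the reals; extended-real
  versions are restored only for the final statement.\<close>

lemma proper_fun_ereal:
  assumes "proper_fun h" "x \<in> eff_dom h"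
  obtains r where "h x = ereal r"
  using assms unfolding proper_fun_def eff_dom_def by (cases "h x") auto

lemma convex_funD:
  assumes "convex_fun h" "h x = ereal a" "h y = ereal b" "0 \<le> u" "u \<le> 1"
  shows "h ((1 - u) *\<^sub>R x + u *\<^sub>R y) \<le> ereal ((1 - u) * a + u * b)"
proof -
  have "h ((1 - u) *\<^sub>R x + u *\<^sub>R y) \<le> ereal (1 - u) * h x + ereal u * h y"
    using assms(1,4,5) unfolding convex_fun_def by simp
  then show ?thesis unfolding assms(2,3) by simp
qed

lemma convex_eff_dom:
  assumes "proper_fun h" "convex_fun h"
  shows "convex (eff_dom h)"
  unfolding convex_alt
proof (intro ballI allI impI)
  fix x y u assume *: "x \<in> eff_dom h" "y \<in> eff_dom h" "0 \<le> (u::real) \<and> u \<le> 1"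
  obtain a b where "h x = ereal a" "h y = ereal b"
    using * assms(1) proper_fun_ereal by metis
  from convex_funD[OF assms(2) this] * show "(1 - u) *\<^sub>R x + u *\<^sub>R y \<in> eff_dom h"
    unfolding eff_dom_def using le_less_trans by fastforce
qed

lemma lsc_fun_eventually:
  assumes "lsc_fun h" "c < h x"
  shows "eventually (\<lambda>z. c < h z) (nhds x)"
proof -
  have "c < Liminf (at x) h" using assms unfolding lsc_fun_def by (meson less_le_trans)
  then have "eventually (\<lambda>z. c < h z) (at x)" by (rule less_LiminfD)
  with assms(2) show ?thesis
    by (simp add: eventually_nhds_conv_at)
qed

text \<open>The bounds may vary with \<open>n\<close>; in this form lower semicontinuity enters both
  the closed graph of the subdifferential and the existence of proximal points.\<close>

lemma lsc_fun_limit: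
  assumes "lsc_fun h" "X \<longlonglongrightarrow> x" "\<And>n. h (X n) \<le> ereal (c n)" "c \<longlonglongrightarrow> c0"
  shows "h x \<le> ereal c0"
proof (rule ccontr)
  assume "\<not> ?thesis"
  then obtain d where d: "ereal c0 < ereal d" "ereal d < h x"
    unfolding not_le using ereal_dense2 by blast
  have "eventually (\<lambda>n. ereal d < h (X n)) sequentially"
    using eventually_compose_filterlim[OF lsc_fun_eventually[OF assms(1) d(2)] assms(2)] .
  moreover have "eventually (\<lambda>n. c n < d) sequentially"
    using assms(4) d(1) by (simp add: order_tendstoD(2))
  ultimately have "eventually (\<lambda>n. False) sequentially"
  proof eventually_elim
    case (elim n)
    from elim(1) assms(3)[of n] have "ereal d < ereal (c n)" by (rule less_le_trans)
    with elim(2) show False by simp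
  qed
  then show False by simp
qed

lemma subdifferentialD:
  assumes "v \<in> subdifferential h x" "h x = ereal a" "h z = ereal b"
  shows "a + v \<bullet> (z - x) \<le> b"
proof -
  have "h x + ereal (v \<bullet> (z - x)) \<le> h z"
    using assms(1) unfolding subdifferential_def by blast
  then show ?thesis unfolding assms(2,3) by simp
qed

lemma subdifferentialI:
  assumes "proper_fun h" "h x = ereal a" "\<And>z b. h z = ereal b \<Longrightarrow> a + v \<bullet> (z - x) \<le> b"
  shows "v \<in> subdifferential h x"
proof -
  have "h x + ereal (v \<bullet> (z - x)) \<le> h z" for z
    using assms by (cases "h z") (auto simp: proper_fun_def)
  then show ?thesis using assms(2) unfolding subdifferential_def eff_dom_def by auto
qed

text \<open>Rearranged as \<open>h (X n) \<le> b - V n \<bullet> (z - X n)\<close>, the subgradient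
  inequality has a convergent right side, so lower semicontinuity passes it to the limit although
  the values \<open>h (X n)\<close> need not converge to \<open>h x\<close>.\<close>

lemma subdifferential_closed_graph:
  assumes "proper_fun h" "lsc_fun h" "X \<longlonglongrightarrow> x" "V \<longlonglongrightarrow> v"
    and sub: "\<And>n. V n \<in> subdifferential h (X n)"
  shows "v \<in> subdifferential h x"
proof -
  have *: "h x \<le> ereal (b - v \<bullet> (z - x))" if b: "h z = ereal b" for z b
  proof (rule lsc_fun_limit[OF assms(2,3)])
    show "h (X n) \<le> ereal (b - V n \<bullet> (z - X n))" for n
    proof -
      have "X n \<in> eff_dom h" using sub unfolding subdifferential_def by auto
      then obtain a where a: "h (X n) = ereal a" using proper_fun_ereal assms(1) by metis
      from subdifferentialD[OF sub a b] a show ?thesis by simp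
    qed
    show "(\<lambda>n. b - V n \<bullet> (z - X n)) \<longlonglongrightarrow> b - v \<bullet> (z - x)"
      by (intro tendsto_intros assms)
  qed
  \<comment> \<open>One point of the domain turns the bound into finiteness of
    \<open>h x\<close>.\<close>
  obtain p where "h p \<noteq> \<infinity>" using assms(1) proper_fun_def by metis
  then obtain b where "h p = ereal b" using assms(1) unfolding proper_fun_def by (cases "h p") auto
  from *[OF this] obtain a where a: "h x = ereal a"
    using assms(1) unfolding proper_fun_def by (cases "h x") auto
  show ?thesis
    by (rule subdifferentialI[OF assms(1) a]) (use * a in fastforce)
qed

section \<open>Conjugate functions\<close>

lemma conjugate_ge:
  assumes "h x = ereal a"
  shows "ereal (y \<bullet> x - a) \<le> conjugate h y"
  unfolding conjugate_def by (rule SUP_upper2[of x]) (simp_all add: assms)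

lemma conjugate_le:
  assumes "proper_fun h" "\<And>x a. h x = ereal a \<Longrightarrow> ereal (y \<bullet> x - a) \<le> c"
  shows "conjugate h y \<le> c"
  unfolding conjugate_def
proof (rule SUP_least)
  fix x show "ereal (y \<bullet> x) - h x \<le> c"
  proof (cases "h x")
    case (real r)
    then show ?thesis using assms(2)[OF real] by simp
  qed (use assms(1) in \<open>auto simp: proper_fun_def\<close>)
qed

text \<open>A subgradient \<open>y\<close> makes \<open>z\<close> attain the supremum that defines
  \<open>conjugate h y\<close>; the Fenchel-Young inequality \<open>conjugate_ge\<close> at
  \<open>z\<close> then reads as the subgradient inequality of the conjugate. Properness comes
  along, with \<open>y\<close> as the point of finite value.\<close>

lemma subdifferential_conjugate:
  assumes "proper_fun h" "y \<in> subdifferential h z"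
  shows "z \<in> subdifferential (conjugate h) y" "proper_fun (conjugate h)"
proof -
  have "z \<in> eff_dom h" using assms(2) unfolding subdifferential_def by auto
  then obtain a where a: "h z = ereal a" using proper_fun_ereal assms(1) by metis
  have "conjugate h y \<le> ereal (y \<bullet> z - a)"
  proof (rule conjugate_le[OF assms(1)])
    fix x b assume "h x = ereal b"
    from subdifferentialD[OF assms(2) a this]
    show "ereal (y \<bullet> x - b) \<le> ereal (y \<bullet> z - a)" by (simp add: inner_diff_right)
  qed
  then have c: "conjugate h y = ereal (y \<bullet> z - a)"
    using conjugate_ge[where h = h, OF a, of y] by (rule antisym)
  have "conjugate h w \<noteq> -\<infinity>" for w using conjugate_ge[where h = h, OF a, of w] by auto
  then show p: "proper_fun (conjugate h)" unfolding proper_fun_def using c by (metis PInfty_neq_ereal(1))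
  show "z \<in> subdifferential (conjugate h) y"
  proof (rule subdifferentialI[OF p c])
    fix w b assume "conjugate h w = ereal b"
    with conjugate_ge[where h = h, OF a, of w] show "y \<bullet> z - a + z \<bullet> (w - y) \<le> b"
      by (simp add: inner_diff_right inner_commute)
  qed
qed

lemma convex_fun_conjugate:
  assumes "proper_fun h"
  shows "convex_fun (conjugate h)"
  unfolding convex_fun_def
proof (intro allI ballI)
  fix x y :: 'a and u :: real assume u: "u \<in> {0..1}"
  show "conjugate h ((1 - u) *\<^sub>R x + u *\<^sub>R y)
      \<le> ereal (1 - u) * conjugate h x + ereal u * conjugate h y"
  proof (rule conjugate_le[OF assms])
    fix w a assume a: "h w = ereal a"
    have "ereal (((1 - u) *\<^sub>R x + u *\<^sub>R y) \<bullet> w - a)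
        = ereal (1 - u) * ereal (x \<bullet> w - a) + ereal u * ereal (y \<bullet> w - a)"
      by (simp add: algebra_simps inner_add_left)
    also have "\<dots> \<le> ereal (1 - u) * conjugate h x + ereal u * conjugate h y"
      using u by (intro add_mono ereal_mult_left_mono conjugate_ge[where h = h, OF a]) auto
    finally show "ereal (((1 - u) *\<^sub>R x + u *\<^sub>R y) \<bullet> w - a)
      \<le> ereal (1 - u) * conjugate h x + ereal u * conjugate h y" .
  qed
qed

lemma lsc_fun_conjugate:
  assumes "proper_fun h"
  shows "lsc_fun (conjugate h)"
  unfolding lsc_fun_def
proof (intro allI)
  fix y :: 'a
  show "conjugate h y \<le> Liminf (at y) (conjugate h)"
  proof (rule conjugate_le[OF assms])
    fix x a assume a: "h x = ereal a"
    have "((\<lambda>w. ereal (w \<bullet> x - a)) \<longlongrightarrow> ereal (y \<bullet> x - a)) (at y)"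
      by (intro tendsto_intros)
    then have "ereal (y \<bullet> x - a) \<le> Liminf (at y) (\<lambda>w. ereal (w \<bullet> x - a))"
      by (cases "at y = bot") (simp_all add: lim_imp_Liminf del: lim_ereal)
    also have "\<dots> \<le> Liminf (at y) (conjugate h)"
      by (intro Liminf_mono always_eventually allI conjugate_ge[where h = h, OF a])
    finally show "ereal (y \<bullet> x - a) \<le> Liminf (at y) (conjugate h)" .
  qed
qed

section \<open>Proximal points\<close>

lemma linear_perturbation_nonneg:
  fixes a b :: real
  assumes "\<And>u. 0 < u \<Longrightarrow> u \<le> 1 \<Longrightarrow> 0 \<le> a + u * b"
  shows "0 \<le> a"
proof (rule ccontr)
  assume "\<not> 0 \<le> a"
  \<comment> \<open>Chosen such that \<open>u * b \<le> - a / 2\<close>.\<close>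
  define u where "u = min 1 (- a / (2 * (\<bar>b\<bar> + 1)))"
  have "0 < u" "u \<le> 1" using \<open>\<not> 0 \<le> a\<close> by (auto simp: u_def divide_neg_pos)
  moreover have "u * b \<le> u * (\<bar>b\<bar> + 1)" using \<open>0 < u\<close> by (intro mult_left_mono) auto
  moreover have "u * (\<bar>b\<bar> + 1) \<le> (- a / (2 * (\<bar>b\<bar> + 1))) * (\<bar>b\<bar> + 1)"
    by (intro mult_right_mono) (auto simp: u_def)
  moreover have "(- a / (2 * (\<bar>b\<bar> + 1))) * (\<bar>b\<bar> + 1) = - a / 2" by (simp add: field_simps)
  ultimately show False using assms[of u] \<open>\<not> 0 \<le> a\<close> by linarith
qed

text \<open>The subgradient at \<open>p\<close> provides an affine minorant, and the quadratic term
  outgrows it. So sublevel sets are bounded, and a minimizing sequence has a cluster point, which is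
  a minimizer by lower semicontinuity. In the iteration the subgradient comes from a primal-dual
  solution.\<close>

lemma prox_minimizer_exists:
  fixes h :: "'a::euclidean_space \<Rightarrow> ereal"
  assumes h: "proper_fun h" "lsc_fun h" and v: "v \<in> subdifferential h p" and \<tau>: "0 < \<tau>"
  shows "\<exists>w. is_arg_min (\<lambda>w. h w + ereal (1 / (2 * \<tau>) * (norm (w - x))\<^sup>2)) (\<lambda>_. True) w"
proof -
  define \<phi> where "\<phi> w = h w + ereal (1 / (2 * \<tau>) * (norm (w - x))\<^sup>2)" for w
  have "p \<in> eff_dom h" using v unfolding subdifferential_def by auto
  then obtain a where a: "h p = ereal a" using proper_fun_ereal h(1) by metis
  have lower: "ereal (a + v \<bullet> (w - p) + 1 / (2 * \<tau>) * (norm (w - x))\<^sup>2) \<le> \<phi> w" for w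
  proof -
    have "ereal (a + v \<bullet> (w - p)) \<le> h w"
      using v a unfolding subdifferential_def by (metis (mono_tags, lifting) mem_Collect_eq plus_ereal.simps(1))
    from add_right_mono[OF this, of "ereal (1 / (2 * \<tau>) * (norm (w - x))\<^sup>2)"]
    show ?thesis unfolding \<phi>_def by simp
  qed
  have bnd: "norm (w - x) \<le> 1 + 2 * \<tau> * (\<bar>M\<bar> + \<bar>a + v \<bullet> (x - p)\<bar> + norm v)"
    if "\<phi> w \<le> ereal M" for w M
  proof (rule ccontr)
    assume n: "\<not> ?thesis"
    let ?d = "norm (w - x)" and ?K = "\<bar>M\<bar> + \<bar>a + v \<bullet> (x - p)\<bar>"
    have d1: "1 \<le> ?d" using n \<tau> by (smt (verit) mult_nonneg_nonneg norm_ge_zero)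
    have "a + v \<bullet> (w - p) + 1 / (2 * \<tau>) * ?d\<^sup>2 \<le> M"
      using order_trans[OF lower that] by simp
    moreover have "v \<bullet> (w - p) = v \<bullet> (x - p) + v \<bullet> (w - x)"
      by (simp add: inner_diff_right)
    moreover have "- (norm v * ?d) \<le> v \<bullet> (w - x)"
      using Cauchy_Schwarz_ineq2[of v "w - x"] by linarith
    ultimately have "1 / (2 * \<tau>) * ?d\<^sup>2 \<le> ?K + norm v * ?d" by linarith
    also have "\<dots> \<le> ?K * ?d + norm v * ?d"
      using mult_left_mono[OF d1, of ?K] by simp
    finally have "1 / (2 * \<tau>) * ?d * ?d \<le> (?K + norm v) * ?d"
      by (simp add: power2_eq_square algebra_simps)
    then have "1 / (2 * \<tau>) * ?d \<le> ?K + norm v"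
      using d1 by (metis less_le_trans mult_le_cancel_right_pos zero_less_one)
    then have "?d \<le> 2 * \<tau> * (?K + norm v)" using \<tau> by (simp add: field_simps)
    then show False using n by linarith
  qed
  define m where "m = Inf (range \<phi>)"
  have m_le: "m \<le> \<phi> w" for w unfolding m_def by (simp add: INF_lower)
  have "m \<noteq> -\<infinity>"
  proof
    assume "m = -\<infinity>"
    \<comment> \<open>A value below -1 confines \<open>w\<close> to the ball of radius
      \<open>R\<close>, on which the minorant does not drop below the second threshold; a single
      \<open>w\<close> below both refutes an infimum of \<open>-\<infinity>\<close>.\<close>
    define R where "R = 1 + 2 * \<tau> * (1 + \<bar>a + v \<bullet> (x - p)\<bar> + norm v)"
    define c where "c = min (-1) (a + v \<bullet> (x - p) - norm v * R)"
    have "\<exists>w. \<phi> w < ereal (a + v \<bullet> (x - p) - norm v * R) \<and> \<phi> w < -1"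
    proof -
      have "Inf (range \<phi>) < ereal c" using \<open>m = -\<infinity>\<close> m_def by simp
      then obtain w where "\<phi> w < ereal c" by (auto simp: Inf_less_iff)
      then have "\<phi> w < ereal (a + v \<bullet> (x - p) - norm v * R)" "\<phi> w < ereal (-1)"
        unfolding c_def by (auto intro: less_le_trans)
      then show ?thesis by (auto simp: one_ereal_def)
    qed
    then obtain w where w: "\<phi> w < ereal (a + v \<bullet> (x - p) - norm v * R)" "\<phi> w < -1" by auto
    have "\<phi> w \<le> ereal (-1)" using w(2) by (simp add: one_ereal_def less_imp_le)
    from bnd[OF this] have "norm (w - x) \<le> R" unfolding R_def by simp
    then have "norm v * norm (w - x) \<le> norm v * R" by (intro mult_left_mono) auto
    moreover have "- (norm v * norm (w - x)) \<le> v \<bullet> (w - x)"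
      using Cauchy_Schwarz_ineq2[of v "w - x"] by linarith
    moreover have "v \<bullet> (w - p) = v \<bullet> (x - p) + v \<bullet> (w - x)"
      by (simp add: inner_diff_right)
    moreover have "a + v \<bullet> (w - p) + 1 / (2 * \<tau>) * (norm (w - x))\<^sup>2 < a + v \<bullet> (x - p) - norm v * R"
      using le_less_trans[OF lower w(1)] by simp
    moreover have "0 \<le> 1 / (2 * \<tau>) * (norm (w - x))\<^sup>2" using \<tau> by simp
    ultimately show False by linarith
  qed
  moreover have "m \<noteq> \<infinity>" using m_le[of p] unfolding \<phi>_def a by auto
  ultimately obtain m' where m': "m = ereal m'" by (cases m) auto
  have "\<exists>w. \<phi> w < ereal (m' + 1 / real (Suc n))" for n
  proof -
    have "Inf (range \<phi>) < ereal (m' + 1 / real (Suc n))" using m' m_def by simp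
    then show ?thesis by (auto simp: Inf_less_iff)
  qed
  then obtain W where W: "\<And>n. \<phi> (W n) < ereal (m' + 1 / real (Suc n))" by metis
  have "\<phi> (W n) \<le> ereal (m' + 1)" for n
    using W[of n] by (rule order_trans[OF less_imp_le]) (simp add: field_simps)
  from bnd[OF this] obtain R where R: "norm (W n - x) \<le> R" for n by blast
  then have "W n \<in> cball x R" for n by (simp add: dist_norm norm_minus_commute)
  then obtain w r where w: "strict_mono (r :: nat \<Rightarrow> nat)" "(W \<circ> r) \<longlonglongrightarrow> w"
    using compact_cball[of x R] unfolding compact_def by blast
  have "h w \<le> ereal (m' + 0 - 1 / (2 * \<tau>) * (norm (w - x))\<^sup>2)"
  proof (rule lsc_fun_limit[OF h(2) w(2)])
    show "h ((W \<circ> r) n) \<le> ereal (m' + 1 / real (Suc (r n)) - 1 / (2 * \<tau>) * (norm ((W \<circ> r) n - x))\<^sup>2)" for n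
      using W[of "r n"] unfolding \<phi>_def by (cases "h (W (r n))") auto
    show "(\<lambda>n. m' + 1 / real (Suc (r n)) - 1 / (2 * \<tau>) * (norm ((W \<circ> r) n - x))\<^sup>2)
        \<longlonglongrightarrow> m' + 0 - 1 / (2 * \<tau>) * (norm (w - x))\<^sup>2"
    proof (intro tendsto_intros w(2))
      show "(\<lambda>n. 1 / real (Suc (r n))) \<longlonglongrightarrow> 0"
        using LIMSEQ_subseq_LIMSEQ[OF lim_1_over_n[THEN LIMSEQ_Suc] w(1)] by (simp add: o_def)
    qed
  qed
  then have "\<phi> w \<le> m" unfolding m' \<phi>_def by (cases "h w") auto
  then have "is_arg_min \<phi> (\<lambda>_. True) w"
    unfolding is_arg_min_def using m_le by (metis le_less_trans less_irrefl order_trans not_le)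
  then show ?thesis unfolding \<phi>_def by blast
qed

text \<open>The minimizer is compared with the points of the segment towards \<open>z\<close>.
  Convexity bounds \<open>h\<close> there and the quadratic contributes a linear term plus a
  multiple of \<open>u\<^sup>2\<close>; dividing by \<open>u\<close> and letting it tend to 0 leaves
  the subgradient inequality.\<close>

lemma prox_subdifferential:
  fixes h :: "'a::euclidean_space \<Rightarrow> ereal"
  assumes h: "proper_fun h" "convex_fun h" "lsc_fun h"
    and v: "v \<in> subdifferential h p" and \<tau>: "0 < \<tau>"
  shows "(1 / \<tau>) *\<^sub>R (x - prox \<tau> h x) \<in> subdifferential h (prox \<tau> h x)"
proof -
  define w where "w = prox \<tau> h x"
  define q where "q w = 1 / (2 * \<tau>) * (norm (w - x))\<^sup>2" for w
  \<comment> \<open>\<open>prox\<close> is a choice among minimizers, so it is one of them as soon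
    as any exists.\<close>
  have "is_arg_min (\<lambda>w. h w + ereal (q w)) (\<lambda>_. True) w"
    unfolding w_def q_def prox_def arg_min_def
    by (rule someI_ex) (rule prox_minimizer_exists[OF h(1,3) v \<tau>])
  then have min: "h w + ereal (q w) \<le> h z + ereal (q z)" for z
    by (auto simp: is_arg_min_def not_less)
  have "p \<in> eff_dom h" using v unfolding subdifferential_def by auto
  then obtain a where "h p = ereal a" using proper_fun_ereal h(1) by metis
  with min[of p] obtain b where b: "h w = ereal b"
    using h(1) unfolding proper_fun_def by (cases "h w") auto
  show ?thesis unfolding w_def[symmetric]
  proof (rule subdifferentialI[OF h(1) b])
    fix z c assume c: "h z = ereal c"
    have "0 \<le> (c - b - ((1 / \<tau>) *\<^sub>R (x - w)) \<bullet> (z - w)) + u * (1 / (2 * \<tau>) * (norm (z - w))\<^sup>2)"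
      if u: "0 < u" "u \<le> 1" for u
    proof -
      have "ereal (b + q w) \<le> h ((1 - u) *\<^sub>R w + u *\<^sub>R z) + ereal (q ((1 - u) *\<^sub>R w + u *\<^sub>R z))"
        using min b by (metis plus_ereal.simps(1))
      also have "\<dots> \<le> ereal ((1 - u) * b + u * c) + ereal (q ((1 - u) *\<^sub>R w + u *\<^sub>R z))"
        using u by (intro add_right_mono convex_funD[OF h(2) b c]) auto
      finally have le: "b + q w \<le> (1 - u) * b + u * c + q ((1 - u) *\<^sub>R w + u *\<^sub>R z)" by simp
      have e: "(1 - u) *\<^sub>R w + u *\<^sub>R z - x = (w - x) + u *\<^sub>R (z - w)"
        by (simp add: algebra_simps)
      have "q ((1 - u) *\<^sub>R w + u *\<^sub>R z)
          = q w + u * (((1 / \<tau>) *\<^sub>R (w - x)) \<bullet> (z - w)) + u * (u * (1 / (2 * \<tau>) * (norm (z - w))\<^sup>2))"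
      proof -
        have "(norm ((w - x) + u *\<^sub>R (z - w)))\<^sup>2
            = (norm (w - x))\<^sup>2 + 2 * u * ((w - x) \<bullet> (z - w)) + u * u * (norm (z - w))\<^sup>2"
          unfolding power2_norm_eq_inner
          by (simp only: inner_add_left inner_add_right inner_scaleR_left inner_scaleR_right)
             (simp add: inner_commute algebra_simps)
        then show ?thesis
          unfolding q_def e using \<tau> by (simp add: add_divide_distrib distrib_left)
      qed
      moreover have "((1 / \<tau>) *\<^sub>R (w - x)) \<bullet> (z - w) = - (((1 / \<tau>) *\<^sub>R (x - w)) \<bullet> (z - w))"
        by (metis inner_minus_left minus_diff_eq scaleR_minus_right)
      ultimately have "0 \<le> u * ((c - b - ((1 / \<tau>) *\<^sub>R (x - w)) \<bullet> (z - w)) + u * (1 / (2 * \<tau>) * (norm (z - w))\<^sup>2))"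
        using le by (simp add: algebra_simps)
      then show ?thesis using u by (simp add: zero_le_mult_iff)
    qed
    from linear_perturbation_nonneg[OF this]
    show "b + ((1 / \<tau>) *\<^sub>R (x - w)) \<bullet> (z - w) \<le> c" by linarith
  qed
qed

text \<open>\<open>v\<close> is meant as the gradient of the smooth part at \<open>z\<close>, which
  thus enters in linearised form. The multiplier \<open>y\<close> is the slope of the separating
  hyperplane; the resulting inequality in \<open>u\<close> and \<open>w\<close> splits into the two
  inclusions by freezing one variable at its optimal value.\<close>

lemma fenchel_duality:
  fixes g :: "'a::euclidean_space \<Rightarrow> ereal" and h :: "'b::euclidean_space \<Rightarrow> ereal"
  assumes g: "proper_fun g" "convex_fun g" and h: "proper_fun h" "convex_fun h"
    and A: "linear A"
    and qual: "\<exists>q \<in> rel_interior (eff_dom g). A q \<in> rel_interior (eff_dom h)"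
    and gz: "g z = ereal a0" and hz: "h (A z) = ereal b0"
    and min: "\<And>w a b. g w = ereal a \<Longrightarrow> h (A w) = ereal b \<Longrightarrow> a0 + b0 \<le> a + b + v \<bullet> (w - z)"
  obtains y where "y \<in> subdifferential h (A z)" "- v - adjoint A y \<in> subdifferential g z"
proof -
  \<comment> \<open>\<open>D\<close> collects the shifts \<open>u - A w\<close> for which the
    perturbed problem is feasible; the qualification places 0 in its relative interior.\<close>
  define D where "D = eff_dom h + (\<lambda>w. - A w) ` eff_dom g"
  have lA: "linear (\<lambda>w. - A w)" using A by (rule linear_compose_neg)
  have cg: "convex (eff_dom g)" and ch: "convex (eff_dom h)"
    using convex_eff_dom g h by auto
  have cA: "convex ((\<lambda>w. - A w) ` eff_dom g)" using cg lA by (rule convex_linear_image[rotated])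
  have cD: "convex D" unfolding D_def using ch cA by (rule convex_set_plus)
  have D0: "0 \<in> rel_interior D"
  proof -
    obtain q where q: "q \<in> rel_interior (eff_dom g)" "A q \<in> rel_interior (eff_dom h)"
      using qual by auto
    have "- A q \<in> rel_interior ((\<lambda>w. - A w) ` eff_dom g)"
      using rel_interior_convex_linear_image[OF lA cg] q(1) by blast
    then have "A q + - A q \<in> rel_interior D"
      unfolding D_def rel_interior_sum[OF ch cA] using q(2) by (intro set_plus_intro)
    then show ?thesis by simp
  qed
  text \<open>Separating \<open>0\<close> from the strict epigraph of the perturbation function. Thickening it by the
    orthogonal complement of \<open>D\<close> puts \<open>0\<close> in the interior of the domain, which rules out a
    vertical hyperplane.\<close>
  define E where "E = {(d, r). \<exists>u w a b n. h u = ereal b \<and> g w = ereal a \<and> (\<forall>e\<in>D. n \<bullet> e = 0)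
      \<and> d = u - A w + n \<and> a + b + v \<bullet> (w - z) - a0 - b0 < r}"
  have DI: "u - A w \<in> D" if "h u = ereal b" "g w = ereal a" for u w a b
  proof -
    have "u + - A w \<in> D" unfolding D_def
      using that by (intro set_plus_intro) (auto simp: eff_dom_def)
    then show ?thesis by simp
  qed
  have "convex E"
    unfolding convex_alt
  proof (intro ballI allI impI)
    fix p1 p2 and s :: real assume "p1 \<in> E" "p2 \<in> E" and s: "0 \<le> s \<and> s \<le> 1"
    then obtain u1 w1 a1 b1 n1 u2 w2 a2 b2 n2 where
      1: "h u1 = ereal b1" "g w1 = ereal a1" "\<forall>e\<in>D. n1 \<bullet> e = 0" "fst p1 = u1 - A w1 + n1"
        "a1 + b1 + v \<bullet> (w1 - z) - a0 - b0 < snd p1" and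
      2: "h u2 = ereal b2" "g w2 = ereal a2" "\<forall>e\<in>D. n2 \<bullet> e = 0" "fst p2 = u2 - A w2 + n2"
        "a2 + b2 + v \<bullet> (w2 - z) - a0 - b0 < snd p2"
      unfolding E_def by force
    define u w n where "u = (1 - s) *\<^sub>R u1 + s *\<^sub>R u2" and "w = (1 - s) *\<^sub>R w1 + s *\<^sub>R w2"
      and "n = (1 - s) *\<^sub>R n1 + s *\<^sub>R n2"
    have hu: "h u \<le> ereal ((1 - s) * b1 + s * b2)" and gw: "g w \<le> ereal ((1 - s) * a1 + s * a2)"
      unfolding u_def w_def using s 1 2 by (auto intro!: convex_funD g h)
    obtain b where b: "h u = ereal b"
      using hu h(1) unfolding proper_fun_def by (cases "h u") auto
    obtain a where a: "g w = ereal a"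
      using gw g(1) unfolding proper_fun_def by (cases "g w") auto
    have "\<forall>e\<in>D. n \<bullet> e = 0" unfolding n_def using 1(3) 2(3) by (simp add: inner_add_left)
    moreover have "fst ((1 - s) *\<^sub>R p1 + s *\<^sub>R p2) = u - A w + n"
    proof -
      have "A w = (1 - s) *\<^sub>R A w1 + s *\<^sub>R A w2"
        unfolding w_def by (simp only: linear_add[OF A] linear_scale[OF A])
      then show ?thesis
        unfolding u_def n_def fst_add fst_scaleR 1(4) 2(4) by (simp add: algebra_simps)
    qed
    moreover have "a + b + v \<bullet> (w - z) - a0 - b0 < snd ((1 - s) *\<^sub>R p1 + s *\<^sub>R p2)"
    proof -
      have "v \<bullet> (w - z) = (1 - s) * (v \<bullet> (w1 - z)) + s * (v \<bullet> (w2 - z))"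
        unfolding w_def by (simp add: inner_diff_right inner_add_right algebra_simps)
      then have "a + b + v \<bullet> (w - z) - a0 - b0
          \<le> (1 - s) * (a1 + b1 + v \<bullet> (w1 - z) - a0 - b0) + s * (a2 + b2 + v \<bullet> (w2 - z) - a0 - b0)"
        using hu gw unfolding a b by (simp add: algebra_simps)
      also have "\<dots> < (1 - s) * snd p1 + s * snd p2"
      proof (cases "s = 0")
        case False
        then have "s * (a2 + b2 + v \<bullet> (w2 - z) - a0 - b0) < s * snd p2"
          using s 2(5) by (intro mult_strict_left_mono) auto
        moreover have "(1 - s) * (a1 + b1 + v \<bullet> (w1 - z) - a0 - b0) \<le> (1 - s) * snd p1"
          using s 1(5) by (intro mult_left_mono) auto
        ultimately show ?thesis by linarith
      qed (use 1(5) in simp)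
      finally show ?thesis by simp
    qed
    ultimately show "(1 - s) *\<^sub>R p1 + s *\<^sub>R p2 \<in> E"
      unfolding E_def mem_Collect_eq case_prod_beta using a b by blast
  qed
  moreover have "0 \<notin> E"
  proof
    assume "0 \<in> E"
    then obtain u w a b n where *: "h u = ereal b" "g w = ereal a" "\<forall>e\<in>D. n \<bullet> e = 0"
      "0 = u - A w + n" "a + b + v \<bullet> (w - z) - a0 - b0 < 0"
      unfolding E_def zero_prod_def by auto
    \<comment> \<open>\<open>n\<close> is orthogonal to \<open>D\<close> and at the same time the
      negative of an element of \<open>D\<close>, hence 0; then \<open>u = A w\<close>, and
      minimality of \<open>z\<close> applies.\<close>
    have "n = - (u - A w)" using *(4) by (metis add.commute add_eq_0_iff)
    then have "n \<bullet> n = 0" using DI[OF *(1,2)] *(3) by (metis inner_minus_right neg_equal_0_iff_equal)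
    then have "u = A w" using *(4) by simp
    then show False using min[OF *(2), of b] *(1,5) by simp
  qed
  ultimately obtain p where "p \<noteq> 0" and p: "\<And>e. e \<in> E \<Longrightarrow> 0 \<le> p \<bullet> e"
    using separating_hyperplane_set_0[of E] by auto
  obtain c \<beta> where pc: "p = (c, \<beta>)" by (cases p)
  have sep: "0 \<le> c \<bullet> (u - A w + n) + \<beta> * r"
    if "h u = ereal b" "g w = ereal a" "\<forall>e\<in>D. n \<bullet> e = 0" "a + b + v \<bullet> (w - z) - a0 - b0 < r"
    for u w a b n r
  proof -
    have "(u - A w + n, r) \<in> E" unfolding E_def using that by blast
    from p[OF this] show ?thesis by (simp add: pc)
  qed
  have sep0: "0 \<le> \<beta> * r" if "0 < r" for r
    using sep[OF hz gz, of 0 r] that by simp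
  then have "0 \<le> \<beta>" by (metis mult.right_neutral zero_less_one)
  have "\<beta> \<noteq> 0"
  proof
    assume \<beta>: "\<beta> = 0"
    have nonneg: "0 \<le> c \<bullet> (d + n)" if "d \<in> D" "\<forall>e\<in>D. n \<bullet> e = 0" for d n
    proof -
      obtain u w where d: "u \<in> eff_dom h" "w \<in> eff_dom g" "d = u - A w"
        using \<open>d \<in> D\<close> unfolding D_def by (auto elim!: set_plus_elim)
      obtain a b where "h u = ereal b" "g w = ereal a"
        using d proper_fun_ereal g(1) h(1) by metis
      from sep[OF this that(2)] show ?thesis unfolding d(3) \<beta> using lt_ex gt_ex by fastforce
    qed
    \<comment> \<open>Since 0 is relatively interior, the ray from \<open>d\<close> through 0 stays
      in \<open>D\<close> a little beyond 0, which yields the opposite sign.\<close>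
    have "c \<bullet> d = 0" if d: "d \<in> D" for d
    proof -
      have "d \<in> affine hull D" using d by (rule hull_inc)
      then obtain m where "1 < m" "\<forall>e. 1 < e \<and> e \<le> m \<longrightarrow> (1 - e) *\<^sub>R d + e *\<^sub>R 0 \<in> D"
        using convex_rel_interior_if[OF cD D0] by blast
      then have "(1 - m) *\<^sub>R d \<in> D" by auto
      from nonneg[OF this, of 0] have "0 \<le> (1 - m) * (c \<bullet> d)" by simp
      then have "c \<bullet> d \<le> 0" using \<open>1 < m\<close> by (simp add: zero_le_mult_iff)
      moreover have "0 \<le> c \<bullet> d" using nonneg[OF d, of 0] by simp
      ultimately show ?thesis by simp
    qed
    moreover have "0 \<in> D" using D0 rel_interior_subset by blast
    \<comment> \<open>\<open>c\<close> is now orthogonal to \<open>D\<close>, so \<open>- c\<close>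
      is itself an admissible \<open>n\<close>.\<close>
    ultimately have "0 \<le> c \<bullet> (0 + - c)" by (intro nonneg) auto
    then have "c \<bullet> c \<le> 0" by simp
    then have "c = 0" using inner_gt_zero_iff[of c] by linarith
    then show False using \<open>p \<noteq> 0\<close> pc \<beta> by (simp add: zero_prod_def)
  qed
  with \<open>0 \<le> \<beta>\<close> have "0 < \<beta>" by simp
  define y where "y = - (1 / \<beta>) *\<^sub>R c"
  have key: "a0 + b0 + y \<bullet> (u - A w) \<le> a + b + v \<bullet> (w - z)"
    if "h u = ereal b" "g w = ereal a" for u w a b
  proof (rule field_le_epsilon)
    \<comment> \<open>The epigraph in \<open>E\<close> is strict, so its boundary is reached with an
      arbitrarily small slack \<open>e\<close>.\<close>
    fix e :: real assume "0 < e"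
    then have "0 \<le> c \<bullet> (u - A w + 0) + \<beta> * (a + b + v \<bullet> (w - z) - a0 - b0 + e)"
      using that by (intro sep) auto
    moreover have "c \<bullet> (u - A w) = - \<beta> * (y \<bullet> (u - A w))"
      unfolding y_def using \<open>0 < \<beta>\<close> by simp
    ultimately have "0 \<le> \<beta> * (a + b + v \<bullet> (w - z) - a0 - b0 + e - y \<bullet> (u - A w))"
      by (simp add: algebra_simps)
    then show "a0 + b0 + y \<bullet> (u - A w) \<le> a + b + v \<bullet> (w - z) + e"
      using \<open>0 < \<beta>\<close> by (simp add: zero_le_mult_iff)
  qed
  show thesis
  proof
    show "y \<in> subdifferential h (A z)"
    proof (rule subdifferentialI[OF h(1) hz])
      fix u b assume "h u = ereal b"
      from key[OF this gz] show "b0 + y \<bullet> (u - A z) \<le> b" by simp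
    qed
    show "- v - adjoint A y \<in> subdifferential g z"
    proof (rule subdifferentialI[OF g(1) gz])
      fix w a assume "g w = ereal a"
      from key[OF hz this] show "a0 + (- v - adjoint A y) \<bullet> (w - z) \<le> a"
        using adjoint_works[OF A, of "w - z" y]
        by (simp add: inner_diff_left inner_diff_right linear_diff[OF A] inner_commute)
    qed
  qed
qed

section \<open>Differentiable convex functions and local cocoercivity\<close>

lemma GDERIV_along_line:
  assumes "GDERIV f (z + u *\<^sub>R d) :> v"
  shows "((\<lambda>u. f (z + u *\<^sub>R d)) has_real_derivative v \<bullet> d) (at u)"
proof -
  have "((\<lambda>u. f (z + u *\<^sub>R d)) has_derivative (\<lambda>s. (s *\<^sub>R d) \<bullet> v)) (at u)"
    by (rule has_derivative_compose[where g = f and f = "\<lambda>u. z + u *\<^sub>R d"])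
      (use assms in \<open>auto simp: gderiv_def intro!: derivative_eq_intros\<close>)
  moreover have "(\<lambda>s. (s *\<^sub>R d) \<bullet> v) = (*) (v \<bullet> d)"
    by (simp add: fun_eq_iff inner_commute)
  ultimately show ?thesis by (simp add: has_field_derivative_def)
qed

text \<open>Passes to the limit in one-sided difference quotients. Applied to f, with the change of
  the nonsmooth terms in \<open>b\<close>, it is first-order optimality of a composite problem;
  applied to the negative of f, it is the tangent inequality.\<close>

lemma GDERIV_nonneg_direction:
  fixes b :: real
  assumes "GDERIV f z :> v" "\<And>u. 0 < u \<Longrightarrow> u \<le> 1 \<Longrightarrow> f z \<le> f (z + u *\<^sub>R d) + u * b"
  shows "0 \<le> v \<bullet> d + b"
proof -
  have "((\<lambda>u. f (z + u *\<^sub>R d)) has_real_derivative v \<bullet> d) (at 0)"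
    by (rule GDERIV_along_line) (use assms(1) in simp)
  then have "((\<lambda>u. (f (z + u *\<^sub>R d) - f z) / u) \<longlongrightarrow> v \<bullet> d) (at_right 0)"
    unfolding has_field_derivative_iff by (auto intro: tendsto_within_subset)
  then have "((\<lambda>u. (f (z + u *\<^sub>R d) - f z) / u + b) \<longlongrightarrow> v \<bullet> d + b) (at_right 0)"
    by (intro tendsto_intros)
  moreover have "eventually (\<lambda>u. 0 \<le> (f (z + u *\<^sub>R d) - f z) / u + b) (at_right 0)"
    unfolding eventually_at_right_field
    by (rule exI[of _ 1]) (use assms(2) in \<open>force simp: field_simps\<close>)
  ultimately show ?thesis by (rule tendsto_lowerbound) simp
qed

lemma convex_gradient_inequality:
  assumes "convex_on UNIV f" "GDERIV f z :> v"
  shows "f z + v \<bullet> (w - z) \<le> f w"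
proof -
  have "0 \<le> (- v) \<bullet> (w - z) + (f w - f z)"
  proof (rule GDERIV_nonneg_direction[where f = "\<lambda>w. - f w"])
    show "GDERIV (\<lambda>w. - f w) z :> - v" using assms(2) by (rule GDERIV_minus)
    fix u :: real assume u: "0 < u" "u \<le> 1"
    have "f ((1 - u) *\<^sub>R z + u *\<^sub>R w) \<le> (1 - u) * f z + u * f w"
      using convex_onD[OF assms(1), of u z w] u by simp
    moreover have "(1 - u) *\<^sub>R z + u *\<^sub>R w = z + u *\<^sub>R (w - z)" by (simp add: algebra_simps)
    ultimately show "- f z \<le> - f (z + u *\<^sub>R (w - z)) + u * (f w - f z)"
      by (simp add: algebra_simps)
  qed
  then show ?thesis by simp
qed

text \<open>Along the segment, f minus its quadratic model is nonincreasing: the derivative of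
  \<open>\<phi>\<close> is nonpositive by Cauchy-Schwarz and the Lipschitz bound.\<close>

lemma lipschitz_gradient_upper_bound:
  fixes G :: "'a::real_inner \<Rightarrow> 'a"
  assumes G: "\<And>z. GDERIV f z :> G z" and lip: "L-lipschitz_on W G" and "convex W" "y \<in> W" "w \<in> W"
  shows "f w \<le> f y + G y \<bullet> (w - y) + L / 2 * (norm (w - y))\<^sup>2"
proof -
  define d where "d = w - y"
  define \<phi> where "\<phi> u = f (y + u *\<^sub>R d) - u * (G y \<bullet> d) - u\<^sup>2 * (L / 2 * (norm d)\<^sup>2)" for u
  have "\<phi> 1 \<le> \<phi> 0"
  proof (rule DERIV_nonpos_imp_nonincreasing[where f = \<phi> and a = 0 and b = 1])
    fix u :: real assume u: "0 \<le> u" "u \<le> 1"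
    have "(\<phi> has_real_derivative (G (y + u *\<^sub>R d) \<bullet> d - G y \<bullet> d - 2 * u * (L / 2 * (norm d)\<^sup>2))) (at u)"
      unfolding \<phi>_def by (auto intro!: derivative_eq_intros GDERIV_along_line G)
    moreover have "G (y + u *\<^sub>R d) \<bullet> d - G y \<bullet> d \<le> 2 * u * (L / 2 * (norm d)\<^sup>2)"
    proof -
      have "y + u *\<^sub>R d = (1 - u) *\<^sub>R y + u *\<^sub>R w" by (simp add: d_def algebra_simps)
      then have "y + u *\<^sub>R d \<in> W" using assms(3-5) u by (simp add: convexD_alt)
      then have "norm (G (y + u *\<^sub>R d) - G y) \<le> L * norm (u *\<^sub>R d)"
        using lipschitz_onD[OF lip _ \<open>y \<in> W\<close>, of "y + u *\<^sub>R d"] by (simp add: dist_norm)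
      then have "norm (G (y + u *\<^sub>R d) - G y) * norm d \<le> L * norm (u *\<^sub>R d) * norm d"
        by (intro mult_right_mono) auto
      moreover have "(G (y + u *\<^sub>R d) - G y) \<bullet> d \<le> norm (G (y + u *\<^sub>R d) - G y) * norm d"
        by (rule norm_cauchy_schwarz)
      ultimately show ?thesis using u by (simp add: inner_diff_left power2_eq_square algebra_simps)
    qed
    ultimately show "\<exists>D. (\<phi> has_real_derivative D) (at u) \<and> D \<le> 0" by force
  qed simp
  then show ?thesis by (simp add: \<phi>_def d_def)
qed

text \<open>At the gradient step \<open>w\<close>, f lies above its tangent at \<open>x\<close> and
  below its quadratic model at \<open>y\<close>; chaining the two gains the squared gradient
  difference. This step may leave a set that contains \<open>x\<close> and \<open>y\<close>, which
  is why the theorem takes the Lipschitz modulus on an enlarged set.\<close>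

lemma convex_lipschitz_gradient_lower_bound:
  fixes G :: "'a::real_inner \<Rightarrow> 'a"
  assumes f: "convex_on UNIV f" and G: "\<And>z. GDERIV f z :> G z"
    and lip: "L-lipschitz_on W G" "0 < L"
    and W: "convex W" "y \<in> W" "y + (1 / L) *\<^sub>R (G x - G y) \<in> W"
  shows "f x + G x \<bullet> (y - x) + 1 / (2 * L) * (norm (G x - G y))\<^sup>2 \<le> f y"
proof -
  define D where "D = G x - G y"
  define w where "w = y + (1 / L) *\<^sub>R D"
  have wy: "w - y = (1 / L) *\<^sub>R D" by (simp add: w_def)
  have "f x + G x \<bullet> (w - x) \<le> f w" by (rule convex_gradient_inequality[OF f G])
  also have "\<dots> \<le> f y + G y \<bullet> (w - y) + L / 2 * (norm (w - y))\<^sup>2"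
    by (rule lipschitz_gradient_upper_bound[OF G lip(1) W(1,2)]) (use W(3) in \<open>simp add: w_def D_def\<close>)
  finally have "f x + G x \<bullet> (w - x) \<le> f y + G y \<bullet> (w - y) + L / 2 * (norm (w - y))\<^sup>2" .
  moreover have "L / 2 * (norm (w - y))\<^sup>2 = 1 / (2 * L) * (norm D)\<^sup>2"
    unfolding wy using lip(2) by (simp add: power2_eq_square)
  moreover have "G x \<bullet> (w - x) = G x \<bullet> (y - x) + G x \<bullet> (w - y)"
    by (simp add: inner_diff_right)
  moreover have "G x \<bullet> (w - y) - G y \<bullet> (w - y) = 1 / L * (norm D)\<^sup>2"
    unfolding inner_diff_left[symmetric] D_def[symmetric] wy
    by (simp add: power2_norm_eq_inner)
  moreover have "1 / L * (norm D)\<^sup>2 = 2 * (1 / (2 * L) * (norm D)\<^sup>2)" using lip(2) by simp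
  ultimately show ?thesis unfolding D_def[symmetric] by linarith
qed

lemma mem_enlarged:
  fixes V :: "'a::real_normed_vector set"
  assumes "bounded V" "v \<in> V"
  shows "v \<in> {v + u | v u. v \<in> V \<and> norm u \<le> diameter V}"
proof -
  have "v = v + 0 \<and> v \<in> V \<and> norm (0::'a) \<le> diameter V"
    using assms diameter_ge_0[OF assms(1)] by simp
  then show ?thesis by blast
qed

text \<open>The gradient step has length at most \<open>norm (v - w)\<close>, hence at most
  \<open>diameter V\<close>, and stays in the enlarged set. Adding the lower bounds for both orders
  of the two points gives cocoercivity.\<close>

lemma convex_lipschitz_gradient_cocoercive:
  fixes G :: "'a::real_inner \<Rightarrow> 'a"
  assumes f: "convex_on UNIV f" and G: "\<And>z. GDERIV f z :> G z"
    and V: "convex V" "bounded V" "x \<in> V" "y \<in> V"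
    and lip: "L-lipschitz_on {v + u | v u. v \<in> V \<and> norm u \<le> diameter V} G" "0 < L"
  shows "(norm (G x - G y))\<^sup>2 \<le> L * ((G x - G y) \<bullet> (x - y))"
proof -
  let ?W = "{v + u | v u. v \<in> V \<and> norm u \<le> diameter V}"
  have "?W = (\<Union>v\<in>V. \<Union>u\<in>cball 0 (diameter V). {v + u})" by auto blast
  then have W: "convex ?W"
    using convex_sums[OF V(1) convex_cball[of 0 "diameter V"]] by simp
  note VW = mem_enlarged[OF V(2)]
  have step: "norm ((1 / L) *\<^sub>R (G v - G w)) \<le> diameter V" if "v \<in> V" "w \<in> V" for v w
  proof -
    have "norm (G v - G w) \<le> L * norm (v - w)"
      using lipschitz_onD[OF lip(1) VW VW] that by (simp add: dist_norm)
    moreover have "norm (v - w) \<le> diameter V"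
      using diameter_bounded_bound[OF V(2) that] by (simp add: dist_norm)
    ultimately have "norm (G v - G w) \<le> L * diameter V"
      using lip(2) by (meson mult_left_mono less_imp_le order_trans)
    then have "norm (G v - G w) / L \<le> diameter V"
      using lip(2) by (simp add: divide_le_eq mult.commute)
    then show ?thesis using lip(2) by simp
  qed
  have "f v + G v \<bullet> (w - v) + 1 / (2 * L) * (norm (G v - G w))\<^sup>2 \<le> f w" if "v \<in> V" "w \<in> V" for v w
  proof (rule convex_lipschitz_gradient_lower_bound[OF f G lip W])
    show "w \<in> ?W" using that(2) by (rule VW)
    show "w + (1 / L) *\<^sub>R (G v - G w) \<in> ?W" using that(2) step[OF that] by blast
  qed
  from this[OF V(3,4)] this[OF V(4,3)]
  have "1 / L * (norm (G x - G y))\<^sup>2 \<le> (G x - G y) \<bullet> (x - y)"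
    by (simp add: inner_diff_left inner_diff_right norm_minus_commute)
  then show ?thesis using lip(2) by (simp add: field_simps)
qed

text \<open>A minimizer of the composite function still minimizes it after f is linearised there:
  along a segment, convexity bounds the change of g and h, and the derivative gives that of f.
  Duality then supplies the dual variable.\<close>

lemma primal_dual_solution_exists:
  fixes g :: "'a::euclidean_space \<Rightarrow> ereal" and h :: "'b::euclidean_space \<Rightarrow> ereal"
  assumes G: "\<And>z. GDERIV f z :> G z"
    and g: "proper_fun g" "convex_fun g" and h: "proper_fun h" "convex_fun h"
    and A: "linear A"
    and minimizer: "\<exists>z. is_arg_min (\<lambda>z. ereal (f z) + g z + h (A z)) (\<lambda>_. True) z"
    and qual: "\<exists>z \<in> rel_interior (eff_dom g). A z \<in> rel_interior (eff_dom h)"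
  obtains z y where "primal_dual_solution G g h A z y" "proper_fun (conjugate h)"
proof -
  obtain z where z: "ereal (f z) + g z + h (A z) \<le> ereal (f w) + g w + h (A w)" for w
    using minimizer by (auto simp: is_arg_min_def not_less)
  obtain q where "q \<in> eff_dom g" "A q \<in> eff_dom h"
    using qual rel_interior_subset[of "eff_dom g"] rel_interior_subset[of "eff_dom h"] by auto
  then obtain aq bq where "g q = ereal aq" "h (A q) = ereal bq"
    using proper_fun_ereal g(1) h(1) by metis
  with z[of q] have fin: "ereal (f z) + g z + h (A z) \<noteq> \<infinity>" by auto
  obtain a0 where a0: "g z = ereal a0" using fin g(1) unfolding proper_fun_def by (cases "g z") auto
  obtain b0 where b0: "h (A z) = ereal b0"
    using fin h(1) unfolding proper_fun_def by (cases "h (A z)") (auto simp: a0)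
  have min: "a0 + b0 \<le> a + b + G z \<bullet> (w - z)" if "g w = ereal a" "h (A w) = ereal b" for w a b
  proof -
    have "0 \<le> G z \<bullet> (w - z) + (a + b - a0 - b0)"
    proof (rule GDERIV_nonneg_direction[OF G])
      fix u :: real assume u: "0 < u" "u \<le> 1"
      let ?p = "(1 - u) *\<^sub>R z + u *\<^sub>R w"
      have p: "?p = z + u *\<^sub>R (w - z)" by (simp add: algebra_simps)
      have "A ?p = (1 - u) *\<^sub>R A z + u *\<^sub>R A w" by (simp only: linear_add[OF A] linear_scale[OF A])
      then have "h (A ?p) \<le> ereal ((1 - u) * b0 + u * b)"
        using u convex_funD[OF h(2) b0 that(2)] by simp
      moreover have "g ?p \<le> ereal ((1 - u) * a0 + u * a)"
        using u convex_funD[OF g(2) a0 that(1)] by simp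
      ultimately have "ereal (f ?p) + g ?p + h (A ?p)
          \<le> ereal (f ?p) + ereal ((1 - u) * a0 + u * a) + ereal ((1 - u) * b0 + u * b)"
        by (intro add_mono) auto
      from order_trans[OF z[of ?p] this] have "f z + a0 + b0 \<le> f ?p + ((1 - u) * a0 + u * a) + ((1 - u) * b0 + u * b)"
        unfolding a0 b0 by simp
      then show "f z \<le> f (z + u *\<^sub>R (w - z)) + u * (a + b - a0 - b0)"
        unfolding p by (simp add: algebra_simps)
    qed
    then show ?thesis by simp
  qed
  obtain y where y: "y \<in> subdifferential h (A z)" "- G z - adjoint A y \<in> subdifferential g z"
    using fenchel_duality[OF g h A qual a0 b0 min] by blast
  have "primal_dual_solution G g h A z y"
    unfolding primal_dual_solution_def
  proof
    show "0 \<in> (\<lambda>v. - A z + v) ` subdifferential (conjugate h) y"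
      by (rule image_eqI[OF _ subdifferential_conjugate(1)[OF h(1) y(1)]]) simp
    show "0 \<in> (\<lambda>v. adjoint A y + G z + v) ` subdifferential g z"
      by (rule image_eqI[OF _ y(2)]) simp
  qed
  then show thesis using subdifferential_conjugate(2)[OF h(1) y(1)] by (rule that)
qed

section \<open>One-step estimates\<close>

lemma locally_lipschitz_enlarged:
  fixes G :: "'a::euclidean_space \<Rightarrow> 'a"
  assumes "locally_lipschitz G" "bounded V"
  obtains L where "0 < L" "L-lipschitz_on {v + u | v u. v \<in> V \<and> norm u \<le> diameter V} G"
proof -
  obtain R where R: "\<And>v. v \<in> V \<Longrightarrow> norm v \<le> R" using assms(2) bounded_iff by blast
  obtain L where L: "0 < L" "L-lipschitz_on (cball 0 (R + diameter V)) G"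
    using assms(1) unfolding locally_lipschitz_def by (meson convex_cball compact_cball)
  have "norm (v + u) \<le> R + diameter V" if "v \<in> V" "norm u \<le> diameter V" for v u
    using R[OF that(1)] that(2) norm_triangle_ineq[of v u] by linarith
  then have "{v + u | v u. v \<in> V \<and> norm u \<le> diameter V} \<subseteq> cball 0 (R + diameter V)" by auto
  from that[OF L(1) lipschitz_on_subset[OF L(2) this]] show thesis .
qed

text \<open>Follows from cocoercivity on a ball containing both points. It makes the value of
  \<open>cocoercivity_est\<close> at a zero denominator the intended one, since the numerator then
  vanishes too.\<close>

lemma convex_gradient_eq:
  fixes G :: "'a::euclidean_space \<Rightarrow> 'a"
  assumes "convex_on UNIV f" "\<And>z. GDERIV f z :> G z" "locally_lipschitz G"
    and "(G u - G v) \<bullet> (u - v) = 0"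
  shows "G u = G v"
proof -
  define V :: "'a set" where "V = cball 0 (max (norm u) (norm v))"
  have V: "convex V" "bounded V" "u \<in> V" "v \<in> V" unfolding V_def by auto
  obtain L where "0 < L" "L-lipschitz_on {v + u | v u. v \<in> V \<and> norm u \<le> diameter V} G"
    using locally_lipschitz_enlarged[OF assms(3) V(2)] .
  from convex_lipschitz_gradient_cocoercive[OF assms(1,2) V this(2,1)] assms(4)
  show ?thesis by simp
qed

text \<open>For a zero denominator the quotient is infinite and the multiplied form trivially true,
  so later arguments about the stepsize rule work with real inequalities and without case
  distinctions.\<close>

lemma le_one_divide_ereal_iff:
  assumes "0 \<le> b"
  shows "ereal m \<le> 1 / ereal b \<longleftrightarrow> m * b \<le> 1" "0 < 1 / ereal b"
proof -
  have "1 / ereal b = (if b = 0 then \<infinity> else ereal (1 / b))"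
    by (simp add: one_ereal_def)
  then show "ereal m \<le> 1 / ereal b \<longleftrightarrow> m * b \<le> 1" "0 < 1 / ereal b"
    using assms by (auto simp: field_simps)
qed

lemma Min_five:
  fixes a b c d e :: "'c::linorder"
  shows "Min {a, b, c, d, e} = min a (min b (min c (min d e)))"
  by simp

lemma le_divide_ereal_iff:
  fixes a b m :: real
  assumes "0 < a" "0 \<le> b"
  shows "ereal m \<le> ereal a / ereal b \<longleftrightarrow> m * b \<le> a" "0 < ereal a / ereal b"
proof -
  have "ereal a / ereal b = (if b = 0 then \<infinity> else ereal (a / b))"
    using assms by simp
  then show "ereal m \<le> ereal a / ereal b \<longleftrightarrow> m * b \<le> a" "0 < ereal a / ereal b"
    using assms by (auto simp: field_simps)
qed

lemma le_esqrt_iff: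
  assumes "0 < c" "0 < a" "0 \<le> b" "0 \<le> m"
  shows "ereal m \<le> ereal c * esqrt (ereal a / ereal b) \<longleftrightarrow> m\<^sup>2 * b \<le> c\<^sup>2 * a"
    "0 < ereal c * esqrt (ereal a / ereal b)"
proof -
  show "ereal m \<le> ereal c * esqrt (ereal a / ereal b) \<longleftrightarrow> m\<^sup>2 * b \<le> c\<^sup>2 * a"
  proof (cases "b = 0")
    case True
    then show ?thesis using assms by (simp add: esqrt_def)
  next
    case False
    then have "0 < b" using assms by simp
    then have "ereal m \<le> ereal c * esqrt (ereal a / ereal b) \<longleftrightarrow> m \<le> c * sqrt (a / b)"
      by (simp add: esqrt_def)
    also have "\<dots> \<longleftrightarrow> m\<^sup>2 \<le> (c * sqrt (a / b))\<^sup>2"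
      using assms by (simp add: abs_le_square_iff[symmetric])
    also have "(c * sqrt (a / b))\<^sup>2 = c\<^sup>2 * a / b"
      using assms by (simp add: power_mult_distrib)
    also have "m\<^sup>2 \<le> c\<^sup>2 * a / b \<longleftrightarrow> m\<^sup>2 * b \<le> c\<^sup>2 * a"
      using \<open>0 < b\<close> by (simp add: pos_le_divide_eq)
    finally show ?thesis .
  qed
  show "0 < ereal c * esqrt (ereal a / ereal b)"
    using assms by (cases "b = 0") (simp_all add: esqrt_def)
qed

text \<open>For positive \<open>q\<close> the positive root of
  \<open>q * z ^ 2 + 2 * d * z - a\<close> is \<open>(R - d) / q = a / (R + d)\<close>. The second
  form, multiplied out, also covers \<open>q = 0\<close> and a vanishing
  \<open>R + d\<close>.\<close>

lemma quadratic_root_bound: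
  fixes q a d z :: real
  assumes "0 \<le> q" "0 < a" "0 \<le> z" "z * (sqrt (d\<^sup>2 + q * a) + d) \<le> a"
  shows "q * z\<^sup>2 + 2 * d * z \<le> a"
proof -
  define R where "R = sqrt (d\<^sup>2 + q * a)"
  have nn: "0 \<le> d\<^sup>2 + q * a" using assms by simp
  have R2: "R\<^sup>2 = d\<^sup>2 + q * a" unfolding R_def using nn by simp
  have "\<bar>d\<bar> \<le> R" unfolding R_def using assms by (intro real_le_rsqrt) simp
  have eq: "(R + d) * (R - d) = q * a" using R2 by (simp add: power2_eq_square algebra_simps)
  show ?thesis
  proof (cases "R + d = 0")
    case True
    then have "q = 0" using eq assms(2) by simp
    moreover have "d * z \<le> 0" using True \<open>\<bar>d\<bar> \<le> R\<close> assms(3)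
      by (intro mult_nonpos_nonneg) auto
    ultimately show ?thesis using assms(2) by simp
  next
    case False
    then have pos: "0 < R + d" using \<open>\<bar>d\<bar> \<le> R\<close> by linarith
    have "q * (z * (R + d)) \<le> q * a" using assms(1,4) unfolding R_def by (intro mult_left_mono)
    then have "(q * z) * (R + d) \<le> (R - d) * (R + d)" using eq by (simp add: mult.commute mult.left_commute)
    then have "q * z \<le> R - d" using pos by simp
    then have "z * (q * z) \<le> z * (R - d)" using assms(3) by (rule mult_left_mono)
    then show ?thesis using assms(4) unfolding R_def[symmetric]
      by (simp add: power2_eq_square algebra_simps)
  qed
qed

section \<open>Descent inequalities of a single step\<close>

lemma inner_three_point:
  fixes a b c :: "'a::real_inner"
  shows "(a - b) \<bullet> (c - b)
      = 1 / 2 * (norm (b - a))\<^sup>2 + 1 / 2 * (norm (b - c))\<^sup>2 - 1 / 2 * (norm (a - c))\<^sup>2"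
  unfolding power2_norm_eq_inner
  by (simp add: inner_diff_left inner_diff_right inner_commute field_simps)

text \<open>Here \<open>xm\<close>, \<open>x0\<close>, \<open>xp\<close> stand for \<open>x\<^sup>k\<^sup>-\<^sup>1\<close>, \<open>x\<^sup>k\<close>, \<open>x\<^sup>k\<^sup>+\<^sup>1\<close>, \<open>c\<close> and \<open>cp\<close> for
  \<open>\<gamma>\<^sub>k\<close> and \<open>\<gamma>\<^sub>k\<^sub>+\<^sub>1\<close>, and \<open>a0\<close>, \<open>ap\<close> for \<open>A\<^sup>T y\<^sup>k\<close>, \<open>A\<^sup>T y\<^sup>k\<^sup>+\<^sup>1\<close>. The key is the identity
  \<open>\<parallel>H\<parallel>\<^sup>2 = H \<bullet> D + \<delta> \<parallel>D\<parallel>\<^sup>2\<close> for \<open>H = D - c (Gm - G0)\<close>, in which \<open>H \<bullet> D\<close> is controlled by the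
  decrease of \<open>f + g\<close>.\<close>

lemma primal_descent:
  fixes x0 xm xp xs G0 Gm a0 ap :: "'a::real_inner" and c cp \<delta> :: real
  assumes pos: "0 < c" "0 < cp" and r: "r = cp / c" and D: "D = xm - x0"
    and gs: "gp + ((1 / cp) *\<^sub>R (x0 - xp) - G0 - ap) \<bullet> (xs - xp) \<le> gs"
    and fs: "f0 + G0 \<bullet> (xs - x0) \<le> fs"
    and gm: "g0 + ((1 / c) *\<^sub>R (xm - x0) - Gm - a0) \<bullet> (xm - x0) \<le> gm"
    and fm: "f0 + G0 \<bullet> (xm - x0) \<le> fm"
    and gp: "g0 + ((1 / c) *\<^sub>R (xm - x0) - Gm - a0) \<bullet> (xp - x0) \<le> gp"
    and \<delta>: "\<delta> * (norm D)\<^sup>2 = c\<^sup>2 * (norm (Gm - G0))\<^sup>2 - c * ((Gm - G0) \<bullet> D)"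
  shows "1 / 2 * (norm (xp - xs))\<^sup>2 + 1 / 4 * (norm (xp - x0))\<^sup>2
    \<le> 1 / 2 * (norm (x0 - xs))\<^sup>2 + r\<^sup>2 * \<delta> * (norm D)\<^sup>2
      + cp * (fs + gs - f0 - g0) + cp * r * (fm + gm - f0 - g0)
      + cp * r * (a0 \<bullet> D) + cp * (a0 \<bullet> (xp - x0)) + cp * (ap \<bullet> (xs - xp))"
proof -
  define H where "H = D - c *\<^sub>R (Gm - G0)"
  have rpos: "0 < r" and rc: "r * c = cp" "cp / c = r" using pos r by auto
  have "cp * (gp + ((1 / cp) *\<^sub>R (x0 - xp) - G0 - ap) \<bullet> (xs - xp)) \<le> cp * gs"
    using gs pos by simp
  then have 1: "cp * gp + (x0 - xp) \<bullet> (xs - xp) - cp * (G0 \<bullet> (xs - xp)) - cp * (ap \<bullet> (xs - xp)) \<le> cp * gs"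
  proof -
    have "cp * (((1 / cp) *\<^sub>R (x0 - xp) - G0 - ap) \<bullet> w) = (x0 - xp) \<bullet> w - cp * (G0 \<bullet> w) - cp * (ap \<bullet> w)" for w
      unfolding inner_diff_left[of _ ap] inner_diff_left[of _ G0] inner_scaleR_left
      using pos by (simp add: right_diff_distrib)
    with \<open>cp * _ \<le> cp * gs\<close> show ?thesis by (simp add: distrib_left)
  qed
  have polar: "(x0 - xp) \<bullet> (xs - xp)
      = 1 / 2 * (norm (xp - x0))\<^sup>2 + 1 / 2 * (norm (xp - xs))\<^sup>2 - 1 / 2 * (norm (x0 - xs))\<^sup>2"
    by (rule inner_three_point)
  have 2: "cp * f0 + cp * (G0 \<bullet> (xs - x0)) \<le> cp * fs"
    using mult_left_mono[OF fs, of cp] pos by (simp add: distrib_left)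
  \<comment> \<open>Trading \<open>Gm\<close> for \<open>G0\<close> writes the subgradient at
    \<open>x0\<close> as \<open>H / c - G0 - a0\<close>; the terms with \<open>G0\<close> then
    cancel in the sum of all inequalities.\<close>
  have inner_v: "((1 / c) *\<^sub>R (xm - x0) - Gm - a0) \<bullet> w
      = (1 / c) * (H \<bullet> w) - G0 \<bullet> w - a0 \<bullet> w" for w
    unfolding H_def D using pos by (simp add: inner_diff_left inner_add_left field_simps)
  have 3: "cp * r * (g0 + f0) + r\<^sup>2 * (H \<bullet> D) - cp * r * (a0 \<bullet> D) \<le> cp * r * (gm + fm)"
  proof -
    have "g0 + f0 + (1 / c) * (H \<bullet> D) - a0 \<bullet> D \<le> gm + fm"
      using gm fm unfolding inner_v unfolding D[symmetric] by linarith
    then have "cp * r * (g0 + f0 + (1 / c) * (H \<bullet> D) - a0 \<bullet> D) \<le> cp * r * (gm + fm)"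
      using pos rpos by (intro mult_left_mono) auto
    moreover have "cp * r * ((1 / c) * (H \<bullet> D)) = r\<^sup>2 * (H \<bullet> D)"
      unfolding rc(1)[symmetric] using pos by (simp add: power2_eq_square)
    ultimately show ?thesis by (simp add: algebra_simps)
  qed
  have 4: "cp * g0 + r * (H \<bullet> (xp - x0)) - cp * (G0 \<bullet> (xp - x0)) - cp * (a0 \<bullet> (xp - x0)) \<le> cp * gp"
  proof -
    have "cp * (g0 + ((1 / c) * (H \<bullet> (xp - x0)) - G0 \<bullet> (xp - x0) - a0 \<bullet> (xp - x0))) \<le> cp * gp"
      using gp pos unfolding inner_v by simp
    moreover have "cp * ((1 / c) * (H \<bullet> (xp - x0))) = r * (H \<bullet> (xp - x0))"
      using rc(2) by (simp add: r)
    ultimately show ?thesis by (simp add: algebra_simps)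
  qed
  \<comment> \<open>The weight 1/4 consumes half of the square of \<open>norm (xp - x0)\<close> in
    \<open>polar\<close>; the other half stays on the left and later pays for the coupling.\<close>
  have young: "- (r * (H \<bullet> (xp - x0))) \<le> r\<^sup>2 * (norm H)\<^sup>2 + 1 / 4 * (norm (xp - x0))\<^sup>2"
  proof -
    have "0 \<le> (norm (r *\<^sub>R H + (1 / 2) *\<^sub>R (xp - x0)))\<^sup>2" by simp
    also have "\<dots> = r\<^sup>2 * (norm H)\<^sup>2 + r * (H \<bullet> (xp - x0)) + 1 / 4 * (norm (xp - x0))\<^sup>2"
      unfolding power2_norm_eq_inner
      by (simp only: inner_add_left inner_add_right inner_scaleR_left inner_scaleR_right)
         (simp add: inner_commute power2_eq_square algebra_simps)
    finally show ?thesis by simp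
  qed
  have "(norm H)\<^sup>2 = H \<bullet> D + \<delta> * (norm D)\<^sup>2"
    unfolding \<delta> unfolding H_def power2_norm_eq_inner
    by (simp only: inner_diff_left[of D] inner_diff_right[of _ D] inner_scaleR_left inner_scaleR_right)
       (simp add: inner_commute power2_eq_square algebra_simps)
  then have "r\<^sup>2 * (norm H)\<^sup>2 = r\<^sup>2 * (H \<bullet> D) + r\<^sup>2 * \<delta> * (norm D)\<^sup>2"
    by (simp add: distrib_left)
  moreover have "G0 \<bullet> (xs - xp) = G0 \<bullet> (xs - x0) - G0 \<bullet> (xp - x0)"
    by (simp add: inner_diff_right)
  then have "cp * (G0 \<bullet> (xs - xp)) = cp * (G0 \<bullet> (xs - x0)) - cp * (G0 \<bullet> (xp - x0))"
    by (simp add: right_diff_distrib)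
  moreover have "cp * (fs + gs - f0 - g0) = cp * fs + cp * gs - cp * f0 - cp * g0"
    "cp * r * (fm + gm - f0 - g0) = cp * r * (gm + fm) - cp * r * (g0 + f0)"
    by (simp_all add: algebra_simps)
  ultimately show ?thesis using 1 polar 2 3 4 young by linarith
qed

text \<open>\<open>u\<close> is the extrapolated image of the primal iterates and \<open>us\<close>
  the image of the primal solution. Replacing the first by the second makes the dual gap appear and
  leaves \<open>(us - u) \<bullet> (ys - yp)\<close> to be combined with the primal part.\<close>

lemma dual_descent:
  fixes y0 yp ys u us :: "'a::real_inner"
  assumes pos: "0 < cp" "0 < t"
    and hs: "hp + ((1 / (t\<^sup>2 * cp)) *\<^sub>R (y0 - yp) + u) \<bullet> (ys - yp) \<le> hs"
  shows "1 / (2 * t\<^sup>2) * (norm (yp - ys))\<^sup>2 + 1 / (2 * t\<^sup>2) * (norm (yp - y0))\<^sup>2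
    \<le> 1 / (2 * t\<^sup>2) * (norm (y0 - ys))\<^sup>2 - cp * (hp - hs + us \<bullet> (ys - yp)) + cp * ((us - u) \<bullet> (ys - yp))"
proof -
  have "cp * (hp + ((1 / (t\<^sup>2 * cp)) *\<^sub>R (y0 - yp) + u) \<bullet> (ys - yp)) \<le> cp * hs"
    using hs pos by simp
  moreover have "cp * (((1 / (t\<^sup>2 * cp)) *\<^sub>R (y0 - yp)) \<bullet> (ys - yp)) = 1 / t\<^sup>2 * ((y0 - yp) \<bullet> (ys - yp))"
    unfolding inner_scaleR_left using pos by (simp add: field_simps)
  moreover have "(y0 - yp) \<bullet> (ys - yp)
      = 1 / 2 * (norm (yp - y0))\<^sup>2 + 1 / 2 * (norm (yp - ys))\<^sup>2 - 1 / 2 * (norm (y0 - ys))\<^sup>2"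
    by (rule inner_three_point)
  then have "1 / t\<^sup>2 * ((y0 - yp) \<bullet> (ys - yp)) = 1 / (2 * t\<^sup>2) * (norm (yp - y0))\<^sup>2
      + 1 / (2 * t\<^sup>2) * (norm (yp - ys))\<^sup>2 - 1 / (2 * t\<^sup>2) * (norm (y0 - ys))\<^sup>2"
    by (simp add: right_diff_distrib distrib_left)
  ultimately show ?thesis by (simp add: inner_add_left[of _ u] inner_diff_left[of us] algebra_simps)
qed

text \<open>Applied to each half of the cross term. The two dual weights add up to
  \<open>1 / (2 * t\<^sup>2 * e)\<close>, which for \<open>e = 1 + \<epsilon>\<close> leaves the
  fraction \<open>\<epsilon> / (1 + \<epsilon>)\<close> of the dual residual.\<close>

lemma young_coupling:
  fixes t c \<eta> e n d :: real
  assumes "0 < t" "0 < e"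
  shows "c * \<eta> * n * d \<le> 1 / (4 * t\<^sup>2 * e) * n\<^sup>2 + t\<^sup>2 * \<eta>\<^sup>2 * c\<^sup>2 * e * d\<^sup>2"
proof -
  have "0 \<le> e * (n / (2 * t * e) - t * \<eta> * c * d)\<^sup>2" using assms by simp
  also have "\<dots> = 1 / (4 * t\<^sup>2 * e) * n\<^sup>2 + t\<^sup>2 * \<eta>\<^sup>2 * c\<^sup>2 * e * d\<^sup>2 - c * \<eta> * n * d"
    using assms by (simp add: power2_eq_square field_simps)
  finally show ?thesis by simp
qed

lemma primal_dual_solutionD:
  assumes "primal_dual_solution G g h A xs ys"
  shows "A xs \<in> subdifferential (conjugate h) ys" "- adjoint A ys - G xs \<in> subdifferential g xs"
proof -
  obtain v where "v \<in> subdifferential (conjugate h) ys" "0 = - A xs + v"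
    using assms unfolding primal_dual_solution_def by blast
  then show "A xs \<in> subdifferential (conjugate h) ys" by (simp add: add_eq_0_iff)
  obtain w where "w \<in> subdifferential g xs" "0 = adjoint A ys + G xs + w"
    using assms unfolding primal_dual_solution_def by blast
  moreover from this(2) have "w = - adjoint A ys - G xs" by (simp add: eq_neg_iff_add_eq_0 algebra_simps)
  ultimately show "- adjoint A ys - G xs \<in> subdifferential g xs" by simp
qed

text \<open>Used with \<open>e = 1 + \<epsilon>\<close>: the second term of the stepsize rule keeps
  \<open>t * a * c\<close> at most \<open>1 / (2 * \<nu>)\<close>, and \<open>e < \<nu>\<close> then
  keeps the numerator under the root of the third term away from 0.\<close>

lemma stepsize_slack_bounds:
  fixes \<nu> t a c e :: real
  assumes "0 < t" "0 \<le> a" "0 < c" "0 < e" "e < \<nu>" "2 * \<nu> * t * a * c \<le> 1"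
  shows "(\<nu>\<^sup>2 - e\<^sup>2) / \<nu>\<^sup>2 \<le> 1 - 4 * (t\<^sup>2 * a\<^sup>2 * c\<^sup>2) * e\<^sup>2" "0 < (\<nu>\<^sup>2 - e\<^sup>2) / \<nu>\<^sup>2"
proof -
  have "0 < \<nu>" using assms by linarith
  have "(2 * \<nu> * t * a * c)\<^sup>2 \<le> 1" using assms \<open>0 < \<nu>\<close> by (simp add: power_le_one)
  then have "4 * (t\<^sup>2 * a\<^sup>2 * c\<^sup>2) * \<nu>\<^sup>2 \<le> 1" by (simp add: power_mult_distrib mult_ac)
  then have "4 * (t\<^sup>2 * a\<^sup>2 * c\<^sup>2) * \<nu>\<^sup>2 * e\<^sup>2 \<le> 1 * e\<^sup>2" by (rule mult_right_mono) simp
  then show "(\<nu>\<^sup>2 - e\<^sup>2) / \<nu>\<^sup>2 \<le> 1 - 4 * (t\<^sup>2 * a\<^sup>2 * c\<^sup>2) * e\<^sup>2"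
    using \<open>0 < \<nu>\<close> by (simp add: field_simps)
  have "e\<^sup>2 < \<nu>\<^sup>2" using assms by (intro power_strict_mono) auto
  then show "0 < (\<nu>\<^sup>2 - e\<^sup>2) / \<nu>\<^sup>2" using \<open>0 < \<nu>\<close> by simp
qed

text \<open>Lower bound for the third term of the stepsize rule: \<open>a = \<gamma>\<^sub>k L\<close>, \<open>d = \<delta>\<^sub>k\<close>, and \<open>M\<close> is
  proportional to the square of the candidate lower bound. A positive \<open>\<delta>\<^sub>k\<close> forces \<open>a > 1\<close>,
  and only the sharp estimate \<open>d \<le> a\<^sup>2 - a\<close> (rather than \<open>a\<^sup>2\<close>) gives the constants of the theorem.\<close>

lemma scaled_root_sum_le_one:
  fixes M b d a :: real
  assumes "0 < M" "0 \<le> b" "M * b \<le> 1"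
    and d: "d \<le> 0 \<or> 1 < a \<and> d \<le> a\<^sup>2 - a \<and> M * (2 * a\<^sup>2) \<le> 1 \<and> M * b * a \<le> 1"
  shows "M * (sqrt (d\<^sup>2 + b\<^sup>2) + d) \<le> 1"
proof -
  \<comment> \<open>These two inequalities are the goal after isolating the root,
    \<open>sqrt ((M * d)\<^sup>2 + (M * b)\<^sup>2) \<le> 1 - M * d\<close>, and squaring.\<close>
  have *: "(M * b)\<^sup>2 + 2 * (M * d) \<le> 1 \<and> M * d \<le> 1"
    using d
  proof
    assume "d \<le> 0"
    then have "M * d \<le> 0" using assms(1) by (simp add: mult_le_0_iff)
    moreover have "(M * b)\<^sup>2 \<le> 1" using assms by (simp add: power_le_one)
    ultimately show ?thesis by linarith
  next
    assume a: "1 < a \<and> d \<le> a\<^sup>2 - a \<and> M * (2 * a\<^sup>2) \<le> 1 \<and> M * b * a \<le> 1"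
    have "M * b \<le> 1 / a" using a by (simp add: field_simps)
    then have "(M * b)\<^sup>2 \<le> (1 / a)\<^sup>2" using assms by (intro power_mono) auto
    also have "\<dots> \<le> 1 / a" using a by (simp add: power2_eq_square field_simps)
    finally have 1: "(M * b)\<^sup>2 \<le> 1 / a" .
    have M: "M \<le> 1 / (2 * a\<^sup>2)" using a by (simp add: field_simps)
    have "M * d \<le> M * (a\<^sup>2 - a)" using a assms(1) by (intro mult_left_mono) auto
    also have "\<dots> \<le> 1 / (2 * a\<^sup>2) * (a\<^sup>2 - a)"
      using M a by (intro mult_right_mono) (auto simp: power2_eq_square)
    also have "\<dots> = (1 - 1 / a) / 2" using a by (simp add: power2_eq_square field_simps)
    finally have 2: "M * d \<le> (1 - 1 / a) / 2" .
    define i where "i = 1 / a"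
    have "0 < i" using a by (simp add: i_def)
    have 3: "2 * (M * d) \<le> 1 - i" using 2 unfolding i_def by simp
    then have "M * d \<le> 1" using \<open>0 < i\<close> by linarith
    moreover have "(M * b)\<^sup>2 + 2 * (M * d) \<le> 1" using 1[folded i_def] 3 by linarith
    ultimately show ?thesis by simp
  qed
  have "sqrt ((M * d)\<^sup>2 + (M * b)\<^sup>2) \<le> 1 - M * d"
    by (rule real_le_lsqrt) (use * in \<open>auto simp: power2_eq_square algebra_simps\<close>)
  moreover have "sqrt ((M * d)\<^sup>2 + (M * b)\<^sup>2) = M * sqrt (d\<^sup>2 + b\<^sup>2)"
  proof -
    have "(M * d)\<^sup>2 + (M * b)\<^sup>2 = M\<^sup>2 * (d\<^sup>2 + b\<^sup>2)" by (simp add: power_mult_distrib algebra_simps)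
    then show ?thesis using assms(1) by (simp add: real_sqrt_mult)
  qed
  ultimately show ?thesis by (simp add: distrib_left)
qed

section \<open>The iteration and its stepsizes\<close>

text \<open>The minimizer and the qualification are represented by what duality extracts from them,
  \<open>solvable\<close> and \<open>conjugate_proper\<close>, which also make the proximal steps
  well defined.\<close>

locale adaptive_primal_dual =
  fixes f :: "'a::euclidean_space \<Rightarrow> real"
    and gradf :: "'a \<Rightarrow> 'a"
    and g :: "'a \<Rightarrow> ereal"
    and h :: "'b::euclidean_space \<Rightarrow> ereal"
    and A :: "'a \<Rightarrow> 'b"
    and t \<epsilon> \<nu> \<eta>max :: real
    and x :: "int \<Rightarrow> 'a"
    and y :: "int \<Rightarrow> 'b"
    and \<gamma> \<sigma> \<eta> \<rho> \<xi> \<delta> :: "int \<Rightarrow> real"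
  assumes f_convex: "convex_on UNIV f"
    and f_gradient: "\<And>z. GDERIV f z :> gradf z"
    and f_smooth: "locally_lipschitz gradf"
    and g: "proper_fun g" "convex_fun g" "lsc_fun g"
    and h: "proper_fun h"
    and A: "linear A"
    and conjugate_proper: "proper_fun (conjugate h)"
    and solvable: "\<exists>xs ys. primal_dual_solution gradf g h A xs ys"
    and parameters: "0 < t" "0 \<le> \<epsilon>" "1 + \<epsilon> < \<nu>"
    and initial_steps: "0 < \<gamma> (-1)" "\<gamma> (-1) \<le> \<gamma> 0"
    and y_update: "\<And>k. 0 \<le> k \<Longrightarrow>
      y (k + 1) = prox (\<sigma> (k + 1)) (conjugate h)
        (y k + \<sigma> (k + 1) *\<^sub>R ((1 + \<gamma> (k + 1) / \<gamma> k) *\<^sub>R A (x k)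
                              - (\<gamma> (k + 1) / \<gamma> k) *\<^sub>R A (x (k - 1))))"
    and x_update: "\<And>k. 0 \<le> k \<Longrightarrow>
      x (k + 1) = prox (\<gamma> (k + 1)) g
        (x k - \<gamma> (k + 1) *\<^sub>R gradf (x k) - \<gamma> (k + 1) *\<^sub>R adjoint A (y (k + 1)))"
    and \<rho>: "\<And>k. 0 \<le> k \<Longrightarrow> \<rho> k = \<gamma> k / \<gamma> (k - 1)"
    and \<xi>: "\<And>k. 0 \<le> k \<Longrightarrow> \<xi> k = t\<^sup>2 * (\<eta> k)\<^sup>2 * (\<gamma> k)\<^sup>2"
    and \<delta>: "\<And>k. 0 \<le> k \<Longrightarrow>
      \<delta> k = \<gamma> k * lip_est gradf (x (k - 1)) (x k)
              * (\<gamma> k * cocoercivity_est gradf (x (k - 1)) (x k) - 1)"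
    and \<eta>_initial: "0 \<le> \<eta> 0" "\<eta> 0 \<le> 1 / (2 * \<nu> * t * \<gamma> 0)"
    and \<eta>_lower: "\<And>k. 0 \<le> k \<Longrightarrow>
      norm (adjoint A (y k - y (k + 1))) / norm (y k - y (k + 1)) \<le> \<eta> (k + 1)"
    and \<eta>_upper: "\<And>k. 0 \<le> k \<Longrightarrow> \<eta> (k + 1) \<le> \<eta>max"
    and dual_steps: "\<And>k. 0 \<le> k \<Longrightarrow> \<sigma> k = t\<^sup>2 * \<gamma> k"
    and primal_steps: "\<And>k. 0 \<le> k \<Longrightarrow>
      ereal (\<gamma> (k + 1)) = Min {
        ereal (\<gamma> k * sqrt (1 + \<gamma> k / \<gamma> (k - 1))),
        1 / ereal (2 * \<nu> * t * \<eta> (k + 1)),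
        ereal (\<gamma> k) * esqrt (ereal (1 - 4 * \<xi> k * (1 + \<epsilon>)\<^sup>2)
          / ereal (2 * (1 + \<epsilon>)
              * (sqrt ((\<delta> k)\<^sup>2 + (t * \<eta> (k + 1) * \<gamma> k)\<^sup>2 * (1 - 4 * \<xi> k * (1 + \<epsilon>)\<^sup>2)) + \<delta> k)))}"
begin

text \<open>\<open>slack k\<close> and \<open>denom k\<close> are the numerator and denominator
  under the root in the third term of the stepsize rule.\<close>

definition slack where "slack k = 1 - 4 * \<xi> k * (1 + \<epsilon>)\<^sup>2"

definition denom where
  "denom k = 2 * (1 + \<epsilon>) * (sqrt ((\<delta> k)\<^sup>2 + (t * \<eta> (k + 1) * \<gamma> k)\<^sup>2 * slack k) + \<delta> k)"

definition nu_bar where "nu_bar = (\<nu>\<^sup>2 - (1 + \<epsilon>)\<^sup>2) / \<nu>\<^sup>2"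

lemma eta_nonneg:
  assumes "0 \<le> k"
  shows "0 \<le> \<eta> k"
proof (cases "k = 0")
  case False
  then have "norm (adjoint A (y (k - 1) - y (k - 1 + 1))) / norm (y (k - 1) - y (k - 1 + 1)) \<le> \<eta> (k - 1 + 1)"
    using assms by (intro \<eta>_lower) simp
  moreover have "0 \<le> norm (adjoint A (y (k - 1) - y (k - 1 + 1))) / norm (y (k - 1) - y (k - 1 + 1))"
    by simp
  ultimately have "0 \<le> \<eta> (k - 1 + 1)" by (rule order_trans[rotated])
  then show ?thesis by simp
qed (use \<eta>_initial in simp)

lemma eta_le_max: "1 \<le> k \<Longrightarrow> \<eta> k \<le> \<eta>max"
  using \<eta>_upper[of "k - 1"] by simp

lemma nu_pos: "0 < \<nu>"
  using parameters by linarith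

lemma slack_bounds:
  assumes "0 \<le> k" "0 < \<gamma> k" "2 * \<nu> * t * \<eta> k * \<gamma> k \<le> 1"
  shows "nu_bar \<le> slack k" "0 < nu_bar"
  using stepsize_slack_bounds[of t "\<eta> k" "\<gamma> k" "1 + \<epsilon>" \<nu>] assms eta_nonneg parameters
  unfolding nu_bar_def slack_def \<xi>[OF assms(1)] by auto

lemma denom_nonneg:
  assumes "0 \<le> slack k"
  shows "0 \<le> denom k"
proof -
  have "\<bar>\<delta> k\<bar> \<le> sqrt ((\<delta> k)\<^sup>2 + (t * \<eta> (k + 1) * \<gamma> k)\<^sup>2 * slack k)"
    using assms by (intro real_le_rsqrt) simp
  then show ?thesis unfolding denom_def using parameters by (intro mult_nonneg_nonneg) auto
qed

text \<open>The stepsize rule with its possibly infinite terms multiplied out. It serves in both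
  directions: \<open>m = \<gamma> (k + 1)\<close> gives upper bounds, another candidate
  \<open>m\<close> gives lower bounds. Positivity is a premise because the induction that
  establishes it uses this lemma.\<close>

lemma next_step_iff:
  assumes k: "0 \<le> k" "0 < \<gamma> k" "0 < \<gamma> (k - 1)" and slack: "0 < slack k"
  shows "0 \<le> m \<Longrightarrow> m \<le> \<gamma> (k + 1) \<longleftrightarrow> m \<le> \<gamma> k * sqrt (1 + \<gamma> k / \<gamma> (k - 1))
      \<and> m * (2 * \<nu> * t * \<eta> (k + 1)) \<le> 1 \<and> m\<^sup>2 * denom k \<le> (\<gamma> k)\<^sup>2 * slack k"
    "0 < \<gamma> (k + 1)"
proof -
  have d: "0 \<le> denom k" using denom_nonneg slack by simp
  have b: "0 \<le> 2 * \<nu> * t * \<eta> (k + 1)" using nu_pos parameters eta_nonneg k by simp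
  have eq: "ereal (\<gamma> (k + 1)) = min (ereal (\<gamma> k * sqrt (1 + \<gamma> k / \<gamma> (k - 1))))
      (min (1 / ereal (2 * \<nu> * t * \<eta> (k + 1))) (ereal (\<gamma> k) * esqrt (ereal (slack k) / ereal (denom k))))"
    using primal_steps[OF k(1)] unfolding slack_def denom_def by simp
  have "ereal m \<le> ereal (\<gamma> (k + 1)) \<longleftrightarrow> m \<le> \<gamma> k * sqrt (1 + \<gamma> k / \<gamma> (k - 1))
      \<and> m * (2 * \<nu> * t * \<eta> (k + 1)) \<le> 1 \<and> m\<^sup>2 * denom k \<le> (\<gamma> k)\<^sup>2 * slack k" if "0 \<le> m"
    unfolding eq min.bounded_iff le_one_divide_ereal_iff(1)[OF b] le_esqrt_iff(1)[OF k(2) slack d that]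
    by simp
  then show "0 \<le> m \<Longrightarrow> m \<le> \<gamma> (k + 1) \<longleftrightarrow> m \<le> \<gamma> k * sqrt (1 + \<gamma> k / \<gamma> (k - 1))
      \<and> m * (2 * \<nu> * t * \<eta> (k + 1)) \<le> 1 \<and> m\<^sup>2 * denom k \<le> (\<gamma> k)\<^sup>2 * slack k" by simp
  have "0 < 1 + \<gamma> k / \<gamma> (k - 1)" using k by (simp add: add_pos_pos)
  then have "0 < ereal (\<gamma> (k + 1))"
    unfolding eq min_less_iff_conj
    using le_one_divide_ereal_iff(2)[OF b] le_esqrt_iff(2)[OF k(2) slack d order_refl] k(2) by simp
  then show "0 < \<gamma> (k + 1)" by simp
qed

text \<open>The facts feed one another: the bound on \<open>\<eta> k * \<gamma> k\<close> makes
  \<open>slack k\<close> positive, this makes the next stepsize positive, and the second term of the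
  rule restores the bound.\<close>

lemma steps_pos_and_bounded:
  assumes "0 \<le> k"
  shows "0 < \<gamma> (k - 1) \<and> 0 < \<gamma> k \<and> 2 * \<nu> * t * \<eta> k * \<gamma> k \<le> 1"
  using assms
proof (induction k rule: int_ge_induct)
  case base
  have "0 < \<gamma> 0" using initial_steps by linarith
  moreover have "\<eta> 0 * (2 * \<nu> * t * \<gamma> 0) \<le> 1"
    using \<eta>_initial(2) \<open>0 < \<gamma> 0\<close> nu_pos parameters by (simp add: field_simps)
  ultimately show ?case using initial_steps by (simp add: mult_ac)
next
  case (step k)
  then have "0 < slack k" using slack_bounds[of k] by simp
  note next_step_iff[OF step(1) _ _ this]
  from this(2) this(1)[of "\<gamma> (k + 1)"] step(2) have "0 < \<gamma> (k + 1)"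
    "\<gamma> (k + 1) * (2 * \<nu> * t * \<eta> (k + 1)) \<le> 1" by auto
  then show ?case using step(2) by (simp add: mult_ac)
qed

lemma gamma_pos: "-1 \<le> k \<Longrightarrow> 0 < \<gamma> k"
  using steps_pos_and_bounded[of "k + 1"] by simp

lemma eta_gamma_le: "0 \<le> k \<Longrightarrow> 2 * \<nu> * t * \<eta> k * \<gamma> k \<le> 1"
  using steps_pos_and_bounded by blast

lemma nu_bar_le_slack: "0 \<le> k \<Longrightarrow> nu_bar \<le> slack k"
  using slack_bounds steps_pos_and_bounded by blast

lemma nu_bar_pos: "0 < nu_bar"
  using slack_bounds[of 0] steps_pos_and_bounded[of 0] by auto

lemma slack_pos: "0 \<le> k \<Longrightarrow> 0 < slack k"
  using nu_bar_le_slack[of k] nu_bar_pos by linarith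

lemma le_next_step_iff:
  assumes "0 \<le> k" "0 \<le> m"
  shows "m \<le> \<gamma> (k + 1) \<longleftrightarrow> m \<le> \<gamma> k * sqrt (1 + \<gamma> k / \<gamma> (k - 1))
      \<and> m * (2 * \<nu> * t * \<eta> (k + 1)) \<le> 1 \<and> m\<^sup>2 * denom k \<le> (\<gamma> k)\<^sup>2 * slack k"
  using next_step_iff(1)[of k m] assms slack_pos gamma_pos by simp

lemma next_step:
  assumes "0 \<le> k"
  shows "\<gamma> (k + 1) \<le> \<gamma> k * sqrt (1 + \<gamma> k / \<gamma> (k - 1))" "(\<gamma> (k + 1))\<^sup>2 * denom k \<le> (\<gamma> k)\<^sup>2 * slack k"
  using le_next_step_iff[of k "\<gamma> (k + 1)"] assms gamma_pos[of "k + 1"] by auto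

lemma rho_pos: "0 \<le> k \<Longrightarrow> 0 < \<rho> k"
  using \<rho>[of k] gamma_pos[of k] gamma_pos[of "k - 1"] by simp

lemma rho_next: "0 \<le> k \<Longrightarrow> \<rho> (k + 1) = \<gamma> (k + 1) / \<gamma> k"
  using \<rho>[of "k + 1"] by simp

lemma rho_square_le:
  assumes "0 \<le> k"
  shows "(\<rho> (k + 1))\<^sup>2 \<le> 1 + \<rho> k"
proof -
  have "\<rho> (k + 1) \<le> sqrt (1 + \<rho> k)"
    unfolding rho_next[OF assms] using next_step(1)[OF assms] gamma_pos[of k] assms
    by (simp add: divide_le_eq mult.commute \<rho>)
  then have "(\<rho> (k + 1))\<^sup>2 \<le> (sqrt (1 + \<rho> k))\<^sup>2"
    using rho_pos[of "k + 1"] assms by (intro power_mono) auto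
  then show ?thesis using rho_pos[OF assms] by simp
qed

text \<open>With \<open>2 * e * s\<close> for \<open>z\<close>, the third term of the stepsize rule
  is the premise of \<open>quadratic_root_bound\<close>. Its conclusion, rescaled by
  \<open>e\<close>, is the claim, because \<open>q * s = \<xi> (k + 1)\<close>.\<close>

lemma residual_coefficient_ge:
  assumes "0 \<le> k"
  shows "\<epsilon> / (4 * (1 + \<epsilon>)) \<le> (1 - 4 * \<xi> k * (1 + \<epsilon>)
      - 4 * (\<rho> (k + 1))\<^sup>2 * (\<delta> k + \<xi> (k + 1) * (1 + \<epsilon>))) / 4"
proof -
  define s q e where "s = (\<rho> (k + 1))\<^sup>2" and "q = (t * \<eta> (k + 1) * \<gamma> k)\<^sup>2" and "e = 1 + \<epsilon>"
  have e: "0 < e" unfolding e_def using parameters by simp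
  have "s = (\<gamma> (k + 1))\<^sup>2 / (\<gamma> k)\<^sup>2" unfolding s_def rho_next[OF assms] by (simp add: power_divide)
  then have "s * denom k \<le> slack k"
    using next_step(2)[OF assms] gamma_pos[of k] assms by (simp add: divide_le_eq mult.commute)
  then have "(2 * e * s) * (sqrt ((\<delta> k)\<^sup>2 + q * slack k) + \<delta> k) \<le> slack k"
    unfolding denom_def q_def e_def by (simp add: mult_ac)
  then have "q * (2 * e * s)\<^sup>2 + 2 * \<delta> k * (2 * e * s) \<le> slack k"
    using slack_pos[OF assms] e by (intro quadratic_root_bound) (auto simp: q_def s_def)
  moreover have "\<xi> (k + 1) = q * s"
    using \<xi>[of "k + 1"] assms gamma_pos[of k]
    by (simp add: q_def s_def rho_next[OF assms] power_divide power_mult_distrib)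
  ultimately have "e * (4 * s * (\<delta> k + \<xi> (k + 1) * e)) \<le> 1 - 4 * \<xi> k * e\<^sup>2"
    unfolding slack_def e_def[symmetric] by (simp add: power2_eq_square algebra_simps)
  then have "e * (1 - 4 * \<xi> k * e - 4 * s * (\<delta> k + \<xi> (k + 1) * e)) \<ge> e - 1"
    by (simp add: power2_eq_square algebra_simps)
  then have "(e - 1) / e \<le> 1 - 4 * \<xi> k * e - 4 * s * (\<delta> k + \<xi> (k + 1) * e)"
    using e by (simp add: divide_le_eq mult.commute)
  then show ?thesis unfolding s_def e_def using parameters by (simp add: field_simps)
qed

text \<open>The product of the two local estimates is the squared gradient difference over the
  squared step. If the inner product vanishes, the gradients agree and both sides are 0, so the
  division conventions do no harm.\<close>

lemma delta_identity:
  assumes "0 \<le> k"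
  shows "\<delta> k * (norm (x (k - 1) - x k))\<^sup>2 = (\<gamma> k)\<^sup>2 * (norm (gradf (x (k - 1)) - gradf (x k)))\<^sup>2
      - \<gamma> k * ((gradf (x (k - 1)) - gradf (x k)) \<bullet> (x (k - 1) - x k))"
proof (cases "(gradf (x (k - 1)) - gradf (x k)) \<bullet> (x (k - 1) - x k) = 0")
  case True
  then have "gradf (x (k - 1)) = gradf (x k)"
    by (rule convex_gradient_eq[OF f_convex f_gradient f_smooth])
  then show ?thesis using \<delta>[OF assms] by (simp add: lip_est_def)
next
  case False
  then have "x (k - 1) - x k \<noteq> 0" by (metis inner_zero_right)
  then show ?thesis using False
    unfolding \<delta>[OF assms] lip_est_def cocoercivity_est_def
    by (simp add: field_simps power2_eq_square)
qed

lemma adjoint_diff: "adjoint A (u - v) = adjoint A u - adjoint A v"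
  using linear_diff[OF adjoint_linear[OF A]] .

lemma eta_bound:
  assumes "0 \<le> k"
  shows "norm (adjoint A (y k) - adjoint A (y (k + 1))) \<le> \<eta> (k + 1) * norm (y k - y (k + 1))"
proof (cases "y k = y (k + 1)")
  case False
  then show ?thesis
    using \<eta>_lower[OF assms] unfolding adjoint_diff by (simp add: divide_le_eq)
qed simp

lemma x_subgradient:
  assumes "1 \<le> k"
  shows "(1 / \<gamma> k) *\<^sub>R (x (k - 1) - x k) - gradf (x (k - 1)) - adjoint A (y k) \<in> subdifferential g (x k)"
proof -
  obtain xs ys where "primal_dual_solution gradf g h A xs ys" using solvable by blast
  note s = primal_dual_solutionD(2)[OF this]
  define w where "w = x (k - 1) - \<gamma> k *\<^sub>R gradf (x (k - 1)) - \<gamma> k *\<^sub>R adjoint A (y k)"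
  have xk: "x k = prox (\<gamma> k) g w" using x_update[of "k - 1"] assms by (simp add: w_def)
  have pos: "0 < \<gamma> k" using gamma_pos assms by simp
  have "(1 / \<gamma> k) *\<^sub>R (w - x k) \<in> subdifferential g (x k)"
    unfolding xk by (rule prox_subdifferential[OF g s pos])
  moreover have "(1 / \<gamma> k) *\<^sub>R (w - x k)
      = (1 / \<gamma> k) *\<^sub>R (x (k - 1) - x k) - gradf (x (k - 1)) - adjoint A (y k)"
    unfolding w_def using pos by (simp add: scaleR_diff_right)
  ultimately show ?thesis by simp
qed

lemma y_subgradient:
  assumes "1 \<le> k"
  shows "(1 / (t\<^sup>2 * \<gamma> k)) *\<^sub>R (y (k - 1) - y k)
      + (A (x (k - 1)) + \<rho> k *\<^sub>R (A (x (k - 1)) - A (x (k - 2)))) \<in> subdifferential (conjugate h) (y k)"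
proof -
  obtain xs ys where "primal_dual_solution gradf g h A xs ys" using solvable by blast
  note s = primal_dual_solutionD(1)[OF this]
  define u where "u = A (x (k - 1)) + \<rho> k *\<^sub>R (A (x (k - 1)) - A (x (k - 2)))"
  define w where "w = y (k - 1) + \<sigma> k *\<^sub>R u"
  have yk: "y k = prox (\<sigma> k) (conjugate h) w"
    using y_update[of "k - 1"] assms \<rho>[of k] by (simp add: w_def u_def algebra_simps)
  have \<sigma>: "\<sigma> k = t\<^sup>2 * \<gamma> k" "0 < \<sigma> k"
    using dual_steps[of k] gamma_pos[of k] assms parameters by auto
  have "(1 / \<sigma> k) *\<^sub>R (w - y k) \<in> subdifferential (conjugate h) (y k)"
    unfolding yk
    by (rule prox_subdifferential[OF conjugate_proper convex_fun_conjugate[OF h] lsc_fun_conjugate[OF h] s \<sigma>(2)])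
  moreover have "(1 / \<sigma> k) *\<^sub>R (w - y k) = (1 / \<sigma> k) *\<^sub>R (y (k - 1) - y k) + u"
    unfolding w_def using \<sigma>(2) by (simp add: scaleR_diff_right scaleR_add_right algebra_simps)
  ultimately show ?thesis unfolding \<sigma>(1) u_def by simp
qed

text \<open>\<open>g_val k\<close> is the true value for \<open>1 \<le> k\<close>; at
  \<open>k = 0\<close> it can be a dummy, because x^0 may lie outside the domain of g.\<close>

definition g_val where "g_val k = real_of_ereal (g (x k))"
definition h_val where "h_val k = real_of_ereal (conjugate h (y k))"

lemma g_val:
  assumes "1 \<le> k"
  shows "g (x k) = ereal (g_val k)"
proof -
  have "x k \<in> eff_dom g" using x_subgradient[OF assms] unfolding subdifferential_def by blast
  then obtain r where "g (x k) = ereal r" using g(1) proper_fun_ereal by metis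
  then show ?thesis by (simp add: g_val_def)
qed

lemma h_val:
  assumes "1 \<le> k"
  shows "conjugate h (y k) = ereal (h_val k)"
proof -
  have "y k \<in> eff_dom (conjugate h)" using y_subgradient[OF assms] unfolding subdifferential_def by blast
  then obtain r where "conjugate h (y k) = ereal r" using conjugate_proper proper_fun_ereal by metis
  then show ?thesis by (simp add: h_val_def)
qed

end

section \<open>Uniform lower bound for the stepsizes\<close>

context adaptive_primal_dual
begin

text \<open>The candidate \<open>m\<close> passes the three tests of
  \<open>le_next_step_iff\<close>: the first because the root is at least 1, the second by
  \<open>m3\<close>. For the third, \<open>m4\<close>, \<open>m1\<close> and \<open>m2\<close>
  become the bounds \<open>Mb\<close>, \<open>MbL\<close> and \<open>McL\<close> that
  \<open>scaled_root_sum_le_one\<close> asks for.\<close>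

lemma step_lower_bound:
  assumes k: "0 \<le> k" and m: "0 < m" "m \<le> \<gamma> k" and L: "0 < L"
    and coco: "(norm (gradf (x (k - 1)) - gradf (x k)))\<^sup>2
        \<le> L * ((gradf (x (k - 1)) - gradf (x k)) \<bullet> (x (k - 1) - x k))"
    and lip: "norm (gradf (x (k - 1)) - gradf (x k)) \<le> L * norm (x (k - 1) - x k)"
    and m1: "m\<^sup>2 * (2 * (1 + \<epsilon>) * t * \<eta>max * L) \<le> sqrt nu_bar"
    and m2: "m\<^sup>2 * (4 * (1 + \<epsilon>) * L\<^sup>2) \<le> nu_bar"
    and m3: "m * (2 * \<nu> * t * \<eta>max) \<le> 1"
    and m4: "m * (2 * (1 + \<epsilon>) * t * \<eta>max) \<le> sqrt nu_bar"
  shows "m \<le> \<gamma> (k + 1)"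
proof -
  define c e a w where "c = \<gamma> k" and "e = 1 + \<epsilon>" and "a = \<eta> (k + 1)" and "w = sqrt (slack k)"
  have c: "0 < c" and e: "0 < e" and a: "0 \<le> a" "a \<le> \<eta>max" and w: "0 < w" "slack k = w\<^sup>2"
    using gamma_pos[of k] k parameters eta_nonneg[of "k + 1"] eta_le_max[of "k + 1"] slack_pos[OF k]
    by (auto simp: c_def e_def a_def w_def)
  have sw: "sqrt nu_bar \<le> w" unfolding w_def using nu_bar_le_slack[OF k] by simp
  have mc: "m \<le> c" using m by (simp add: c_def)
  have t: "0 < t" by (rule parameters)
  have m_a: "m * (2 * e * t * a) \<le> w"
  proof -
    have "m * (2 * e * t * a) \<le> m * (2 * e * t * \<eta>max)"
      using m e t a by (intro mult_left_mono) auto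
    then show ?thesis using m4 sw unfolding e_def by linarith
  qed
  have m_aL: "m\<^sup>2 * (2 * e * t * a * L) \<le> w"
  proof -
    have "m\<^sup>2 * (2 * e * t * a * L) \<le> m\<^sup>2 * (2 * e * t * \<eta>max * L)"
      using m e t a L by (intro mult_left_mono mult_right_mono) auto
    then show ?thesis using m1 sw unfolding e_def by linarith
  qed
  \<comment> \<open>Normalisation of the third test: \<open>m\<^sup>2 * denom k\<close> equals
    \<open>M * (sqrt ((\<delta> k)\<^sup>2 + b\<^sup>2) + \<delta> k)\<close> times
    \<open>(\<gamma> k)\<^sup>2 * slack k\<close>.\<close>
  define M b where "M = 2 * e * m\<^sup>2 / (w\<^sup>2 * c\<^sup>2)" and "b = t * a * c * w"
  have M: "0 < M" unfolding M_def using e m c w by simp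
  have b: "0 \<le> b" unfolding b_def using t a c w by simp
  have Mb: "M * b \<le> 1"
  proof -
    have "M * b = (m / c) * (m * (2 * e * t * a) / w)"
      unfolding M_def b_def using c w by (simp add: power2_eq_square mult_ac)
    also have "\<dots> \<le> 1 * 1"
      using m_a mc m c w e t a by (intro mult_mono) auto
    finally show ?thesis by simp
  qed
  have MbL: "M * b * (c * L) \<le> 1"
  proof -
    have "M * b * (c * L) = m\<^sup>2 * (2 * e * t * a * L) / w"
      unfolding M_def b_def using c w by (simp add: power2_eq_square)
    then show ?thesis using m_aL w by simp
  qed
  have McL: "M * (2 * (c * L)\<^sup>2) \<le> 1"
  proof -
    have "M * (2 * (c * L)\<^sup>2) = m\<^sup>2 * (4 * e * L\<^sup>2) / w\<^sup>2"
      unfolding M_def using c w by (simp add: power_mult_distrib)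
    also have "\<dots> \<le> 1"
      using m2 nu_bar_le_slack[OF k] w unfolding e_def by (simp add: divide_le_eq)
    finally show ?thesis .
  qed
  \<comment> \<open>Cocoercivity bounds \<open>\<delta> k * D\<close> by
    \<open>p * (c * (c * L - 1))\<close>. The sign of \<open>c * L - 1\<close> decides: either this
    is nonpositive, or \<open>p\<close> may be replaced by its upper bound
    \<open>L * D\<close>.\<close>
  have d: "\<delta> k \<le> 0 \<or> 1 < c * L \<and> \<delta> k \<le> (c * L)\<^sup>2 - c * L"
  proof (cases "x (k - 1) = x k")
    case True
    then show ?thesis using \<delta>[OF k] by (simp add: lip_est_def)
  next
    case False
    define D p where "D = (norm (x (k - 1) - x k))\<^sup>2"
      and "p = (gradf (x (k - 1)) - gradf (x k)) \<bullet> (x (k - 1) - x k)"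
    have D: "0 < D" unfolding D_def using False by simp
    have "0 \<le> L * p" using order_trans[OF zero_le_power2 coco] by (simp add: p_def)
    then have p0: "0 \<le> p" using L by (simp add: zero_le_mult_iff)
    have "p \<le> norm (gradf (x (k - 1)) - gradf (x k)) * norm (x (k - 1) - x k)"
      unfolding p_def by (rule norm_cauchy_schwarz)
    also have "\<dots> \<le> L * norm (x (k - 1) - x k) * norm (x (k - 1) - x k)"
      using lip by (rule mult_right_mono) simp
    finally have pL: "p \<le> L * D" unfolding D_def by (simp add: power2_eq_square)
    have "\<delta> k * D \<le> c\<^sup>2 * (L * p) - c * p"
      unfolding D_def delta_identity[OF k] c_def[symmetric]
      using coco unfolding p_def[symmetric] by (simp add: mult_left_mono)
    also have "\<dots> = p * (c * (c * L - 1))" by (simp add: power2_eq_square algebra_simps)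
    finally have dD: "\<delta> k * D \<le> p * (c * (c * L - 1))" .
    show ?thesis
    proof (cases "c * L \<le> 1")
      case True
      then have "p * (c * (c * L - 1)) \<le> 0"
        using p0 c by (intro mult_nonneg_nonpos mult_nonneg_nonpos) auto
      then have "\<delta> k * D \<le> 0" using dD by linarith
      then show ?thesis using D by (simp add: mult_le_0_iff)
    next
      case False
      then have "p * (c * (c * L - 1)) \<le> L * D * (c * (c * L - 1))"
        using pL c by (intro mult_right_mono mult_nonneg_nonneg) auto
      then have "\<delta> k * D \<le> ((c * L)\<^sup>2 - c * L) * D"
        using dD by (simp add: power2_eq_square algebra_simps)
      then show ?thesis using D False by simp
    qed
  qed
  have "M * (sqrt ((\<delta> k)\<^sup>2 + b\<^sup>2) + \<delta> k) \<le> 1"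
    by (rule scaled_root_sum_le_one[OF M b Mb, of _ "c * L"]) (use d McL MbL in blast)
  moreover have "m\<^sup>2 * denom k = M * (sqrt ((\<delta> k)\<^sup>2 + b\<^sup>2) + \<delta> k) * ((\<gamma> k)\<^sup>2 * slack k)"
  proof -
    have "b\<^sup>2 = (t * \<eta> (k + 1) * \<gamma> k)\<^sup>2 * slack k"
      unfolding b_def w(2) a_def c_def by (simp add: power_mult_distrib)
    then have "denom k = 2 * e * (sqrt ((\<delta> k)\<^sup>2 + b\<^sup>2) + \<delta> k)"
      unfolding denom_def e_def by simp
    then show ?thesis unfolding M_def w(2) c_def[symmetric] using c w(1) by (simp add: mult_ac)
  qed
  ultimately have "m\<^sup>2 * denom k \<le> 1 * ((\<gamma> k)\<^sup>2 * slack k)"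
    using slack_pos[OF k] by (metis mult_right_mono mult_nonneg_nonneg zero_le_power2 less_imp_le)
  moreover have "m * (2 * \<nu> * t * \<eta> (k + 1)) \<le> 1"
  proof -
    have "m * (2 * \<nu> * t * \<eta> (k + 1)) \<le> m * (2 * \<nu> * t * \<eta>max)"
      using m nu_pos t a unfolding a_def by (intro mult_left_mono) auto
    then show ?thesis using m3 by linarith
  qed
  moreover have "m \<le> \<gamma> k * sqrt (1 + \<gamma> k / \<gamma> (k - 1))"
  proof -
    have "\<gamma> k * 1 \<le> \<gamma> k * sqrt (1 + \<gamma> k / \<gamma> (k - 1))"
      using gamma_pos[of k] gamma_pos[of "k - 1"] k by (intro mult_left_mono) auto
    then show ?thesis using m(2) by linarith
  qed
  ultimately show ?thesis using le_next_step_iff[OF k, of m] m(1) by simp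
qed

text \<open>Extended-real valued, because three of the entries are infinite when
  \<open>\<eta>max = 0\<close>; the entry \<open>\<gamma> 0\<close> keeps the minimum
  finite.\<close>

definition gamma_hat :: "real \<Rightarrow> ereal" where
  "gamma_hat L = Min {
     ereal (\<gamma> 0),
     ereal (nu_bar powr (1 / 4)) / ereal (sqrt (2 * (1 + \<epsilon>) * t * \<eta>max * L)),
     ereal (sqrt nu_bar) / ereal (2 * sqrt (1 + \<epsilon>) * L),
     1 / ereal (2 * \<nu> * t * \<eta>max),
     ereal (sqrt nu_bar) / ereal (2 * (1 + \<epsilon>) * t * \<eta>max)}"

lemma eta_max_nonneg: "0 \<le> \<eta>max"
  using eta_le_max[of 1] eta_nonneg[of 1] by simp

text \<open>Induction with \<open>step_lower_bound\<close>, started by the entry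
  \<open>\<gamma> 0\<close>. The set \<open>V\<close> has to contain x^{-1} as well, since the
  induction step at \<open>k = 0\<close> compares the gradients at x^{-1} and x^0.\<close>

lemma gamma_hat_bounds:
  assumes L: "0 < L"
    and V: "convex V" "bounded V" "\<And>k. -1 \<le> k \<Longrightarrow> x k \<in> V"
    and lip: "L-lipschitz_on {v + u | v u. v \<in> V \<and> norm u \<le> diameter V} gradf"
  shows "0 < gamma_hat L" "0 \<le> k \<Longrightarrow> gamma_hat L \<le> ereal (\<gamma> k)"
proof -
  have nb: "0 < nu_bar powr (1 / 4)" "0 < sqrt nu_bar" using nu_bar_pos by auto
  have e: "0 < 1 + \<epsilon>" using parameters by simp
  have b1: "0 \<le> sqrt (2 * (1 + \<epsilon>) * t * \<eta>max * L)" and b2: "0 \<le> 2 * sqrt (1 + \<epsilon>) * L"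
    and b3: "0 \<le> 2 * \<nu> * t * \<eta>max" and b4: "0 \<le> 2 * (1 + \<epsilon>) * t * \<eta>max"
    using eta_max_nonneg parameters(1) e L nu_pos by auto
  have eq: "gamma_hat L = min (ereal (\<gamma> 0)) (min
     (ereal (nu_bar powr (1 / 4)) / ereal (sqrt (2 * (1 + \<epsilon>) * t * \<eta>max * L))) (min
     (ereal (sqrt nu_bar) / ereal (2 * sqrt (1 + \<epsilon>) * L)) (min
     (1 / ereal (2 * \<nu> * t * \<eta>max))
     (ereal (sqrt nu_bar) / ereal (2 * (1 + \<epsilon>) * t * \<eta>max)))))"
    unfolding gamma_hat_def by (rule Min_five)
  show pos: "0 < gamma_hat L"
    unfolding eq min_less_iff_conj
    using le_divide_ereal_iff(2)[OF nb(1) b1] le_divide_ereal_iff(2)[OF nb(2) b2]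
      le_one_divide_ereal_iff(2)[OF b3] le_divide_ereal_iff(2)[OF nb(2) b4] gamma_pos[of 0] by simp
  have "gamma_hat L \<le> ereal (\<gamma> 0)" unfolding eq by (rule min.cobounded1)
  with pos obtain m where m: "gamma_hat L = ereal m" by (cases "gamma_hat L") auto
  have "0 < m" using pos m by simp
  have "ereal m \<le> gamma_hat L" using m by simp
  then have m0: "m \<le> \<gamma> 0" and m1: "m * sqrt (2 * (1 + \<epsilon>) * t * \<eta>max * L) \<le> nu_bar powr (1 / 4)"
    and m2: "m * (2 * sqrt (1 + \<epsilon>) * L) \<le> sqrt nu_bar"
    and m3: "m * (2 * \<nu> * t * \<eta>max) \<le> 1"
    and m4: "m * (2 * (1 + \<epsilon>) * t * \<eta>max) \<le> sqrt nu_bar"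
    unfolding eq min.bounded_iff le_divide_ereal_iff(1)[OF nb(1) b1] le_divide_ereal_iff(1)[OF nb(2) b2]
      le_one_divide_ereal_iff(1)[OF b3] le_divide_ereal_iff(1)[OF nb(2) b4] by auto
  have m1': "m\<^sup>2 * (2 * (1 + \<epsilon>) * t * \<eta>max * L) \<le> sqrt nu_bar"
  proof -
    have "(m * sqrt (2 * (1 + \<epsilon>) * t * \<eta>max * L))\<^sup>2 \<le> (nu_bar powr (1 / 4))\<^sup>2"
      using m1 \<open>0 < m\<close> b1 by (intro power_mono) auto
    moreover have "(nu_bar powr (1 / 4))\<^sup>2 = sqrt nu_bar"
      using nu_bar_pos by (simp add: powr_half_sqrt[symmetric] powr_powr flip: powr_realpow)
    ultimately show ?thesis
      using eta_max_nonneg parameters(1) e L by (simp add: power_mult_distrib)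
  qed
  have m2': "m\<^sup>2 * (4 * (1 + \<epsilon>) * L\<^sup>2) \<le> nu_bar"
  proof -
    have "(m * (2 * sqrt (1 + \<epsilon>) * L))\<^sup>2 \<le> (sqrt nu_bar)\<^sup>2"
      using m2 \<open>0 < m\<close> b2 by (intro power_mono) auto
    then show ?thesis using e nu_bar_pos by (simp add: power_mult_distrib)
  qed
  note VW = mem_enlarged[OF V(2)]
  have "m \<le> \<gamma> k" if "0 \<le> k" for k
    using that
  proof (induction k rule: int_ge_induct)
    case base
    show ?case by (rule m0)
  next
    case (step k)
    have xV: "x (k - 1) \<in> V" "x k \<in> V" using V(3)[of k] V(3)[of "k - 1"] step(1) by auto
    have "norm (gradf (x (k - 1)) - gradf (x k)) \<le> L * norm (x (k - 1) - x k)"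
      using lipschitz_onD[OF lip VW VW] xV by (simp add: dist_norm)
    from step_lower_bound[OF step(1) \<open>0 < m\<close> step(2) L
        convex_lipschitz_gradient_cocoercive[OF f_convex f_gradient V(1,2) xV lip L] this m1' m2' m3 m4]
    show ?case .
  qed
  then show "0 \<le> k \<Longrightarrow> gamma_hat L \<le> ereal (\<gamma> k)" unfolding m by simp
qed

end

section \<open>The Lyapunov function of a fixed solution\<close>

locale adaptive_primal_dual_solution = adaptive_primal_dual +
  fixes xs :: 'a and ys :: 'b
  assumes solution: "primal_dual_solution gradf g h A xs ys"
begin

definition g_opt where "g_opt = real_of_ereal (g xs)"
definition h_opt where "h_opt = real_of_ereal (conjugate h ys)"

definition primal_gap where
  "primal_gap k = f (x k) + g_val k - f xs - g_opt + (x k - xs) \<bullet> adjoint A ys"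

definition dual_gap where
  "dual_gap k = h_val k - h_opt + A xs \<bullet> (ys - y k)"

definition lyapunov where
  "lyapunov k = 1 / 2 * (norm (x k - xs))\<^sup>2
     + (1 - 4 * \<xi> k * (1 + \<epsilon>)) / 4 * (norm (x k - x (k - 1)))\<^sup>2
     + 1 / (2 * t\<^sup>2) * (norm (y k - ys))\<^sup>2
     + \<gamma> k * (1 + \<rho> k) * primal_gap (k - 1)"

definition residual_coefficient where
  "residual_coefficient k = (1 - 4 * \<xi> k * (1 + \<epsilon>)
      - 4 * (\<rho> (k + 1))\<^sup>2 * (\<delta> k + \<xi> (k + 1) * (1 + \<epsilon>))) / 4"

lemma g_opt: "g xs = ereal g_opt"
proof -
  have "xs \<in> eff_dom g" using primal_dual_solutionD(2)[OF solution] unfolding subdifferential_def by blast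
  then obtain r where "g xs = ereal r" using g(1) proper_fun_ereal by metis
  then show ?thesis by (simp add: g_opt_def)
qed

lemma h_opt: "conjugate h ys = ereal h_opt"
proof -
  have "ys \<in> eff_dom (conjugate h)"
    using primal_dual_solutionD(1)[OF solution] unfolding subdifferential_def by blast
  then obtain r where "conjugate h ys = ereal r" using conjugate_proper proper_fun_ereal by metis
  then show ?thesis by (simp add: h_opt_def)
qed

lemma primal_gap_nonneg:
  assumes "g (x k) = ereal (g_val k)"
  shows "0 \<le> primal_gap k"
proof -
  have "(- adjoint A ys - gradf xs) \<bullet> (x k - xs) = - ((x k - xs) \<bullet> adjoint A ys) - gradf xs \<bullet> (x k - xs)"
    unfolding inner_diff_left[of "- adjoint A ys"] inner_minus_left by (simp only: inner_commute)
  then show ?thesis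
    using subdifferentialD[OF primal_dual_solutionD(2)[OF solution] g_opt assms]
      convex_gradient_inequality[OF f_convex f_gradient, of xs "x k"]
    unfolding primal_gap_def by linarith
qed

lemma dual_gap_nonneg: "1 \<le> k \<Longrightarrow> 0 \<le> dual_gap k"
  using subdifferentialD[OF primal_dual_solutionD(1)[OF solution] h_opt h_val, of k]
  unfolding dual_gap_def by (simp add: inner_diff_right)

text \<open>The sum of \<open>primal_descent\<close> and \<open>dual_descent\<close>. All bilinear
  terms collapse into one inner product, which Young's inequality distributes over the dual residual
  and the two primal residuals. The premise \<open>fin\<close> is a restriction only at
  \<open>k = 1\<close>.\<close>

lemma lyapunov_descent:
  assumes k: "1 \<le> k" and fin: "g (x (k - 1)) = ereal (g_val (k - 1))"
  shows "lyapunov (k + 1) \<le> lyapunov k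
      - \<epsilon> / (2 * t\<^sup>2 * (1 + \<epsilon>)) * (norm (y (k + 1) - y k))\<^sup>2
      - residual_coefficient k * (norm (x k - x (k - 1)))\<^sup>2
      - \<gamma> k * (1 + \<rho> k - (\<rho> (k + 1))\<^sup>2) * primal_gap (k - 1)
      - \<gamma> (k + 1) * dual_gap (k + 1)"
proof -
  define e c cp r D where "e = 1 + \<epsilon>" and "c = \<gamma> k" and "cp = \<gamma> (k + 1)" and "r = \<rho> (k + 1)"
    and "D = x (k - 1) - x k"
  define a0 ap as where "a0 = adjoint A (y k)" and "ap = adjoint A (y (k + 1))" and "as = adjoint A ys"
  define a n w where "a = \<eta> (k + 1)" and "n = norm (y (k + 1) - y k)" and "w = norm (x (k + 1) - x k)"
  have pos: "0 < c" "0 < cp" "0 < e" "0 < t" "0 < r"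
    using gamma_pos[of k] gamma_pos[of "k + 1"] rho_pos[of "k + 1"] k parameters
    by (auto simp: c_def cp_def e_def r_def)
  have r: "r = cp / c" unfolding r_def cp_def c_def using rho_next[of k] k by simp
  have sx: "(1 / cp) *\<^sub>R (x k - x (k + 1)) - gradf (x k) - ap \<in> subdifferential g (x (k + 1))"
    using x_subgradient[of "k + 1"] k by (simp add: cp_def ap_def)
  have sx0: "(1 / c) *\<^sub>R (x (k - 1) - x k) - gradf (x (k - 1)) - a0 \<in> subdifferential g (x k)"
    using x_subgradient[of k] k by (simp add: c_def a0_def)
  note gk = g_val[of k, OF k]
  have gk1: "g (x (k + 1)) = ereal (g_val (k + 1))" using g_val[of "k + 1"] k by simp
  have \<delta>k: "\<delta> k * (norm D)\<^sup>2 = c\<^sup>2 * (norm (gradf (x (k - 1)) - gradf (x k)))\<^sup>2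
      - c * ((gradf (x (k - 1)) - gradf (x k)) \<bullet> D)"
    unfolding D_def c_def by (rule delta_identity) (use k in simp)
  note grad = convex_gradient_inequality[OF f_convex f_gradient, of "x k"]
  have primal: "1 / 2 * (norm (x (k + 1) - xs))\<^sup>2 + 1 / 4 * w\<^sup>2
    \<le> 1 / 2 * (norm (x k - xs))\<^sup>2 + r\<^sup>2 * \<delta> k * (norm D)\<^sup>2
      + cp * (f xs + g_opt - f (x k) - g_val k)
      + cp * r * (f (x (k - 1)) + g_val (k - 1) - f (x k) - g_val k)
      + cp * r * (a0 \<bullet> D) + cp * (a0 \<bullet> (x (k + 1) - x k)) + cp * (ap \<bullet> (xs - x (k + 1)))"
    unfolding w_def
    by (rule primal_descent[OF pos(1,2) r D_def subdifferentialD[OF sx gk1 g_opt] grad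
          subdifferentialD[OF sx0 gk fin] grad subdifferentialD[OF sx0 gk gk1] \<delta>k])
  define u where "u = A (x k) + r *\<^sub>R (A (x k) - A (x (k - 1)))"
  have sy: "(1 / (t\<^sup>2 * cp)) *\<^sub>R (y k - y (k + 1)) + u \<in> subdifferential (conjugate h) (y (k + 1))"
    using y_subgradient[of "k + 1"] k by (simp add: cp_def u_def r_def)
  have hk1: "conjugate h (y (k + 1)) = ereal (h_val (k + 1))" using h_val[of "k + 1"] k by simp
  have dual: "1 / (2 * t\<^sup>2) * (norm (y (k + 1) - ys))\<^sup>2 + 1 / (2 * t\<^sup>2) * n\<^sup>2
      \<le> 1 / (2 * t\<^sup>2) * (norm (y k - ys))\<^sup>2 - cp * dual_gap (k + 1)
        + cp * ((A xs - u) \<bullet> (ys - y (k + 1)))"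
    unfolding n_def dual_gap_def
    by (rule dual_descent[OF pos(2,4) subdifferentialD[OF sy hk1 h_opt]])
  have "A xs - u = A (xs - x k + r *\<^sub>R D)"
    unfolding u_def D_def by (simp add: linear_diff[OF A] linear_add[OF A] linear_scale[OF A] algebra_simps)
  then have u: "(A xs - u) \<bullet> (ys - y (k + 1)) = (xs - x k + r *\<^sub>R D) \<bullet> (as - ap)"
    unfolding as_def ap_def adjoint_diff[symmetric] by (simp only: adjoint_works[OF A])
  have gaps: "f xs + g_opt - f (x k) - g_val k = - primal_gap k + (x k - xs) \<bullet> as"
    "f (x (k - 1)) + g_val (k - 1) - f (x k) - g_val k = primal_gap (k - 1) - primal_gap k - D \<bullet> as"
    unfolding primal_gap_def as_def D_def by (simp_all add: inner_diff_left)
  \<comment> \<open>The multiplier \<open>as\<close> drops out of the collected terms; what is left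
    is the change \<open>a0 - ap\<close>, and this is what \<open>\<eta> (k + 1)\<close>
    controls.\<close>
  have "((x k - xs) \<bullet> as) - r * (D \<bullet> as) + r * (a0 \<bullet> D) + a0 \<bullet> (x (k + 1) - x k) + ap \<bullet> (xs - x (k + 1))
      + (xs - x k + r *\<^sub>R D) \<bullet> (as - ap) = (a0 - ap) \<bullet> (r *\<^sub>R D + (x (k + 1) - x k))"
    by (simp add: inner_diff_left inner_diff_right inner_add_left inner_add_right inner_commute algebra_simps)
  then have cross: "cp * ((x k - xs) \<bullet> as) - cp * (r * (D \<bullet> as)) + cp * (r * (a0 \<bullet> D))
      + cp * (a0 \<bullet> (x (k + 1) - x k)) + cp * (ap \<bullet> (xs - x (k + 1)))
      + cp * ((xs - x k + r *\<^sub>R D) \<bullet> (as - ap)) = cp * ((a0 - ap) \<bullet> (r *\<^sub>R D + (x (k + 1) - x k)))"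
    by (simp only: distrib_left[symmetric] right_diff_distrib[symmetric])
  have "(a0 - ap) \<bullet> (r *\<^sub>R D + (x (k + 1) - x k)) \<le> norm (a0 - ap) * norm (r *\<^sub>R D + (x (k + 1) - x k))"
    by (rule norm_cauchy_schwarz)
  also have "\<dots> \<le> (a * n) * (r * norm D + w)"
  proof (intro mult_mono)
    show "norm (a0 - ap) \<le> a * n"
      using eta_bound[of k] k unfolding a0_def ap_def a_def n_def by (simp add: norm_minus_commute)
    show "norm (r *\<^sub>R D + (x (k + 1) - x k)) \<le> r * norm D + w"
      unfolding w_def using norm_triangle_ineq[of "r *\<^sub>R D" "x (k + 1) - x k"] pos by simp
    show "0 \<le> a * n" unfolding a_def n_def using eta_nonneg[of "k + 1"] k by simp
  qed simp
  finally have "cp * ((a0 - ap) \<bullet> (r *\<^sub>R D + (x (k + 1) - x k))) \<le> cp * ((a * n) * (r * norm D + w))"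
    using pos(2) by simp
  also have "\<dots> = cp * a * n * (r * norm D) + cp * a * n * w" by (simp add: algebra_simps)
  also have "\<dots> \<le> (1 / (4 * t\<^sup>2 * e) * n\<^sup>2 + t\<^sup>2 * a\<^sup>2 * cp\<^sup>2 * e * (r * norm D)\<^sup>2)
      + (1 / (4 * t\<^sup>2 * e) * n\<^sup>2 + t\<^sup>2 * a\<^sup>2 * cp\<^sup>2 * e * w\<^sup>2)"
    by (intro add_mono young_coupling pos)
  finally have coupling: "cp * ((a0 - ap) \<bullet> (r *\<^sub>R D + (x (k + 1) - x k)))
      \<le> 2 * (1 / (4 * t\<^sup>2 * e)) * n\<^sup>2 + \<xi> (k + 1) * e * r\<^sup>2 * (norm D)\<^sup>2 + \<xi> (k + 1) * e * w\<^sup>2"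
    using \<xi>[of "k + 1"] k unfolding a_def cp_def by (simp add: power_mult_distrib algebra_simps)
  have n_coeff: "1 / (2 * t\<^sup>2) * n\<^sup>2 - 2 * (1 / (4 * t\<^sup>2 * e)) * n\<^sup>2 = \<epsilon> / (2 * t\<^sup>2 * e) * n\<^sup>2"
  proof -
    have "\<epsilon> / (2 * t\<^sup>2 * e) = (e - 1) / (2 * t\<^sup>2 * e)" by (simp add: e_def)
    also have "\<dots> = 1 / (2 * t\<^sup>2) - 2 * (1 / (4 * t\<^sup>2 * e))"
      using pos(3) by (simp add: diff_divide_distrib)
    finally show ?thesis by (simp only: left_diff_distrib)
  qed
  \<comment> \<open>The old gap gets a weight in terms of the old stepsize, so that it can be
    subtracted from its weight \<open>c * (1 + \<rho> k)\<close> in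
    \<open>lyapunov k\<close>.\<close>
  have "cp * r = r\<^sup>2 * c" unfolding r using pos by (simp add: power2_eq_square)
  then have gapk: "cp * r * primal_gap (k - 1) = r\<^sup>2 * c * primal_gap (k - 1)" by simp
  \<comment> \<open>\<open>S\<close> holds the squares of step \<open>k + 1\<close> before the
    coupling takes its share of \<open>n\<close> and \<open>w\<close>.\<close>
  define S where "S = 1 / 2 * (norm (x (k + 1) - xs))\<^sup>2 + 1 / 4 * w\<^sup>2
    + 1 / (2 * t\<^sup>2) * (norm (y (k + 1) - ys))\<^sup>2 + 1 / (2 * t\<^sup>2) * n\<^sup>2"
  have "S \<le> 1 / 2 * (norm (x k - xs))\<^sup>2 + 1 / (2 * t\<^sup>2) * (norm (y k - ys))\<^sup>2
      + r\<^sup>2 * \<delta> k * (norm D)\<^sup>2 - cp * dual_gap (k + 1)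
      - cp * primal_gap k + cp * r * primal_gap (k - 1) - cp * r * primal_gap k
      + cp * ((a0 - ap) \<bullet> (r *\<^sub>R D + (x (k + 1) - x k)))"
    using primal dual cross unfolding u gaps S_def
    by (simp add: distrib_left right_diff_distrib mult.assoc)
  then have main: "S \<le> 1 / 2 * (norm (x k - xs))\<^sup>2 + 1 / (2 * t\<^sup>2) * (norm (y k - ys))\<^sup>2
      + r\<^sup>2 * \<delta> k * (norm D)\<^sup>2 - cp * dual_gap (k + 1)
      - cp * primal_gap k + r\<^sup>2 * c * primal_gap (k - 1) - cp * r * primal_gap k
      + 2 * (1 / (4 * t\<^sup>2 * e)) * n\<^sup>2 + \<xi> (k + 1) * e * r\<^sup>2 * (norm D)\<^sup>2 + \<xi> (k + 1) * e * w\<^sup>2"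
    using coupling gapk by linarith
  have Dn: "norm (x k - x (k - 1)) = norm D" unfolding D_def by (rule norm_minus_commute)
  have kk: "k + 1 - 1 = k" by simp
  have U1: "lyapunov (k + 1) = S - \<xi> (k + 1) * e * w\<^sup>2 - 1 / (2 * t\<^sup>2) * n\<^sup>2
      + cp * primal_gap k + cp * r * primal_gap k"
    unfolding lyapunov_def S_def kk cp_def r_def e_def w_def by (simp add: field_simps)
  have U0: "lyapunov k = 1 / 2 * (norm (x k - xs))\<^sup>2 + 1 / (2 * t\<^sup>2) * (norm (y k - ys))\<^sup>2
      + (1 - 4 * \<xi> k * e) / 4 * (norm D)\<^sup>2 + c * (1 + \<rho> k) * primal_gap (k - 1)"
    unfolding lyapunov_def Dn e_def c_def by simp
  have RC: "residual_coefficient k * (norm D)\<^sup>2 = (1 - 4 * \<xi> k * e) / 4 * (norm D)\<^sup>2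
      - r\<^sup>2 * \<delta> k * (norm D)\<^sup>2 - \<xi> (k + 1) * e * r\<^sup>2 * (norm D)\<^sup>2"
    unfolding residual_coefficient_def e_def r_def by (simp add: field_simps)
  have GC: "c * (1 + \<rho> k - r\<^sup>2) * primal_gap (k - 1)
      = c * (1 + \<rho> k) * primal_gap (k - 1) - r\<^sup>2 * c * primal_gap (k - 1)"
    by (simp add: algebra_simps)
  show ?thesis
    unfolding Dn n_def[symmetric] c_def[symmetric] cp_def[symmetric] r_def[symmetric] e_def[symmetric] RC GC U0
    using main n_coeff unfolding U1 by linarith
qed

end

section \<open>Asymptotics\<close>

lemma descent_summable:
  fixes U r :: "nat \<Rightarrow> real"
  assumes "\<And>n. U (Suc n) \<le> U n - r n" "\<And>n. 0 \<le> U n" "\<And>n. 0 \<le> r n"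
  shows "decseq U" "summable r"
proof -
  show "decseq U" using assms(1,3) by (intro decseq_SucI) (smt (verit))
  have "sum r {..<n} \<le> U 0 - U n" for n
  proof (induction n)
    case (Suc n)
    then show ?case using assms(1)[of n] by simp
  qed simp
  then have "sum r {..<n} \<le> U 0" for n using assms(2)[of n] by (smt (verit))
  then show "summable r" using assms(3) by (intro summableI_nonneg_bounded)
qed

lemma locally_lipschitz_sequentially_continuous:
  fixes G :: "'a::euclidean_space \<Rightarrow> 'a"
  assumes "locally_lipschitz G" "X \<longlonglongrightarrow> z"
  shows "(\<lambda>n. G (X n)) \<longlonglongrightarrow> G z"
proof -
  obtain L where L: "L-lipschitz_on (cball z 1) G"
    using assms(1) unfolding locally_lipschitz_def by (meson convex_cball compact_cball)
  have "eventually (\<lambda>n. dist (X n) z < 1) sequentially" using assms(2) by (rule tendstoD) simp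
  then have "eventually (\<lambda>n. norm (G (X n) - G z) \<le> L * dist (X n) z) sequentially"
  proof eventually_elim
    case (elim n)
    then show ?case using lipschitz_onD[OF L, of "X n" z] by (simp add: dist_norm norm_minus_commute)
  qed
  moreover have "(\<lambda>n. L * dist (X n) z) \<longlonglongrightarrow> 0"
    by (rule tendsto_mult_right_zero[OF tendsto_dist_iff[THEN iffD1, OF assms(2)]])
  ultimately have "(\<lambda>n. G (X n) - G z) \<longlonglongrightarrow> 0" by (rule Lim_null_comparison)
  then show ?thesis by (simp add: LIM_zero_iff)
qed

context adaptive_primal_dual
begin

text \<open>By \<open>rho_square_le\<close>, any \<open>B\<close> with
  \<open>1 + B \<le> B\<^sup>2\<close> is an invariant bound, and \<open>2 \<le> B\<close> ensures
  this.\<close>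

lemma rho_bounded:
  obtains B where "2 \<le> B" "\<And>k. 0 \<le> k \<Longrightarrow> \<rho> k \<le> B"
proof
  let ?B = "max 2 (\<rho> 0)"
  show "2 \<le> ?B" by simp
  fix k :: int assume "0 \<le> k"
  then show "\<rho> k \<le> ?B"
  proof (induction k rule: int_ge_induct)
    case (step k)
    have "(\<rho> (k + 1))\<^sup>2 \<le> 1 + ?B" using rho_square_le[OF step(1)] step(2) by linarith
    also have "\<dots> \<le> ?B * 2" by simp
    also have "\<dots> \<le> ?B * ?B" by (rule mult_left_mono) auto
    finally have "(\<rho> (k + 1))\<^sup>2 \<le> ?B\<^sup>2" by (simp add: power2_eq_square)
    then show ?case by (rule power2_le_imp_le) simp
  qed simp
qed

text \<open>The premise at \<open>k - 1\<close> gives \<open>(\<rho> k)\<^sup>2 \<ge> 1 / 2\<close>,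
  hence \<open>\<rho> k \<ge> 7 / 10\<close>; at \<open>k\<close> it then gives
  \<open>(\<rho> (k + 1))\<^sup>2 \<ge> 6 / 5\<close>, which exceeds
  \<open>(21 / 20)\<^sup>2\<close>. Using it twice costs the shift from \<open>N\<close> to
  \<open>N + 1\<close>.\<close>

lemma geometric_growth:
  assumes N: "0 \<le> N" and gr: "\<And>k. N \<le> k \<Longrightarrow> 1 / 2 + \<rho> k \<le> (\<rho> (k + 1))\<^sup>2"
  shows "N + 1 \<le> k \<Longrightarrow> 21 / 20 * \<gamma> k \<le> \<gamma> (k + 1)"
    "(21 / 20) ^ n * \<gamma> (N + 1) \<le> \<gamma> (N + 1 + int n)"
proof -
  have step: "21 / 20 * \<gamma> k \<le> \<gamma> (k + 1)" if k: "N + 1 \<le> k" for k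
  proof -
    have "(7 / 10)\<^sup>2 \<le> (\<rho> k)\<^sup>2"
      using gr[of "k - 1"] rho_pos[of "k - 1"] k N by (simp add: power2_eq_square)
    then have "7 / 10 \<le> \<rho> k" by (rule power2_le_imp_le) (use rho_pos[of k] k N in simp)
    then have "(21 / 20)\<^sup>2 \<le> (\<rho> (k + 1))\<^sup>2"
      using gr[of k] k by (simp add: power2_eq_square)
    then have "21 / 20 \<le> \<rho> (k + 1)" by (rule power2_le_imp_le) (use rho_pos[of "k + 1"] k N in simp)
    then show ?thesis using gamma_pos[of k] k N rho_next[of k] by (simp add: le_divide_eq)
  qed
  then show "N + 1 \<le> k \<Longrightarrow> 21 / 20 * \<gamma> k \<le> \<gamma> (k + 1)" .
  show "(21 / 20) ^ n * \<gamma> (N + 1) \<le> \<gamma> (N + 1 + int n)"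
  proof (induction n)
    case (Suc n)
    have "(21 / 20) ^ Suc n * \<gamma> (N + 1) = 21 / 20 * ((21 / 20) ^ n * \<gamma> (N + 1))" by simp
    also have "\<dots> \<le> 21 / 20 * \<gamma> (N + 1 + int n)" using Suc by (intro mult_left_mono) auto
    also have "\<dots> \<le> \<gamma> (N + 1 + int n + 1)" by (rule step) simp
    finally show ?case by (simp add: add_ac)
  qed simp
qed

lemma xi_coefficient:
  assumes "0 \<le> k"
  shows "0 \<le> \<xi> k" "0 \<le> 1 - 4 * \<xi> k * (1 + \<epsilon>)" "1 - 4 * \<xi> k * (1 + \<epsilon>) \<le> 1"
proof -
  show 0: "0 \<le> \<xi> k" using \<xi>[OF assms] by simp
  have "\<xi> k * ((1 + \<epsilon>) * 1) \<le> \<xi> k * ((1 + \<epsilon>) * (1 + \<epsilon>))"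
    using 0 parameters by (intro mult_left_mono) auto
  then show "0 \<le> 1 - 4 * \<xi> k * (1 + \<epsilon>)"
    using slack_pos[OF assms] unfolding slack_def by (simp add: power2_eq_square)
  show "1 - 4 * \<xi> k * (1 + \<epsilon>) \<le> 1" using 0 parameters by simp
qed

end

context adaptive_primal_dual_solution
begin

text \<open>The count starts at \<open>k = 2\<close>, the first index for which
  \<open>x (k - 1)\<close> is a proximal point and thus certain to lie in the domain of g.\<close>

definition decrease where
  "decrease n = (let k = int n + 2 in
      \<epsilon> / (2 * t\<^sup>2 * (1 + \<epsilon>)) * (norm (y (k + 1) - y k))\<^sup>2
      + residual_coefficient k * (norm (x k - x (k - 1)))\<^sup>2
      + \<gamma> k * (1 + \<rho> k - (\<rho> (k + 1))\<^sup>2) * primal_gap (k - 1)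
      + \<gamma> (k + 1) * dual_gap (k + 1))"

lemma primal_gap_nonneg_index: "1 \<le> k \<Longrightarrow> 0 \<le> primal_gap k"
  by (rule primal_gap_nonneg) (rule g_val)

lemma residual_coefficient_lower: "0 \<le> k \<Longrightarrow> \<epsilon> / (4 * (1 + \<epsilon>)) \<le> residual_coefficient k"
  unfolding residual_coefficient_def by (rule residual_coefficient_ge)

lemma residual_coefficient_nonneg: "0 \<le> k \<Longrightarrow> 0 \<le> residual_coefficient k"
  using residual_coefficient_lower[of k] parameters(2) by (smt (verit) divide_nonneg_nonneg)

lemma decrease_terms_nonneg:
  assumes "k = int n + 2"
  shows "0 \<le> \<epsilon> / (2 * t\<^sup>2 * (1 + \<epsilon>)) * (norm (y (k + 1) - y k))\<^sup>2"
    "0 \<le> residual_coefficient k * (norm (x k - x (k - 1)))\<^sup>2"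
    "0 \<le> \<gamma> k * (1 + \<rho> k - (\<rho> (k + 1))\<^sup>2) * primal_gap (k - 1)"
    "0 \<le> \<gamma> (k + 1) * dual_gap (k + 1)"
  using assms parameters residual_coefficient_nonneg[of k] gamma_pos[of k] gamma_pos[of "k + 1"]
    rho_square_le[of k] primal_gap_nonneg_index[of "k - 1"] dual_gap_nonneg[of "k + 1"]
  by (auto intro!: mult_nonneg_nonneg)

lemma lyapunov_lower:
  assumes "2 \<le> k"
  shows "1 / 2 * (norm (x k - xs))\<^sup>2 \<le> lyapunov k" "1 / (2 * t\<^sup>2) * (norm (y k - ys))\<^sup>2 \<le> lyapunov k"
    "\<gamma> k * (1 + \<rho> k) * primal_gap (k - 1) \<le> lyapunov k" "0 \<le> lyapunov k"
proof -
  have "0 \<le> (1 - 4 * \<xi> k * (1 + \<epsilon>)) / 4 * (norm (x k - x (k - 1)))\<^sup>2"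
    using xi_coefficient(2)[of k] assms by (intro mult_nonneg_nonneg) auto
  moreover have "0 \<le> \<gamma> k * (1 + \<rho> k) * primal_gap (k - 1)"
    using gamma_pos[of k] rho_pos[of k] primal_gap_nonneg_index[of "k - 1"] assms
    by (intro mult_nonneg_nonneg) auto
  moreover have "0 \<le> 1 / 2 * (norm (x k - xs))\<^sup>2" "0 \<le> 1 / (2 * t\<^sup>2) * (norm (y k - ys))\<^sup>2" by auto
  ultimately show "1 / 2 * (norm (x k - xs))\<^sup>2 \<le> lyapunov k" "1 / (2 * t\<^sup>2) * (norm (y k - ys))\<^sup>2 \<le> lyapunov k"
    "\<gamma> k * (1 + \<rho> k) * primal_gap (k - 1) \<le> lyapunov k" "0 \<le> lyapunov k"
    unfolding lyapunov_def by linarith+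
qed

lemma lyapunov_step: "lyapunov (int (Suc n) + 2) \<le> lyapunov (int n + 2) - decrease n"
proof -
  have "lyapunov ((int n + 2) + 1) \<le> lyapunov (int n + 2) - decrease n"
    using lyapunov_descent[of "int n + 2", OF _ g_val] unfolding decrease_def Let_def by linarith
  moreover have "(int n + 2) + 1 = int (Suc n) + 2" by simp
  ultimately show ?thesis by metis
qed

lemma lyapunov_decseq: "decseq (\<lambda>n. lyapunov (int n + 2))" and decrease_summable: "summable decrease"
proof -
  have "0 \<le> decrease n" for n
    unfolding decrease_def Let_def using decrease_terms_nonneg[OF refl, of n] by linarith
  from descent_summable[where U = "\<lambda>n. lyapunov (int n + 2)", OF lyapunov_step lyapunov_lower(4) this]
  show "decseq (\<lambda>n. lyapunov (int n + 2))" "summable decrease" by auto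
qed

lemma decrease_terms_tendsto:
  shows "(\<lambda>n. \<epsilon> / (2 * t\<^sup>2 * (1 + \<epsilon>)) * (norm (y (int n + 3) - y (int n + 2)))\<^sup>2) \<longlonglongrightarrow> 0"
    "(\<lambda>n. residual_coefficient (int n + 2) * (norm (x (int n + 2) - x (int n + 1)))\<^sup>2) \<longlonglongrightarrow> 0"
    "(\<lambda>n. \<gamma> (int n + 2) * (1 + \<rho> (int n + 2) - (\<rho> (int n + 3))\<^sup>2) * primal_gap (int n + 1)) \<longlonglongrightarrow> 0"
    "(\<lambda>n. \<gamma> (int n + 3) * dual_gap (int n + 3)) \<longlonglongrightarrow> 0"
proof -
  have d: "decrease \<longlonglongrightarrow> 0" by (rule summable_LIMSEQ_zero[OF decrease_summable])
  have null: "u \<longlonglongrightarrow> 0" if "\<And>n. 0 \<le> u n" "\<And>n. u n \<le> decrease n" for u :: "nat \<Rightarrow> real"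
    by (rule tendsto_sandwich[OF _ _ tendsto_const d]) (auto simp: that)
  have idx: "int n + 2 + 1 = int n + 3" "int n + 2 - 1 = int n + 1" for n by auto
  note nn = decrease_terms_nonneg[OF refl, unfolded idx]
  note dec = decrease_def[unfolded Let_def idx]
  show "(\<lambda>n. \<epsilon> / (2 * t\<^sup>2 * (1 + \<epsilon>)) * (norm (y (int n + 3) - y (int n + 2)))\<^sup>2) \<longlonglongrightarrow> 0"
    by (rule null[OF nn(1)]) (use nn in \<open>smt (verit) dec\<close>)
  show "(\<lambda>n. residual_coefficient (int n + 2) * (norm (x (int n + 2) - x (int n + 1)))\<^sup>2) \<longlonglongrightarrow> 0"
    by (rule null[OF nn(2)]) (use nn in \<open>smt (verit) dec\<close>)
  show "(\<lambda>n. \<gamma> (int n + 2) * (1 + \<rho> (int n + 2) - (\<rho> (int n + 3))\<^sup>2) * primal_gap (int n + 1)) \<longlonglongrightarrow> 0"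
    by (rule null[OF nn(3)]) (use nn in \<open>smt (verit) dec\<close>)
  show "(\<lambda>n. \<gamma> (int n + 3) * dual_gap (int n + 3)) \<longlonglongrightarrow> 0"
    by (rule null[OF nn(4)]) (use nn in \<open>smt (verit) dec\<close>)
qed

lemma lyapunov_le_initial:
  assumes "2 \<le> k"
  shows "lyapunov k \<le> lyapunov 2"
proof -
  obtain n where "k = int n + 2" using assms by (metis add.commute le_add_diff_inverse zle_iff_zadd)
  then show ?thesis using decseqD[OF lyapunov_decseq, of 0 n] by simp
qed

lemma iterates_bounded: "bounded (x ` {-1..})" "bounded (y ` {1..})"
proof -
  have "norm (x k - xs) \<le> sqrt (2 * lyapunov 2)" if "2 \<le> k" for k
    using lyapunov_lower(1)[OF that] lyapunov_le_initial[OF that] by (intro real_le_rsqrt) simp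
  then have "x ` {2..} \<subseteq> cball xs (sqrt (2 * lyapunov 2))" by (auto simp: dist_norm norm_minus_commute)
  then have "bounded (x ` {2..})" by (rule bounded_subset[OF bounded_cball])
  moreover have "{-1::int..} = {2..} \<union> {-1, 0, 1}" by auto
  then have "x ` {-1..} = x ` {2..} \<union> {x (-1), x 0, x 1}" by (simp add: image_Un)
  ultimately show "bounded (x ` {-1..})" by (simp add: bounded_insert)
  have "norm (y k - ys) \<le> sqrt (2 * t\<^sup>2 * lyapunov 2)" if "2 \<le> k" for k
  proof (rule real_le_rsqrt)
    have "1 / (2 * t\<^sup>2) * (norm (y k - ys))\<^sup>2 \<le> lyapunov 2"
      using lyapunov_lower(2)[OF that] lyapunov_le_initial[OF that] by linarith
    then show "(norm (y k - ys))\<^sup>2 \<le> 2 * t\<^sup>2 * lyapunov 2" using parameters(1) by (simp add: field_simps)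
  qed
  then have "y ` {2..} \<subseteq> cball ys (sqrt (2 * t\<^sup>2 * lyapunov 2))" by (auto simp: dist_norm norm_minus_commute)
  then have "bounded (y ` {2..})" by (rule bounded_subset[OF bounded_cball])
  moreover have "{1::int..} = {2..} \<union> {1}" by auto
  then have "y ` {1..} = y ` {2..} \<union> {y 1}" by (simp add: image_Un)
  ultimately show "bounded (y ` {1..})" by (simp add: bounded_insert)
qed

end

section \<open>Bounds that do not refer to a chosen solution\<close>

context adaptive_primal_dual
begin

lemma iterates_bounded: "bounded (x ` {-1..})" "bounded (y ` {1..})"
proof -
  obtain xs ys where s: "primal_dual_solution gradf g h A xs ys" using solvable by blast
  interpret adaptive_primal_dual_solution f gradf g h A t \<epsilon> \<nu> \<eta>max x y \<gamma> \<sigma> \<eta> \<rho> \<xi> \<delta> xs ys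
    by unfold_locales (rule s)
  show "bounded (x ` {-1..})" "bounded (y ` {1..})" by (fact iterates_bounded)+
qed

lemma steps_bounded_below:
  obtains c where "0 < c" "\<And>k. 0 \<le> k \<Longrightarrow> c \<le> \<gamma> k"
proof -
  obtain R where R: "\<And>k. -1 \<le> k \<Longrightarrow> norm (x k) \<le> R"
    using iterates_bounded(1) unfolding bounded_iff by auto
  have V: "convex (cball (0::'a) R)" "bounded (cball (0::'a) R)" by auto
  have xV: "x k \<in> cball 0 R" if "-1 \<le> k" for k using R[OF that] by simp
  obtain L where L: "0 < L" "L-lipschitz_on {v + u | v u. v \<in> cball (0::'a) R \<and> norm u \<le> diameter (cball (0::'a) R)} gradf"
    using locally_lipschitz_enlarged[OF f_smooth V(2)] .
  note b = gamma_hat_bounds[OF L(1) V xV L(2)]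
  have "gamma_hat L \<noteq> \<infinity>" using b(2)[of 0] by auto
  with b(1) obtain c where "gamma_hat L = ereal c" by (cases "gamma_hat L") auto
  with b show thesis by (intro that[of c]) auto
qed

end

context adaptive_primal_dual_solution
begin

lemma dual_gap_tendsto: "(\<lambda>n. dual_gap (int n)) \<longlonglongrightarrow> 0"
proof -
  obtain c where c: "0 < c" "\<And>k. 0 \<le> k \<Longrightarrow> c \<le> \<gamma> k" using steps_bounded_below by blast
  have le: "dual_gap (int n + 3) \<le> \<gamma> (int n + 3) * dual_gap (int n + 3) / c" for n
    using mult_right_mono[OF c(2)[of "int n + 3"] dual_gap_nonneg[of "int n + 3"]] c(1)
    by (simp add: field_simps)
  have "(\<lambda>n. \<gamma> (int n + 3) * dual_gap (int n + 3) / c) \<longlonglongrightarrow> 0 / c"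
    by (intro tendsto_divide decrease_terms_tendsto(4) tendsto_const) (use c in simp)
  then have "(\<lambda>n. \<gamma> (int n + 3) * dual_gap (int n + 3) / c) \<longlonglongrightarrow> 0" by simp
  then have "(\<lambda>n. dual_gap (int n + 3)) \<longlonglongrightarrow> 0"
    by (rule tendsto_sandwich[OF _ _ tendsto_const, rotated 2]) (auto simp: le dual_gap_nonneg)
  then have "(\<lambda>n. dual_gap (int (n + 3))) \<longlonglongrightarrow> 0" by simp
  then show ?thesis by (rule LIMSEQ_offset)
qed

lemma primal_gap_frequently_small:
  assumes "0 < p"
  shows "\<not> eventually (\<lambda>n. p \<le> primal_gap (int n)) sequentially"
proof
  assume "eventually (\<lambda>n. p \<le> primal_gap (int n)) sequentially"
  then obtain N0 where N0: "\<And>n. N0 \<le> n \<Longrightarrow> p \<le> primal_gap (int n)"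
    unfolding eventually_sequentially by blast
  obtain c where c: "0 < c" "\<And>k. 0 \<le> k \<Longrightarrow> c \<le> \<gamma> k" using steps_bounded_below by blast
  \<comment> \<open>With stepsizes at least \<open>c\<close> and gaps at least \<open>p\<close>, a
    weighted gap below this threshold forces \<open>1 + \<rho> k - (\<rho> (k + 1))\<^sup>2\<close>
    below 1/2.\<close>
  have "0 < c * p / 2" using c assms by simp
  from order_tendstoD(2)[OF decrease_terms_tendsto(3) this]
  obtain N1 where N1: "\<And>n. N1 \<le> n \<Longrightarrow>
      \<gamma> (int n + 2) * (1 + \<rho> (int n + 2) - (\<rho> (int n + 3))\<^sup>2) * primal_gap (int n + 1) < c * p / 2"
    unfolding eventually_sequentially by blast
  define N where "N = int (max N0 N1) + 2"
  have growth: "1 / 2 + \<rho> k \<le> (\<rho> (k + 1))\<^sup>2" if k: "N \<le> k" for k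
  proof (rule ccontr)
    assume n: "\<not> ?thesis"
    define n where "n = nat (k - 2)"
    have kn: "k = int n + 2" "N0 \<le> n" "N1 \<le> n" using k by (auto simp: N_def n_def)
    have gap: "p \<le> primal_gap (int n + 1)" using N0[of "n + 1"] kn(2) by (simp add: add.commute)
    have th: "1 / 2 \<le> 1 + \<rho> k - (\<rho> (k + 1))\<^sup>2" using n by linarith
    have "c * (1 / 2) * p \<le> \<gamma> k * (1 + \<rho> k - (\<rho> (k + 1))\<^sup>2) * primal_gap (int n + 1)"
      using c(2)[of k] c(1) th gap assms kn(1) by (intro mult_mono mult_nonneg_nonneg) auto
    moreover have "k + 1 = int n + 3" using kn(1) by simp
    ultimately show False using N1[OF kn(3)] unfolding kn(1)[symmetric] by simp
  qed
  have N2: "2 \<le> N" by (simp add: N_def)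
  have bound: "\<gamma> k \<le> lyapunov 2 / p" if k: "N \<le> k" for k
  proof -
    have gap: "p \<le> primal_gap (k - 1)"
      using N0[of "nat (k - 1)"] k by (simp add: N_def)
    have "\<gamma> k * 1 * p \<le> \<gamma> k * (1 + \<rho> k) * primal_gap (k - 1)"
      using gap gamma_pos[of k] rho_pos[of k] k N2 assms by (intro mult_mono mult_nonneg_nonneg) auto
    also have "\<dots> \<le> lyapunov 2"
      using lyapunov_lower(3)[of k] lyapunov_le_initial[of k] k N2 by linarith
    finally show ?thesis using assms by (simp add: field_simps)
  qed
  have "0 < \<gamma> (N + 1)" using gamma_pos N2 by simp
  obtain n where n: "lyapunov 2 / p / \<gamma> (N + 1) < (21 / 20) ^ n"
    using real_arch_pow[of "21 / 20" "lyapunov 2 / p / \<gamma> (N + 1)"] by auto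
  then have "lyapunov 2 / p < (21 / 20) ^ n * \<gamma> (N + 1)"
    using pos_divide_less_eq[OF \<open>0 < \<gamma> (N + 1)\<close>] by blast
  also have "\<dots> \<le> \<gamma> (N + 1 + int n)"
    by (rule geometric_growth(2)) (use N2 growth in auto)
  also have "\<dots> \<le> lyapunov 2 / p" by (rule bound) simp
  finally show False by simp
qed

lemma residuals_tendsto:
  assumes "0 < \<epsilon>"
  shows "(\<lambda>n. x (int n + 2) - x (int n + 1)) \<longlonglongrightarrow> 0" "(\<lambda>n. y (int n + 2) - y (int n + 1)) \<longlonglongrightarrow> 0"
proof -
  have null: "u \<longlonglongrightarrow> 0" if "0 < c" "(\<lambda>n. c * (norm (u n))\<^sup>2) \<longlonglongrightarrow> 0"
    for c and u :: "nat \<Rightarrow> 'c::real_normed_vector"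
  proof -
    have "(\<lambda>n. (norm (u n))\<^sup>2) \<longlonglongrightarrow> 0" using that by (simp add: tendsto_mult_left_iff[where l = 0, simplified])
    then have "(\<lambda>n. sqrt ((norm (u n))\<^sup>2)) \<longlonglongrightarrow> sqrt 0" by (rule tendsto_real_sqrt)
    then show ?thesis by (simp add: tendsto_norm_zero_iff)
  qed
  define c where "c = \<epsilon> / (4 * (1 + \<epsilon>))"
  have c: "0 < c" using assms by (simp add: c_def)
  have "(\<lambda>n. c * (norm (x (int n + 2) - x (int n + 1)))\<^sup>2) \<longlonglongrightarrow> 0"
  proof (rule tendsto_sandwich[OF _ _ tendsto_const decrease_terms_tendsto(2)])
    show "eventually (\<lambda>n. 0 \<le> c * (norm (x (int n + 2) - x (int n + 1)))\<^sup>2) sequentially"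
      using c by simp
    have "c \<le> residual_coefficient (int n + 2)" for n
      unfolding c_def by (rule residual_coefficient_lower) simp
    then show "eventually (\<lambda>n. c * (norm (x (int n + 2) - x (int n + 1)))\<^sup>2
        \<le> residual_coefficient (int n + 2) * (norm (x (int n + 2) - x (int n + 1)))\<^sup>2) sequentially"
      by (intro always_eventually allI mult_right_mono) auto
  qed
  then show "(\<lambda>n. x (int n + 2) - x (int n + 1)) \<longlonglongrightarrow> 0" by (rule null[OF c])
  have "(\<lambda>n. y (int n + 3) - y (int n + 2)) \<longlonglongrightarrow> 0"
    by (rule null[OF _ decrease_terms_tendsto(1)]) (use assms parameters in simp)
  \<comment> \<open>The descent controls the dual residual one index later than the primal one; the
    shift aligns the two.\<close>
  then have "(\<lambda>n. y (int (Suc n) + 2) - y (int (Suc n) + 1)) \<longlonglongrightarrow> 0" by (simp add: add_ac)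
  then show "(\<lambda>n. y (int n + 2) - y (int n + 1)) \<longlonglongrightarrow> 0"
    using LIMSEQ_imp_Suc[of "\<lambda>n. y (int n + 2) - y (int n + 1)"] by blast
qed

section \<open>Convergence of the iterates\<close>

text \<open>Convergence along \<open>r\<close> and the vanishing residuals take care of every term
  of the Lyapunov function except the weighted gap. This one is the separate premise
  \<open>W\<close>, because the stepsizes in its weight may be unbounded.\<close>

lemma convergence_from_subsequence:
  assumes \<epsilon>: "0 < \<epsilon>" and r: "strict_mono r"
    and xr: "(\<lambda>n. x (int (r n) + 2)) \<longlonglongrightarrow> xs" and yr: "(\<lambda>n. y (int (r n) + 2)) \<longlonglongrightarrow> ys"
    and W: "(\<lambda>n. \<gamma> (int (r n) + 2) * (1 + \<rho> (int (r n) + 2)) * primal_gap (int (r n) + 1)) \<longlonglongrightarrow> 0"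
  shows "(\<lambda>n. x (int n + 2)) \<longlonglongrightarrow> xs" "(\<lambda>n. y (int n + 2)) \<longlonglongrightarrow> ys"
proof -
  define U where "U n = lyapunov (int n + 2)" for n
  have idx: "int n + 2 - 1 = int n + 1" for n by simp
  have dx: "(\<lambda>n. (norm (x (int (r n) + 2) - x (int (r n) + 1)))\<^sup>2) \<longlonglongrightarrow> 0"
    using LIMSEQ_subseq_LIMSEQ[OF residuals_tendsto(1)[OF \<epsilon>] r] unfolding o_def
    by (auto dest!: tendsto_norm_zero intro!: tendsto_null_power)
  have "(\<lambda>n. (1 - 4 * \<xi> (int (r n) + 2) * (1 + \<epsilon>)) / 4 * (norm (x (int (r n) + 2) - x (int (r n) + 1)))\<^sup>2) \<longlonglongrightarrow> 0"
  proof (rule tendsto_sandwich[OF _ _ tendsto_const dx])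
    show "eventually (\<lambda>n. 0 \<le> (1 - 4 * \<xi> (int (r n) + 2) * (1 + \<epsilon>)) / 4 * (norm (x (int (r n) + 2) - x (int (r n) + 1)))\<^sup>2) sequentially"
      using xi_coefficient(2) by (intro always_eventually allI mult_nonneg_nonneg) auto
    show "eventually (\<lambda>n. (1 - 4 * \<xi> (int (r n) + 2) * (1 + \<epsilon>)) / 4 * (norm (x (int (r n) + 2) - x (int (r n) + 1)))\<^sup>2
        \<le> (norm (x (int (r n) + 2) - x (int (r n) + 1)))\<^sup>2) sequentially"
    proof (intro always_eventually allI)
      fix n
      have "(1 - 4 * \<xi> (int (r n) + 2) * (1 + \<epsilon>)) / 4 \<le> 1"
        using divide_right_mono[OF xi_coefficient(3)[of "int (r n) + 2"], of 4] by linarith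
      from mult_right_mono[OF this, of "(norm (x (int (r n) + 2) - x (int (r n) + 1)))\<^sup>2"]
      show "(1 - 4 * \<xi> (int (r n) + 2) * (1 + \<epsilon>)) / 4 * (norm (x (int (r n) + 2) - x (int (r n) + 1)))\<^sup>2
        \<le> (norm (x (int (r n) + 2) - x (int (r n) + 1)))\<^sup>2" by simp
    qed
  qed
  moreover have "(\<lambda>n. 1 / 2 * (norm (x (int (r n) + 2) - xs))\<^sup>2) \<longlonglongrightarrow> 1 / 2 * (norm (xs - xs))\<^sup>2"
    by (intro tendsto_intros xr)
  moreover have "(\<lambda>n. 1 / (2 * t\<^sup>2) * (norm (y (int (r n) + 2) - ys))\<^sup>2) \<longlonglongrightarrow> 1 / (2 * t\<^sup>2) * (norm (ys - ys))\<^sup>2"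
    by (intro tendsto_mult[OF tendsto_const] tendsto_power tendsto_norm tendsto_diff yr tendsto_const)
  ultimately have "(\<lambda>n. U (r n)) \<longlonglongrightarrow> 1 / 2 * (norm (xs - xs))\<^sup>2 + 0 + 1 / (2 * t\<^sup>2) * (norm (ys - ys))\<^sup>2 + 0"
    unfolding U_def lyapunov_def idx by (intro tendsto_add W)
  then have Ur: "(\<lambda>n. U (r n)) \<longlonglongrightarrow> 0" by simp
  have U: "decseq U" "\<And>n. 0 \<le> U n"
    unfolding U_def using lyapunov_decseq lyapunov_lower(4) by auto
  obtain l where l: "U \<longlonglongrightarrow> l" using decseq_convergent[OF U(1)] U(2) by metis
  have "(\<lambda>n. U (r n)) \<longlonglongrightarrow> l" using LIMSEQ_subseq_LIMSEQ[OF l r] by (simp add: o_def)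
  then have "l = 0" using LIMSEQ_unique[OF Ur] by simp
  then have U0: "U \<longlonglongrightarrow> 0" using l by simp
  have null: "u \<longlonglongrightarrow> z" if "0 < c" "\<And>n. c * (norm (u n - z))\<^sup>2 \<le> U n"
    for c z and u :: "nat \<Rightarrow> 'c::real_normed_vector"
  proof -
    have "(\<lambda>n. sqrt (U n / c)) \<longlonglongrightarrow> sqrt (0 / c)"
      by (intro tendsto_real_sqrt tendsto_divide U0 tendsto_const) (use that in simp)
    then have lim: "(\<lambda>n. sqrt (U n / c)) \<longlonglongrightarrow> 0" by simp
    have le: "norm (u n - z) \<le> sqrt (U n / c)" for n
      using that(2)[of n] that(1) by (intro real_le_rsqrt) (simp add: field_simps)
    have "(\<lambda>n. u n - z) \<longlonglongrightarrow> 0" by (rule Lim_null_comparison[OF _ lim]) (simp add: le)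
    then show ?thesis by (simp add: LIM_zero_iff)
  qed
  show "(\<lambda>n. x (int n + 2)) \<longlonglongrightarrow> xs"
    using lyapunov_lower(1) by (intro null[of "1 / 2", unfolded U_def]) auto
  show "(\<lambda>n. y (int n + 2)) \<longlonglongrightarrow> ys"
    using lyapunov_lower(2) parameters(1)
    by (intro null[of "1 / (2 * t\<^sup>2)", unfolded U_def]) auto
qed

text \<open>The subgradient of g and the gradient of f at \<open>x j\<close> add up to
  \<open>H / c - adjoint A (y j)\<close>, so convexity towards \<open>xs\<close> bounds the gap. On
  \<open>H\<close> the factor \<open>\<gamma> (j + 1)\<close> shrinks to
  \<open>\<rho> (j + 1)\<close>; it survives only in front of the dual distance, which makes the
  estimate useful for unbounded stepsizes.\<close>

lemma scaled_primal_gap_le: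
  assumes j: "1 \<le> j" and B: "0 \<le> B" "\<rho> (j + 1) \<le> B"
  shows "\<gamma> (j + 1) * primal_gap j
    \<le> ((B + 1) * norm (x j - x (j - 1)) + \<gamma> (j + 1) * norm (adjoint A (y j - ys))) * norm (x j - xs)"
proof -
  define c cp D G where "c = \<gamma> j" and "cp = \<gamma> (j + 1)" and "D = x (j - 1) - x j"
    and "G = gradf (x (j - 1)) - gradf (x j)"
  define H where "H = D - c *\<^sub>R G"
  have pos: "0 < c" "0 < cp" using gamma_pos[of j] gamma_pos[of "j + 1"] j by (auto simp: c_def cp_def)
  have r: "\<rho> (j + 1) = cp / c" "0 < \<rho> (j + 1)"
    using rho_next[of j] rho_pos[of "j + 1"] j by (auto simp: cp_def c_def)
  have sx: "(1 / c) *\<^sub>R D - gradf (x (j - 1)) - adjoint A (y j) \<in> subdifferential g (x j)"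
    using x_subgradient[OF j] by (simp add: c_def D_def)
  have "g_val j + ((1 / c) *\<^sub>R D - gradf (x (j - 1)) - adjoint A (y j)) \<bullet> (xs - x j) \<le> g_opt"
    by (rule subdifferentialD[OF sx g_val[OF j] g_opt])
  moreover have "f (x j) + gradf (x j) \<bullet> (xs - x j) \<le> f xs"
    by (rule convex_gradient_inequality[OF f_convex f_gradient])
  moreover have "((1 / c) *\<^sub>R D - gradf (x (j - 1)) - adjoint A (y j)) \<bullet> (xs - x j) + gradf (x j) \<bullet> (xs - x j)
      = - ((1 / c) * (H \<bullet> (x j - xs))) + adjoint A (y j - ys) \<bullet> (x j - xs) + (x j - xs) \<bullet> adjoint A ys"
  proof -
    define w where "w = x j - xs"
    have "xs - x j = - w" by (simp add: w_def)
    moreover have "(1 / c) * (H \<bullet> w) = (1 / c) * (D \<bullet> w) - (gradf (x (j - 1)) \<bullet> w - gradf (x j) \<bullet> w)"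
      unfolding H_def G_def using pos by (simp add: inner_diff_left right_diff_distrib)
    ultimately show ?thesis
      unfolding w_def[symmetric] adjoint_diff
      by (simp add: inner_diff_left inner_commute[of w])
  qed
  ultimately have "primal_gap j \<le> (1 / c) * (H \<bullet> (x j - xs)) - adjoint A (y j - ys) \<bullet> (x j - xs)"
    unfolding primal_gap_def by linarith
  then have "cp * primal_gap j \<le> cp * ((1 / c) * (H \<bullet> (x j - xs)) - adjoint A (y j - ys) \<bullet> (x j - xs))"
    using pos by simp
  also have "\<dots> = \<rho> (j + 1) * (H \<bullet> (x j - xs)) + cp * (- (adjoint A (y j - ys)) \<bullet> (x j - xs))"
    unfolding r by (simp add: right_diff_distrib)
  also have "\<dots> \<le> \<rho> (j + 1) * (norm H * norm (x j - xs)) + cp * (norm (- adjoint A (y j - ys)) * norm (x j - xs))"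
    using r(2) pos by (intro add_mono mult_left_mono norm_cauchy_schwarz) auto
  finally have 1: "cp * primal_gap j \<le> (\<rho> (j + 1) * norm H + cp * norm (adjoint A (y j - ys))) * norm (x j - xs)"
    by (simp add: algebra_simps)
  have "\<rho> (j + 1) * norm H \<le> (B + 1) * norm D"
  proof (rule power2_le_imp_le)
    have "0 \<le> c * (G \<bullet> D)"
    proof -
      have "0 \<le> G \<bullet> D"
        unfolding G_def D_def
        using convex_gradient_inequality[OF f_convex f_gradient, of "x j" "x (j - 1)"]
          convex_gradient_inequality[OF f_convex f_gradient, of "x (j - 1)" "x j"]
        by (simp add: inner_diff_left inner_diff_right)
      then show ?thesis using pos by simp
    qed
    moreover have "(norm H)\<^sup>2 = (norm D)\<^sup>2 - 2 * (c * (G \<bullet> D)) + c\<^sup>2 * (norm G)\<^sup>2"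
      unfolding H_def power2_norm_eq_inner
      by (simp only: inner_diff_left inner_diff_right inner_scaleR_left inner_scaleR_right)
         (simp add: inner_commute power2_eq_square algebra_simps)
    moreover have "\<delta> j * (norm D)\<^sup>2 = c\<^sup>2 * (norm G)\<^sup>2 - c * (G \<bullet> D)"
      unfolding D_def G_def c_def by (rule delta_identity) (use j in simp)
    ultimately have "(norm H)\<^sup>2 \<le> (1 + \<delta> j) * (norm D)\<^sup>2" by (simp add: distrib_right)
    then have "(\<rho> (j + 1))\<^sup>2 * (norm H)\<^sup>2 \<le> (\<rho> (j + 1))\<^sup>2 * ((1 + \<delta> j) * (norm D)\<^sup>2)"
      by (intro mult_left_mono) auto
    also have "\<dots> = ((\<rho> (j + 1))\<^sup>2 + (\<rho> (j + 1))\<^sup>2 * \<delta> j) * (norm D)\<^sup>2" by (simp add: algebra_simps)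
    also have "\<dots> \<le> (B + 1)\<^sup>2 * (norm D)\<^sup>2"
    proof (rule mult_right_mono)
      \<comment> \<open>The stepsize rule balances \<open>\<rho> (j + 1)\<close> against
        \<open>\<delta> j\<close>: a nonnegative residual coefficient bounds
        \<open>(\<rho> (j + 1))\<^sup>2 * \<delta> j\<close> even if \<open>\<delta> j\<close> is
        large.\<close>
      have "0 \<le> residual_coefficient j" using residual_coefficient_nonneg j by simp
      then have "4 * ((\<rho> (j + 1))\<^sup>2 * \<delta> j) + 4 * ((\<rho> (j + 1))\<^sup>2 * (\<xi> (j + 1) * (1 + \<epsilon>))) \<le> 1 - 4 * \<xi> j * (1 + \<epsilon>)"
        unfolding residual_coefficient_def by (simp add: algebra_simps)
      moreover have "0 \<le> (\<rho> (j + 1))\<^sup>2 * (\<xi> (j + 1) * (1 + \<epsilon>))"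
        using xi_coefficient(1)[of "j + 1"] j parameters by simp
      ultimately have "(\<rho> (j + 1))\<^sup>2 * \<delta> j \<le> 1" using xi_coefficient(3)[of j] j by linarith
      moreover have "(\<rho> (j + 1))\<^sup>2 \<le> B\<^sup>2" using B r(2) by (intro power_mono) auto
      ultimately show "(\<rho> (j + 1))\<^sup>2 + (\<rho> (j + 1))\<^sup>2 * \<delta> j \<le> (B + 1)\<^sup>2"
        using B(1) by (simp add: power2_eq_square algebra_simps)
    qed simp
    finally show "(\<rho> (j + 1) * norm H)\<^sup>2 \<le> ((B + 1) * norm D)\<^sup>2" by (simp add: power_mult_distrib)
    show "0 \<le> (B + 1) * norm D" using B by simp
  qed
  then have "(\<rho> (j + 1) * norm H + cp * norm (adjoint A (y j - ys))) * norm (x j - xs)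
      \<le> ((B + 1) * norm D + cp * norm (adjoint A (y j - ys))) * norm (x j - xs)"
    by (intro mult_right_mono) auto
  with 1 show ?thesis unfolding cp_def D_def by (simp add: norm_minus_commute)
qed

end

context adaptive_primal_dual_solution
begin

text \<open>The fixed solution \<open>(xs, ys)\<close> only serves to know that the residuals vanish.\<close>

lemma limit_point_solution:
  assumes \<epsilon>: "0 < \<epsilon>" and r: "strict_mono r"
    and xr: "(\<lambda>n. x (int (r n) + 2)) \<longlonglongrightarrow> xl" and yr: "(\<lambda>n. y (int (r n) + 2)) \<longlonglongrightarrow> yl"
  shows "primal_dual_solution gradf g h A xl yl"
proof -
  have dx: "(\<lambda>n. x (int (r n) + 2) - x (int (r n) + 1)) \<longlonglongrightarrow> 0"
    using LIMSEQ_subseq_LIMSEQ[OF residuals_tendsto(1)[OF \<epsilon>] r] by (simp add: o_def)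
  have dy: "(\<lambda>n. y (int (r n) + 2) - y (int (r n) + 1)) \<longlonglongrightarrow> 0"
    using LIMSEQ_subseq_LIMSEQ[OF residuals_tendsto(2)[OF \<epsilon>] r] by (simp add: o_def)
  \<comment> \<open>The dual subgradient at index k involves x^{k-2}, so a second consecutive primal
    residual has to vanish.\<close>
  have "(\<lambda>n. x (int (Suc n) + 1) - x (int (Suc n))) \<longlonglongrightarrow> 0"
    using residuals_tendsto(1)[OF \<epsilon>] by (simp add: add_ac)
  then have "(\<lambda>n. x (int n + 1) - x (int n)) \<longlonglongrightarrow> 0"
    using LIMSEQ_imp_Suc[of "\<lambda>n. x (int n + 1) - x (int n)"] by blast
  then have dx0: "(\<lambda>n. x (int (r n) + 1) - x (int (r n))) \<longlonglongrightarrow> 0"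
    using LIMSEQ_subseq_LIMSEQ[OF _ r] by (force simp: o_def)
  have x1: "(\<lambda>n. x (int (r n) + 1)) \<longlonglongrightarrow> xl"
    using tendsto_diff[OF xr dx] by simp
  have x0: "(\<lambda>n. x (int (r n))) \<longlonglongrightarrow> xl"
    using tendsto_diff[OF x1 dx0] by simp
  obtain c where c: "0 < c" "\<And>k. 0 \<le> k \<Longrightarrow> c \<le> \<gamma> k" using steps_bounded_below by blast
  obtain B where B: "2 \<le> B" "\<And>k. 0 \<le> k \<Longrightarrow> \<rho> k \<le> B" using rho_bounded by blast
  have scaled: "(\<lambda>n. a n *\<^sub>R u n) \<longlonglongrightarrow> 0"
    if "u \<longlonglongrightarrow> 0" "\<And>n. \<bar>a n\<bar> \<le> b" for a b and u :: "nat \<Rightarrow> 'c::real_normed_vector"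
  proof (rule Lim_null_comparison)
    show "eventually (\<lambda>n. norm (a n *\<^sub>R u n) \<le> b * norm (u n)) sequentially"
      using that(2) by (intro always_eventually allI) (simp add: mult_right_mono)
    show "(\<lambda>n. b * norm (u n)) \<longlonglongrightarrow> 0"
      by (rule tendsto_mult_right_zero[OF tendsto_norm_zero[OF that(1)]])
  qed
  have A_lim: "(\<lambda>n. A (X n)) \<longlonglongrightarrow> A z" if "X \<longlonglongrightarrow> z" for X :: "nat \<Rightarrow> 'a" and z
    using bounded_linear.tendsto[OF linear_conv_bounded_linear[THEN iffD1, OF A] that] .
  have At_lim: "(\<lambda>n. adjoint A (X n)) \<longlonglongrightarrow> adjoint A z" if "X \<longlonglongrightarrow> z" for X :: "nat \<Rightarrow> 'b" and z
    using bounded_linear.tendsto[OF linear_conv_bounded_linear[THEN iffD1, OF adjoint_linear[OF A]] that] .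
  have inv: "\<bar>1 / \<gamma> (int (r n) + 2)\<bar> \<le> 1 / c" for n
    using c(1) c(2)[of "int (r n) + 2"] by (simp add: frac_le)
  have idx: "int (r n) + 2 - 1 = int (r n) + 1" "int (r n) + 2 - 2 = int (r n)" for n by auto
  have "- adjoint A yl - gradf xl \<in> subdifferential g xl"
  proof (rule subdifferential_closed_graph[OF g(1,3) xr])
    define v where "v n = (1 / \<gamma> (int (r n) + 2)) *\<^sub>R (x (int (r n) + 1) - x (int (r n) + 2))
        - gradf (x (int (r n) + 1)) - adjoint A (y (int (r n) + 2))" for n
    show "v n \<in> subdifferential g (x (int (r n) + 2))" for n
      using x_subgradient[of "int (r n) + 2", unfolded idx] unfolding v_def by simp
    have "(\<lambda>n. x (int (r n) + 1) - x (int (r n) + 2)) \<longlonglongrightarrow> 0"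
      using tendsto_minus[OF dx] by simp
    then have "(\<lambda>n. (1 / \<gamma> (int (r n) + 2)) *\<^sub>R (x (int (r n) + 1) - x (int (r n) + 2))) \<longlonglongrightarrow> 0"
      by (rule scaled) (rule inv)
    then have "v \<longlonglongrightarrow> 0 - gradf xl - adjoint A yl"
      unfolding v_def
      by (intro tendsto_diff locally_lipschitz_sequentially_continuous[OF f_smooth x1] At_lim yr)
    moreover have "0 - gradf xl - adjoint A yl = - adjoint A yl - gradf xl"
      by (simp only: diff_conv_add_uminus add_0 add.commute)
    ultimately show "v \<longlonglongrightarrow> - adjoint A yl - gradf xl" by metis
  qed
  moreover have "A xl \<in> subdifferential (conjugate h) yl"
  proof (rule subdifferential_closed_graph[OF conjugate_proper lsc_fun_conjugate[OF h] yr])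
    define v where "v n = (1 / (t\<^sup>2 * \<gamma> (int (r n) + 2))) *\<^sub>R (y (int (r n) + 1) - y (int (r n) + 2))
        + (A (x (int (r n) + 1)) + \<rho> (int (r n) + 2) *\<^sub>R (A (x (int (r n) + 1)) - A (x (int (r n)))))" for n
    show "v n \<in> subdifferential (conjugate h) (y (int (r n) + 2))" for n
      using y_subgradient[of "int (r n) + 2", unfolded idx] unfolding v_def by simp
    have "(\<lambda>n. y (int (r n) + 1) - y (int (r n) + 2)) \<longlonglongrightarrow> 0"
      using tendsto_minus[OF dy] by simp
    moreover have "\<bar>1 / (t\<^sup>2 * \<gamma> (int (r n) + 2))\<bar> \<le> 1 / t\<^sup>2 * (1 / c)" for n
      using mult_left_mono[OF inv[of n], of "1 / t\<^sup>2"] by (simp add: abs_mult)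
    ultimately have 1: "(\<lambda>n. (1 / (t\<^sup>2 * \<gamma> (int (r n) + 2))) *\<^sub>R (y (int (r n) + 1) - y (int (r n) + 2))) \<longlonglongrightarrow> 0"
      by (rule scaled)
    have "(\<lambda>n. A (x (int (r n) + 1)) - A (x (int (r n)))) \<longlonglongrightarrow> 0"
      using tendsto_diff[OF A_lim[OF x1] A_lim[OF x0]] by simp
    moreover have "\<bar>\<rho> (int (r n) + 2)\<bar> \<le> B" for n
      using B(2)[of "int (r n) + 2"] rho_pos[of "int (r n) + 2"] by simp
    ultimately have 2: "(\<lambda>n. \<rho> (int (r n) + 2) *\<^sub>R (A (x (int (r n) + 1)) - A (x (int (r n))))) \<longlonglongrightarrow> 0"
      by (rule scaled)
    have "v \<longlonglongrightarrow> 0 + (A xl + 0)"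
      unfolding v_def by (intro tendsto_add 1 2 A_lim x1)
    then show "v \<longlonglongrightarrow> A xl" by simp
  qed
  ultimately show ?thesis
    unfolding primal_dual_solution_def by (auto intro!: image_eqI)
qed

end

context adaptive_primal_dual
begin

text \<open>Each step costs at most \<open>S / (2 * \<nu> * t)\<close>, because
  \<open>\<eta> (k + 1) * \<gamma> (k + 1)\<close> is at most \<open>1 / (2 * \<nu> * t)\<close>.
  Passing from the weight at one index to that of its predecessor gains the factor 20/21, so the
  costs form a geometric series with sum factor 21.\<close>

lemma adjoint_drift:
  assumes M: "0 \<le> M" "\<And>k. M \<le> k \<Longrightarrow> 21 / 20 * \<gamma> k \<le> \<gamma> (k + 1)"
    and S: "\<And>k. M \<le> k \<Longrightarrow> norm (y k - y (k + 1)) \<le> S" "0 \<le> S"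
  shows "M \<le> j \<Longrightarrow> \<gamma> (j + 1) * norm (adjoint A (y j - y (j + int n))) \<le> 21 * (S / (2 * \<nu> * t))"
proof (induction n arbitrary: j)
  case 0
  have "0 \<le> S / (2 * \<nu> * t)" using S(2) nu_pos parameters(1) by simp
  then show ?case using linear_0[OF adjoint_linear[OF A]] by simp
next
  case (Suc n)
  define i where "i = S / (2 * \<nu> * t)"
  have j: "0 \<le> j" using Suc.prems M(1) by simp
  have gp: "0 < \<gamma> (j + 1)" using gamma_pos j by simp
  have 1: "\<gamma> (j + 1) * norm (adjoint A (y j - y (j + 1))) \<le> i"
  proof -
    have "norm (adjoint A (y j - y (j + 1))) \<le> \<eta> (j + 1) * norm (y j - y (j + 1))"
      unfolding adjoint_diff by (rule eta_bound[OF j])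
    also have "\<dots> \<le> \<eta> (j + 1) * S"
      using S(1)[OF Suc.prems] eta_nonneg[of "j + 1"] j by (intro mult_left_mono) auto
    finally have "\<gamma> (j + 1) * norm (adjoint A (y j - y (j + 1))) \<le> \<gamma> (j + 1) * (\<eta> (j + 1) * S)"
      using gp by simp
    also have "\<dots> = (2 * \<nu> * t * \<eta> (j + 1) * \<gamma> (j + 1)) * i"
      unfolding i_def using nu_pos parameters(1) by simp
    also have "\<dots> \<le> 1 * i"
      using eta_gamma_le[of "j + 1"] j S(2) nu_pos parameters(1)
      by (intro mult_right_mono) (auto simp: i_def)
    finally show ?thesis by simp
  qed
  have 2: "\<gamma> (j + 1) * norm (adjoint A (y (j + 1) - y (j + 1 + int n))) \<le> 20 * i"
  proof -
    have "21 / 20 * \<gamma> (j + 1) * norm (adjoint A (y (j + 1) - y (j + 1 + int n)))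
        \<le> \<gamma> (j + 1 + 1) * norm (adjoint A (y (j + 1) - y (j + 1 + int n)))"
      using M(2)[of "j + 1"] Suc.prems by (intro mult_right_mono) auto
    also have "\<dots> \<le> 21 * i" unfolding i_def using Suc.IH[of "j + 1"] Suc.prems by simp
    finally show ?thesis by simp
  qed
  have "y j - y (j + int (Suc n)) = (y j - y (j + 1)) + (y (j + 1) - y (j + 1 + int n))"
    by (simp add: add_ac)
  then have "norm (adjoint A (y j - y (j + int (Suc n))))
      \<le> norm (adjoint A (y j - y (j + 1))) + norm (adjoint A (y (j + 1) - y (j + 1 + int n)))"
    using linear_add[OF adjoint_linear[OF A]] norm_triangle_ineq by metis
  then have "\<gamma> (j + 1) * norm (adjoint A (y j - y (j + int (Suc n))))
      \<le> \<gamma> (j + 1) * (norm (adjoint A (y j - y (j + 1))) + norm (adjoint A (y (j + 1) - y (j + 1 + int n))))"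
    using gp by simp
  also have "\<dots> \<le> 21 * i" using 1 2 by (simp add: distrib_left)
  finally show ?case unfolding i_def .
qed

lemma iterates_converge:
  assumes \<epsilon>: "0 < \<epsilon>"
  shows "\<exists>xl yl. primal_dual_solution gradf g h A xl yl
    \<and> (\<lambda>n. x (int n)) \<longlonglongrightarrow> xl \<and> (\<lambda>n. y (int n)) \<longlonglongrightarrow> yl"
proof -
  obtain xs ys where s: "primal_dual_solution gradf g h A xs ys" using solvable by blast
  interpret S: adaptive_primal_dual_solution f gradf g h A t \<epsilon> \<nu> \<eta>max x y \<gamma> \<sigma> \<eta> \<rho> \<xi> \<delta> xs ys
    by unfold_locales (rule s)
  obtain B where B: "2 \<le> B" "\<And>k. 0 \<le> k \<Longrightarrow> \<rho> k \<le> B" using rho_bounded by blast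
  obtain Rx where Rx: "\<And>k. -1 \<le> k \<Longrightarrow> norm (x k) \<le> Rx"
    using iterates_bounded(1) unfolding bounded_iff by auto
  obtain Ry where Ry: "\<And>k. 1 \<le> k \<Longrightarrow> norm (y k) \<le> Ry"
    using iterates_bounded(2) unfolding bounded_iff by auto
  define z where "z n = (x (int n + 2), y (int n + 2))" for n
  have "norm (z n) \<le> Rx + Ry" for n
    unfolding z_def using norm_Pair_le[of "x (int n + 2)" "y (int n + 2)"]
      Rx[of "int n + 2"] Ry[of "int n + 2"] by simp
  then have z_bounded: "bounded (range (\<lambda>n. z (q n)))" for q :: "nat \<Rightarrow> nat"
    unfolding bounded_iff by blast
  have cluster: "\<exists>r xl yl. strict_mono r \<and> (\<forall>n. r n \<in> range q)
      \<and> (\<lambda>n. x (int (r n) + 2)) \<longlonglongrightarrow> xl \<and> (\<lambda>n. y (int (r n) + 2)) \<longlonglongrightarrow> yl"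
    if q: "strict_mono q" for q :: "nat \<Rightarrow> nat"
  proof -
    obtain l p where p: "strict_mono p" "((\<lambda>n. z (q n)) \<circ> p) \<longlonglongrightarrow> l"
      using bounded_imp_convergent_subsequence[OF z_bounded] by metis
    have "(\<lambda>n. fst (z (q (p n)))) \<longlonglongrightarrow> fst l" "(\<lambda>n. snd (z (q (p n)))) \<longlonglongrightarrow> snd l"
      using tendsto_fst[OF p(2)] tendsto_snd[OF p(2)] by (simp_all add: o_def)
    then show ?thesis
      using strict_mono_o[OF q p(1)] by (intro exI[of _ "q \<circ> p"]) (auto simp: z_def o_def)
  qed
  have "\<exists>r xl yl. strict_mono r \<and> primal_dual_solution gradf g h A xl yl
      \<and> (\<lambda>n. x (int (r n) + 2)) \<longlonglongrightarrow> xl \<and> (\<lambda>n. y (int (r n) + 2)) \<longlonglongrightarrow> yl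
      \<and> (\<lambda>n. \<gamma> (int (r n) + 2) * (1 + \<rho> (int (r n) + 2))
            * adaptive_primal_dual_solution.primal_gap f g A x xl yl (int (r n) + 1)) \<longlonglongrightarrow> 0"
    \<comment> \<open>If \<open>1 + \<rho>\<^sub>k - \<rho>\<^sub>k\<^sub>+\<^sub>1\<^sup>2 \<ge> 1 / 2\<close> infinitely often, then the gap term is summable along these
      indices. Otherwise \<open>\<gamma>\<^sub>k\<close> grows geometrically, so that \<open>A\<^sup>T y\<^sup>k\<close> is Cauchy at rate \<open>1 / \<gamma>\<^sub>k\<close>.\<close>
  proof (cases "infinite {m :: nat. 1 / 2 \<le> 1 + \<rho> (int m + 2) - (\<rho> (int m + 3))\<^sup>2}")
    case True
    obtain q :: "nat \<Rightarrow> nat" where q: "strict_mono q"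
      "\<And>n. q n \<in> {m. 1 / 2 \<le> 1 + \<rho> (int m + 2) - (\<rho> (int m + 3))\<^sup>2}"
      using infinite_enumerate[OF True] by blast
    obtain r xl yl where r: "strict_mono r" "\<And>n. r n \<in> range q"
      "(\<lambda>n. x (int (r n) + 2)) \<longlonglongrightarrow> xl" "(\<lambda>n. y (int (r n) + 2)) \<longlonglongrightarrow> yl"
      using cluster[OF q(1)] by blast
    have sol: "primal_dual_solution gradf g h A xl yl"
      by (rule S.limit_point_solution[OF \<epsilon> r(1,3,4)])
    \<comment> \<open>The gap now refers to \<open>(xl, yl)\<close>, so the descent results are
      invoked afresh for this solution.\<close>
    interpret L: adaptive_primal_dual_solution f gradf g h A t \<epsilon> \<nu> \<eta>max x y \<gamma> \<sigma> \<eta> \<rho> \<xi> \<delta> xl yl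
      by unfold_locales (rule sol)
    define w where "w m = \<gamma> (int m + 2) * (1 + \<rho> (int m + 2) - (\<rho> (int m + 3))\<^sup>2) * L.primal_gap (int m + 1)" for m :: nat
    \<comment> \<open>Along \<open>r\<close> the factor
      \<open>1 + \<rho> k - (\<rho> (k + 1))\<^sup>2\<close> is at least 1/2 while
      \<open>1 + \<rho> k \<le> 1 + B\<close>; hence the constant
      \<open>2 * (1 + B)\<close>.\<close>
    have "(\<lambda>n. 2 * (1 + B) * w (r n)) \<longlonglongrightarrow> 2 * (1 + B) * 0"
      using LIMSEQ_subseq_LIMSEQ[OF L.decrease_terms_tendsto(3) r(1)] unfolding o_def w_def[symmetric]
      by (intro tendsto_mult tendsto_const)
    then have w0: "(\<lambda>n. 2 * (1 + B) * w (r n)) \<longlonglongrightarrow> 0" by simp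
    have "(\<lambda>n. \<gamma> (int (r n) + 2) * (1 + \<rho> (int (r n) + 2)) * L.primal_gap (int (r n) + 1)) \<longlonglongrightarrow> 0"
    proof (rule tendsto_sandwich[OF _ _ tendsto_const w0]; intro always_eventually allI)
      fix n
      define m where "m = r n"
      have half: "1 / 2 \<le> 1 + \<rho> (int m + 2) - (\<rho> (int m + 3))\<^sup>2"
        using q(2) r(2)[of n] unfolding m_def by auto
      have gP: "0 \<le> \<gamma> (int m + 2) * L.primal_gap (int m + 1)"
        using gamma_pos[of "int m + 2"] L.primal_gap_nonneg_index[of "int m + 1"] by simp
      show "0 \<le> \<gamma> (int (r n) + 2) * (1 + \<rho> (int (r n) + 2)) * L.primal_gap (int (r n) + 1)"
        using mult_nonneg_nonneg[OF gP, of "1 + \<rho> (int m + 2)"] rho_pos[of "int m + 2"]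
        unfolding m_def by (simp add: mult_ac)
      have "1 + \<rho> (int m + 2) \<le> 2 * (1 + B) * (1 / 2)" using B(2)[of "int m + 2"] by simp
      also have "\<dots> \<le> 2 * (1 + B) * (1 + \<rho> (int m + 2) - (\<rho> (int m + 3))\<^sup>2)"
        using half B(1) by (intro mult_left_mono) auto
      finally have "(1 + \<rho> (int m + 2)) * (\<gamma> (int m + 2) * L.primal_gap (int m + 1))
          \<le> 2 * (1 + B) * (1 + \<rho> (int m + 2) - (\<rho> (int m + 3))\<^sup>2) * (\<gamma> (int m + 2) * L.primal_gap (int m + 1))"
        using gP by (rule mult_right_mono)
      then show "\<gamma> (int (r n) + 2) * (1 + \<rho> (int (r n) + 2)) * L.primal_gap (int (r n) + 1) \<le> 2 * (1 + B) * w (r n)"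
        unfolding w_def m_def by (simp only: mult_ac)
    qed
    then show ?thesis using r sol by blast
  next
    case False
    then obtain N0 where N0: "\<And>m. 1 / 2 \<le> 1 + \<rho> (int m + 2) - (\<rho> (int m + 3))\<^sup>2 \<Longrightarrow> m \<le> N0"
      unfolding finite_nat_set_iff_bounded_le by auto
    define N where "N = int N0 + 3"
    have gr: "1 / 2 + \<rho> k \<le> (\<rho> (k + 1))\<^sup>2" if "N \<le> k" for k
    proof (rule ccontr)
      assume n: "\<not> ?thesis"
      define m where "m = nat (k - 2)"
      have k: "k = int m + 2" "k + 1 = int m + 3" using that by (auto simp: m_def N_def)
      have "1 / 2 \<le> 1 + \<rho> k - (\<rho> (k + 1))\<^sup>2" using n by linarith
      then have "m \<le> N0" unfolding k(2) unfolding k(1) by (rule N0)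
      then show False using that k by (simp add: N_def)
    qed
    define M where "M = N + 1"
    have M: "0 \<le> M" "1 \<le> M" by (auto simp: M_def N_def)
    have Mgrowth: "21 / 20 * \<gamma> k \<le> \<gamma> (k + 1)" if "M \<le> k" for k
      by (rule geometric_growth(1)[of N]) (use that gr in \<open>auto simp: M_def N_def\<close>)
    obtain r xl yl where r: "strict_mono r"
      "(\<lambda>n. x (int (r n) + 2)) \<longlonglongrightarrow> xl" "(\<lambda>n. y (int (r n) + 2)) \<longlonglongrightarrow> yl"
      using cluster[of id] by (auto simp: strict_mono_def)
    have sol: "primal_dual_solution gradf g h A xl yl"
      by (rule S.limit_point_solution[OF \<epsilon> r])
    interpret L: adaptive_primal_dual_solution f gradf g h A t \<epsilon> \<nu> \<eta>max x y \<gamma> \<sigma> \<eta> \<rho> \<xi> \<delta> xl yl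
      by unfold_locales (rule sol)
    have "0 \<le> Ry" using order_trans[OF norm_ge_zero Ry[of 1]] by simp
    define K where "K = 21 * (2 * Ry / (2 * \<nu> * t))"
    have drift: "\<gamma> (j + 1) * norm (adjoint A (y j - y (j + int n))) \<le> K" if "M \<le> j" for j n
      unfolding K_def
    proof (rule adjoint_drift[OF M(1) Mgrowth _ _ that])
      fix k assume "M \<le> k"
      then show "norm (y k - y (k + 1)) \<le> 2 * Ry"
        using norm_triangle_ineq4[of "y k" "y (k + 1)"] Ry[of k] Ry[of "k + 1"] M by simp
    qed (use \<open>0 \<le> Ry\<close> in auto)
    \<comment> \<open>\<open>drift\<close> bounds the weighted distance to every later iterate, and
      along \<open>r\<close> these tend to \<open>yl\<close>.\<close>
    have drift_lim: "\<gamma> (j + 1) * norm (adjoint A (y j - yl)) \<le> K" if j: "M \<le> j" for j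
    proof (rule LIMSEQ_le_const2)
      show "(\<lambda>n. \<gamma> (j + 1) * norm (adjoint A (y j - y (int (r n) + 2)))) \<longlonglongrightarrow> \<gamma> (j + 1) * norm (adjoint A (y j - yl))"
        by (intro tendsto_mult tendsto_const tendsto_norm tendsto_diff r(3)
            bounded_linear.tendsto[OF linear_conv_bounded_linear[THEN iffD1, OF adjoint_linear[OF A]]])
      show "\<exists>N. \<forall>n\<ge>N. \<gamma> (j + 1) * norm (adjoint A (y j - y (int (r n) + 2))) \<le> K"
      proof (intro exI[of _ "nat j"] allI impI)
        fix n assume "nat j \<le> n"
        also have "n \<le> r n" using r(1) by (rule seq_suble)
        finally have "int (r n) + 2 = j + int (nat (int (r n) + 2 - j))" by simp
        then show "\<gamma> (j + 1) * norm (adjoint A (y j - y (int (r n) + 2))) \<le> K"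
          using drift[OF j] by metis
      qed
    qed
    \<comment> \<open>The factor in \<open>scaled_primal_gap_le\<close>, with primal residuals at
      most \<open>2 * Rx\<close> and dual drift at most \<open>K\<close>, times the bound on
      \<open>1 + \<rho> k\<close>.\<close>
    define C where "C = (1 + B) * ((B + 1) * (2 * Rx) + K)"
    have "(\<lambda>n. x (int (r n) + 2) - x (int (r n) + 1)) \<longlonglongrightarrow> 0"
      using LIMSEQ_subseq_LIMSEQ[OF S.residuals_tendsto(1)[OF \<epsilon>] r(1)] by (simp add: o_def)
    from tendsto_diff[OF r(2) this] have "(\<lambda>n. x (int (r n) + 1)) \<longlonglongrightarrow> xl" by simp
    then have "(\<lambda>n. C * norm (x (int (r n) + 1) - xl)) \<longlonglongrightarrow> C * norm (xl - xl)"
      by (intro tendsto_intros)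
    then have C0: "(\<lambda>n. C * norm (x (int (r n) + 1) - xl)) \<longlonglongrightarrow> 0" by simp
    have "(\<lambda>n. \<gamma> (int (r n) + 2) * (1 + \<rho> (int (r n) + 2)) * L.primal_gap (int (r n) + 1)) \<longlonglongrightarrow> 0"
    proof (rule tendsto_sandwich[OF _ _ tendsto_const C0])
      show "eventually (\<lambda>n. 0 \<le> \<gamma> (int (r n) + 2) * (1 + \<rho> (int (r n) + 2)) * L.primal_gap (int (r n) + 1)) sequentially"
      proof (intro always_eventually allI mult_nonneg_nonneg)
        fix n
        show "0 \<le> \<gamma> (int (r n) + 2)" using gamma_pos[of "int (r n) + 2"] by simp
        show "0 \<le> 1 + \<rho> (int (r n) + 2)" using rho_pos[of "int (r n) + 2"] by simp
        show "0 \<le> L.primal_gap (int (r n) + 1)" by (rule L.primal_gap_nonneg_index) simp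
      qed
      have "\<gamma> (int (r n) + 2) * (1 + \<rho> (int (r n) + 2)) * L.primal_gap (int (r n) + 1)
          \<le> C * norm (x (int (r n) + 1) - xl)" if n: "nat M \<le> n" for n
      proof -
        define j where "j = int (r n) + 1"
        have "n \<le> r n" using r(1) by (rule seq_suble)
        then have j: "M \<le> j" "1 \<le> j" "j + 1 = int (r n) + 2" using n by (auto simp: j_def)
        have nx: "norm (x j - x (j - 1)) \<le> 2 * Rx"
          using norm_triangle_ineq4[of "x j" "x (j - 1)"] Rx[of j] Rx[of "j - 1"] j by simp
        have "\<gamma> (j + 1) * L.primal_gap j
            \<le> ((B + 1) * norm (x j - x (j - 1)) + \<gamma> (j + 1) * norm (adjoint A (y j - yl))) * norm (x j - xl)"
          by (rule L.scaled_primal_gap_le[OF j(2)]) (use B j in auto)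
        also have "\<dots> \<le> ((B + 1) * (2 * Rx) + K) * norm (x j - xl)"
          using nx drift_lim[OF j(1)] B(1) by (intro mult_right_mono add_mono mult_left_mono) auto
        finally have gp: "\<gamma> (j + 1) * L.primal_gap j \<le> ((B + 1) * (2 * Rx) + K) * norm (x j - xl)" .
        have "(1 + \<rho> (j + 1)) * (\<gamma> (j + 1) * L.primal_gap j) \<le> (1 + B) * (((B + 1) * (2 * Rx) + K) * norm (x j - xl))"
        proof (rule mult_mono[OF _ gp])
          show "1 + \<rho> (j + 1) \<le> 1 + B" using B(2)[of "j + 1"] j(2) by simp
          show "0 \<le> 1 + B" using B(1) by simp
          show "0 \<le> \<gamma> (j + 1) * L.primal_gap j"
            using gamma_pos[of "j + 1"] L.primal_gap_nonneg_index[of j] j(2) by simp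
        qed
        then show ?thesis unfolding C_def j_def[symmetric] j(3)[symmetric] by (simp add: mult_ac)
      qed
      then show "eventually (\<lambda>n. \<gamma> (int (r n) + 2) * (1 + \<rho> (int (r n) + 2)) * L.primal_gap (int (r n) + 1)
          \<le> C * norm (x (int (r n) + 1) - xl)) sequentially"
        unfolding eventually_sequentially by blast
    qed
    then show ?thesis using r sol by blast
  qed
  then obtain r xl yl where r: "strict_mono r" and sol: "primal_dual_solution gradf g h A xl yl"
    and lim: "(\<lambda>n. x (int (r n) + 2)) \<longlonglongrightarrow> xl" "(\<lambda>n. y (int (r n) + 2)) \<longlonglongrightarrow> yl"
      "(\<lambda>n. \<gamma> (int (r n) + 2) * (1 + \<rho> (int (r n) + 2))
            * adaptive_primal_dual_solution.primal_gap f g A x xl yl (int (r n) + 1)) \<longlonglongrightarrow> 0"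
    by blast
  interpret L: adaptive_primal_dual_solution f gradf g h A t \<epsilon> \<nu> \<eta>max x y \<gamma> \<sigma> \<eta> \<rho> \<xi> \<delta> xl yl
    by unfold_locales (rule sol)
  have "(\<lambda>n. x (int (n + 2))) \<longlonglongrightarrow> xl" "(\<lambda>n. y (int (n + 2))) \<longlonglongrightarrow> yl"
    using L.convergence_from_subsequence[OF \<epsilon> r lim] by (simp_all add: add_ac)
  then have "(\<lambda>n. x (int n)) \<longlonglongrightarrow> xl" "(\<lambda>n. y (int n)) \<longlonglongrightarrow> yl"
    using LIMSEQ_offset[of "\<lambda>n. x (int n)" 2] LIMSEQ_offset[of "\<lambda>n. y (int n)" 2] by auto
  then show ?thesis using sol by blast
qed

end

section \<open>Extended-real form of the conclusions\<close>

context adaptive_primal_dual_solution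
begin

definition primal_gap_ext where
  "primal_gap_ext k = (ereal (f (x k)) + g (x k)) - (ereal (f xs) + g xs) + ereal ((x k - xs) \<bullet> adjoint A ys)"

definition dual_gap_ext where
  "dual_gap_ext k = conjugate h (y k) - conjugate h ys + ereal (A xs \<bullet> (ys - y k))"

definition lyapunov_ext where
  "lyapunov_ext k = ereal (1 / 2 * (norm (x k - xs))\<^sup>2)
     + ereal ((1 - 4 * \<xi> k * (1 + \<epsilon>)) / 4 * (norm (x k - x (k - 1)))\<^sup>2)
     + ereal (1 / (2 * t\<^sup>2) * (norm (y k - ys))\<^sup>2)
     + ereal (\<gamma> k * (1 + \<rho> k)) * primal_gap_ext (k - 1)"

lemma primal_gap_ext_real: "g (x k) = ereal (g_val k) \<Longrightarrow> primal_gap_ext k = ereal (primal_gap k)"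
  unfolding primal_gap_ext_def primal_gap_def g_opt by simp

lemma dual_gap_ext_real: "1 \<le> k \<Longrightarrow> dual_gap_ext k = ereal (dual_gap k)"
  unfolding dual_gap_ext_def dual_gap_def h_opt by (simp add: h_val)

lemma lyapunov_ext_real:
  "g (x (k - 1)) = ereal (g_val (k - 1)) \<Longrightarrow> lyapunov_ext k = ereal (lyapunov k)"
  unfolding lyapunov_ext_def lyapunov_def by (simp add: primal_gap_ext_real)

lemma lyapunov_ext_descent:
  assumes k: "1 \<le> k"
  shows "lyapunov_ext (k + 1) \<le> lyapunov_ext k
      - ereal (\<epsilon> / (2 * t\<^sup>2 * (1 + \<epsilon>)) * (norm (y (k + 1) - y k))\<^sup>2)
      - ereal (residual_coefficient k * (norm (x k - x (k - 1)))\<^sup>2)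
      - ereal (\<gamma> k * (1 + \<rho> k - (\<rho> (k + 1))\<^sup>2)) * primal_gap_ext (k - 1)
      - ereal (\<gamma> (k + 1)) * dual_gap_ext (k + 1)"
proof (cases "g (x (k - 1)) = \<infinity>")
  case False
  then have fin: "g (x (k - 1)) = ereal (g_val (k - 1))"
    using g(1) unfolding g_val_def proper_fun_def by (cases "g (x (k - 1))") auto
  have "lyapunov_ext (k + 1) = ereal (lyapunov (k + 1))"
    using g_val[OF k] by (intro lyapunov_ext_real) simp
  moreover have "dual_gap_ext (k + 1) = ereal (dual_gap (k + 1))" using k by (simp add: dual_gap_ext_real)
  ultimately show ?thesis
    using lyapunov_descent[OF k fin]
    unfolding lyapunov_ext_real[OF fin] primal_gap_ext_real[OF fin] by simp
next
  case True
  \<comment> \<open>By \<open>g_val\<close> this occurs only for \<open>k = 1\<close>. The right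
    side is then infinite whatever is subtracted, as
    \<open>\<infinity> - \<infinity> = \<infinity>\<close>.\<close>
  have gap: "primal_gap_ext (k - 1) = \<infinity>" unfolding primal_gap_ext_def True g_opt by simp
  have "0 < \<gamma> k * (1 + \<rho> k)"
    using gamma_pos[of k] rho_pos[of k] k by (intro mult_pos_pos) auto
  then have "lyapunov_ext k = \<infinity>" unfolding lyapunov_ext_def gap by auto
  moreover have "dual_gap_ext (k + 1) = ereal (dual_gap (k + 1))" using k by (simp add: dual_gap_ext_real)
  ultimately show ?thesis by simp
qed

lemma primal_gap_ext_Liminf: "Liminf sequentially (\<lambda>n. primal_gap_ext (int n)) = 0"
proof (rule antisym)
  show "0 \<le> Liminf sequentially (\<lambda>n. primal_gap_ext (int n))"
  proof (rule Liminf_bounded)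
    show "eventually (\<lambda>n. 0 \<le> primal_gap_ext (int n)) sequentially"
      using eventually_ge_at_top[of 1]
      by eventually_elim (simp add: primal_gap_ext_real g_val primal_gap_nonneg_index)
  qed
  show "Liminf sequentially (\<lambda>n. primal_gap_ext (int n)) \<le> 0"
  proof (rule ccontr)
    assume "\<not> ?thesis"
    then have "0 < Liminf sequentially (\<lambda>n. primal_gap_ext (int n))" by simp
    then obtain p where p: "0 < ereal p" "ereal p < Liminf sequentially (\<lambda>n. primal_gap_ext (int n))"
      using ereal_dense2 by blast
    have "eventually (\<lambda>n. p \<le> primal_gap (int n)) sequentially"
      using less_LiminfD[OF p(2)] eventually_ge_at_top[of 1]
      by eventually_elim (simp add: primal_gap_ext_real g_val)
    with primal_gap_frequently_small[of p] p(1) show False by simp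
  qed
qed

lemma dual_gap_ext_tendsto: "(\<lambda>n. dual_gap_ext (int n)) \<longlonglongrightarrow> 0"
proof (rule Lim_transform_eventually)
  show "(\<lambda>n. ereal (dual_gap (int n))) \<longlonglongrightarrow> 0"
    using tendsto_ereal[OF dual_gap_tendsto] by (simp add: zero_ereal_def)
  show "eventually (\<lambda>n. ereal (dual_gap (int n)) = dual_gap_ext (int n)) sequentially"
    using eventually_ge_at_top[of 1] by eventually_elim (simp add: dual_gap_ext_real)
qed

end

theorem theorem3p3:
  fixes f :: "real ^ 'n \<Rightarrow> real"
    and gradf :: "real ^ 'n \<Rightarrow> real ^ 'n"
    and g :: "real ^ 'n \<Rightarrow> ereal"
    and h :: "real ^ 'm \<Rightarrow> ereal"
    and A :: "real ^ 'n \<Rightarrow> real ^ 'm"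
    and t \<epsilon> \<nu> \<eta>max :: real
    and x :: "int \<Rightarrow> real ^ 'n"
    and y :: "int \<Rightarrow> real ^ 'm"
    and \<gamma> \<sigma> \<eta> \<rho> \<xi> \<delta> :: "int \<Rightarrow> real"
  assumes f_convex: "convex_on UNIV f"
    and f_gradient: "\<And>z. GDERIV f z :> gradf z"
    and f_smooth: "locally_lipschitz gradf"
    and g: "proper_fun g" "convex_fun g" "lsc_fun g"
    and h: "proper_fun h" "convex_fun h" "lsc_fun h"
    and A: "linear A"
    and minimizer: "\<exists>z. is_arg_min (\<lambda>z. ereal (f z) + g z + h (A z)) (\<lambda>_. True) z"
    and qualification: "\<exists>z \<in> rel_interior (eff_dom g). A z \<in> rel_interior (eff_dom h)"
    and parameters: "0 < t" "0 \<le> \<epsilon>" "1 + \<epsilon> < \<nu>"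
    and initial_steps: "0 < \<gamma> (-1)" "\<gamma> (-1) \<le> \<gamma> 0"
    and y_update: "\<And>k. 0 \<le> k \<Longrightarrow>
      y (k + 1) = prox (\<sigma> (k + 1)) (conjugate h)
        (y k + \<sigma> (k + 1) *\<^sub>R ((1 + \<gamma> (k + 1) / \<gamma> k) *\<^sub>R A (x k)
                              - (\<gamma> (k + 1) / \<gamma> k) *\<^sub>R A (x (k - 1))))"
    and x_update: "\<And>k. 0 \<le> k \<Longrightarrow>
      x (k + 1) = prox (\<gamma> (k + 1)) g
        (x k - \<gamma> (k + 1) *\<^sub>R gradf (x k) - \<gamma> (k + 1) *\<^sub>R adjoint A (y (k + 1)))"
    and \<rho>: "\<And>k. 0 \<le> k \<Longrightarrow> \<rho> k = \<gamma> k / \<gamma> (k - 1)"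
    and \<xi>: "\<And>k. 0 \<le> k \<Longrightarrow> \<xi> k = t\<^sup>2 * (\<eta> k)\<^sup>2 * (\<gamma> k)\<^sup>2"
    and \<delta>: "\<And>k. 0 \<le> k \<Longrightarrow>
      \<delta> k = \<gamma> k * lip_est gradf (x (k - 1)) (x k)
              * (\<gamma> k * cocoercivity_est gradf (x (k - 1)) (x k) - 1)"
    and \<eta>_initial: "0 \<le> \<eta> 0" "\<eta> 0 \<le> 1 / (2 * \<nu> * t * \<gamma> 0)"
    and \<eta>_lower: "\<And>k. 0 \<le> k \<Longrightarrow>
      norm (adjoint A (y k - y (k + 1))) / norm (y k - y (k + 1)) \<le> \<eta> (k + 1)"
    and \<eta>_upper: "\<And>k. 0 \<le> k \<Longrightarrow> \<eta> (k + 1) \<le> \<eta>max"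
    and dual_steps: "\<And>k. 0 \<le> k \<Longrightarrow> \<sigma> k = t\<^sup>2 * \<gamma> k"
    and primal_steps: "\<And>k. 0 \<le> k \<Longrightarrow>
      ereal (\<gamma> (k + 1)) = Min {
        ereal (\<gamma> k * sqrt (1 + \<gamma> k / \<gamma> (k - 1))),
        1 / ereal (2 * \<nu> * t * \<eta> (k + 1)),
        ereal (\<gamma> k) * esqrt (ereal (1 - 4 * \<xi> k * (1 + \<epsilon>)\<^sup>2)
          / ereal (2 * (1 + \<epsilon>)
              * (sqrt ((\<delta> k)\<^sup>2 + (t * \<eta> (k + 1) * \<gamma> k)\<^sup>2 * (1 - 4 * \<xi> k * (1 + \<epsilon>)\<^sup>2)) + \<delta> k)))}"
  shows
    "(\<forall>xs ys. primal_dual_solution gradf g h A xs ys \<longrightarrow>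
       (let P = (\<lambda>k. (ereal (f (x k)) + g (x k)) - (ereal (f xs) + g xs)
                       + ereal ((x k - xs) \<bullet> adjoint A ys));
            Q = (\<lambda>k. conjugate h (y k) - conjugate h ys + ereal (A xs \<bullet> (ys - y k)));
            U = (\<lambda>k. ereal (1 / 2 * (norm (x k - xs))\<^sup>2)
                     + ereal ((1 - 4 * \<xi> k * (1 + \<epsilon>)) / 4 * (norm (x k - x (k - 1)))\<^sup>2)
                     + ereal (1 / (2 * t\<^sup>2) * (norm (y k - ys))\<^sup>2)
                     + ereal (\<gamma> k * (1 + \<rho> k)) * P (k - 1));
            C = (\<lambda>k. (1 - 4 * \<xi> k * (1 + \<epsilon>)
                      - 4 * (\<rho> (k + 1))\<^sup>2 * (\<delta> k + \<xi> (k + 1) * (1 + \<epsilon>))) / 4)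
        in (\<forall>k\<ge>1.
              U (k + 1) \<le> U k
                - ereal (\<epsilon> / (2 * t\<^sup>2 * (1 + \<epsilon>)) * (norm (y (k + 1) - y k))\<^sup>2)
                - ereal (C k * (norm (x k - x (k - 1)))\<^sup>2)
                - ereal (\<gamma> k * (1 + \<rho> k - (\<rho> (k + 1))\<^sup>2)) * P (k - 1)
                - ereal (\<gamma> (k + 1)) * Q (k + 1)
              \<and> C k \<ge> \<epsilon> / (4 * (1 + \<epsilon>))
              \<and> 1 + \<rho> k - (\<rho> (k + 1))\<^sup>2 \<ge> 0)
           \<and> Liminf sequentially (\<lambda>k. P (int k)) = 0
           \<and> (\<lambda>k. Q (int k)) \<longlonglongrightarrow> 0))
     \<and> bounded ((\<lambda>k. (x k, y k)) ` {1..})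
     \<and> (\<forall>V L. convex V \<and> compact V \<and> (\<forall>k\<ge>-1. x k \<in> V) \<and> 0 < L
           \<and> L-lipschitz_on {v + u | v u. v \<in> V \<and> norm u \<le> diameter V} gradf \<longrightarrow>
         (let \<nu>bar = (\<nu>\<^sup>2 - (1 + \<epsilon>)\<^sup>2) / \<nu>\<^sup>2;
              \<gamma>hat = Min {
                ereal (\<gamma> 0),
                ereal (\<nu>bar powr (1 / 4)) / ereal (sqrt (2 * (1 + \<epsilon>) * t * \<eta>max * L)),
                ereal (sqrt \<nu>bar) / ereal (2 * sqrt (1 + \<epsilon>) * L),
                1 / ereal (2 * \<nu> * t * \<eta>max),
                ereal (sqrt \<nu>bar) / ereal (2 * (1 + \<epsilon>) * t * \<eta>max)}
          in 0 < \<gamma>hat \<and> (\<forall>k\<ge>1. \<gamma>hat \<le> ereal (\<gamma> k))))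
     \<and> (0 < \<epsilon> \<longrightarrow>
         (\<exists>xs ys. primal_dual_solution gradf g h A xs ys
            \<and> (\<lambda>k. (x (int k), y (int k))) \<longlonglongrightarrow> (xs, ys)))"
proof -
  obtain z w where "primal_dual_solution gradf g h A z w" and conj: "proper_fun (conjugate h)"
    using primal_dual_solution_exists[OF f_gradient g(1,2) h(1,2) A minimizer qualification] .
  then have solvable: "\<exists>xs ys. primal_dual_solution gradf g h A xs ys" by blast
  interpret adaptive_primal_dual f gradf g h A t \<epsilon> \<nu> \<eta>max x y \<gamma> \<sigma> \<eta> \<rho> \<xi> \<delta>
    by (rule adaptive_primal_dual.intro; fact)
  show ?thesis
  proof (intro conjI)
    show "\<forall>xs ys. primal_dual_solution gradf g h A xs ys \<longrightarrow>
       (let P = (\<lambda>k. (ereal (f (x k)) + g (x k)) - (ereal (f xs) + g xs)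
                       + ereal ((x k - xs) \<bullet> adjoint A ys));
            Q = (\<lambda>k. conjugate h (y k) - conjugate h ys + ereal (A xs \<bullet> (ys - y k)));
            U = (\<lambda>k. ereal (1 / 2 * (norm (x k - xs))\<^sup>2)
                     + ereal ((1 - 4 * \<xi> k * (1 + \<epsilon>)) / 4 * (norm (x k - x (k - 1)))\<^sup>2)
                     + ereal (1 / (2 * t\<^sup>2) * (norm (y k - ys))\<^sup>2)
                     + ereal (\<gamma> k * (1 + \<rho> k)) * P (k - 1));
            C = (\<lambda>k. (1 - 4 * \<xi> k * (1 + \<epsilon>)
                      - 4 * (\<rho> (k + 1))\<^sup>2 * (\<delta> k + \<xi> (k + 1) * (1 + \<epsilon>))) / 4)
        in (\<forall>k\<ge>1.
              U (k + 1) \<le> U k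
                - ereal (\<epsilon> / (2 * t\<^sup>2 * (1 + \<epsilon>)) * (norm (y (k + 1) - y k))\<^sup>2)
                - ereal (C k * (norm (x k - x (k - 1)))\<^sup>2)
                - ereal (\<gamma> k * (1 + \<rho> k - (\<rho> (k + 1))\<^sup>2)) * P (k - 1)
                - ereal (\<gamma> (k + 1)) * Q (k + 1)
              \<and> C k \<ge> \<epsilon> / (4 * (1 + \<epsilon>))
              \<and> 1 + \<rho> k - (\<rho> (k + 1))\<^sup>2 \<ge> 0)
           \<and> Liminf sequentially (\<lambda>k. P (int k)) = 0
           \<and> (\<lambda>k. Q (int k)) \<longlonglongrightarrow> 0)"
      (is "\<forall>xs ys. _ \<longrightarrow> ?descent xs ys")
    proof (intro allI impI)
      fix xs ys assume s: "primal_dual_solution gradf g h A xs ys"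
      interpret adaptive_primal_dual_solution f gradf g h A t \<epsilon> \<nu> \<eta>max x y \<gamma> \<sigma> \<eta> \<rho> \<xi> \<delta> xs ys
        by unfold_locales (rule s)
      have "\<epsilon> / (4 * (1 + \<epsilon>)) \<le> residual_coefficient k" "0 \<le> 1 + \<rho> k - (\<rho> (k + 1))\<^sup>2" if "1 \<le> k" for k
        using residual_coefficient_lower[of k] rho_square_le[of k] that by auto
      with lyapunov_ext_descent primal_gap_ext_Liminf dual_gap_ext_tendsto
      show "?descent xs ys"
        unfolding Let_def lyapunov_ext_def primal_gap_ext_def dual_gap_ext_def residual_coefficient_def
        by blast
    qed
    have "bounded (x ` {-1..} \<times> y ` {1..})"
      using iterates_bounded by (rule bounded_Times)
    then show "bounded ((\<lambda>k. (x k, y k)) ` {1..})"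
      by (rule bounded_subset) auto
    show "\<forall>V L. convex V \<and> compact V \<and> (\<forall>k\<ge>-1. x k \<in> V) \<and> 0 < L
           \<and> L-lipschitz_on {v + u | v u. v \<in> V \<and> norm u \<le> diameter V} gradf \<longrightarrow>
         (let \<nu>bar = (\<nu>\<^sup>2 - (1 + \<epsilon>)\<^sup>2) / \<nu>\<^sup>2;
              \<gamma>hat = Min {
                ereal (\<gamma> 0),
                ereal (\<nu>bar powr (1 / 4)) / ereal (sqrt (2 * (1 + \<epsilon>) * t * \<eta>max * L)),
                ereal (sqrt \<nu>bar) / ereal (2 * sqrt (1 + \<epsilon>) * L),
                1 / ereal (2 * \<nu> * t * \<eta>max),
                ereal (sqrt \<nu>bar) / ereal (2 * (1 + \<epsilon>) * t * \<eta>max)}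
          in 0 < \<gamma>hat \<and> (\<forall>k\<ge>1. \<gamma>hat \<le> ereal (\<gamma> k)))"
      (is "\<forall>V L. _ \<longrightarrow> ?bound V L")
    proof (intro allI impI, elim conjE)
      fix V L assume V: "convex V" "compact V" "\<forall>k\<ge>-1. x k \<in> V" and "0 < L"
        and "L-lipschitz_on {v + u | v u. v \<in> V \<and> norm u \<le> diameter V} gradf"
      then have "0 < gamma_hat L \<and> (\<forall>k\<ge>1. gamma_hat L \<le> ereal (\<gamma> k))"
        using gamma_hat_bounds[of L V] compact_imp_bounded[OF V(2)] by simp
      then show "?bound V L"
        unfolding Let_def gamma_hat_def nu_bar_def .
    qed
    show "0 < \<epsilon> \<longrightarrow> (\<exists>xs ys. primal_dual_solution gradf g h A xs ys
            \<and> (\<lambda>k. (x (int k), y (int k))) \<longlonglongrightarrow> (xs, ys))"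
    proof
      assume "0 < \<epsilon>"
      then obtain xl yl where "primal_dual_solution gradf g h A xl yl"
        and "(\<lambda>k. x (int k)) \<longlonglongrightarrow> xl" "(\<lambda>k. y (int k)) \<longlonglongrightarrow> yl"
        using iterates_converge by blast
      then show "\<exists>xs ys. primal_dual_solution gradf g h A xs ys
            \<and> (\<lambda>k. (x (int k), y (int k))) \<longlonglongrightarrow> (xs, ys)"
        using tendsto_Pair by blast
    qed
  qed
qed

end
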